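(* Let $\rho:\mathbb{R}^d\to(0,\infty)$ be a critical radius function and let $L$ be a non-negative self-adjoint operator on $L^2(\mathbb{R}^d)$ such that the kernels $p_t(x,y)$ of the semigroup $e^{-tL}$ satisfy: for every $N>0$ there are constants $c,C>0$ such that $$|p_t(x,y)|\le \frac{C}{t^{d/2}}e^{-\frac{|x-y|^2}{ct}}\Big(1+\frac{\sqrt t}{\rho(x)}+\frac{\sqrt t}{\rho(y)}\Big)^{-N}\qquad\text{for all }x,y\in\mathbb{R}^d,\ t>0.$$ Let $\theta\ge0$, $0<\alpha<d$, $p<q$ and $1<p\le s\le q<\infty$. Assume that $\Phi$ and $\Psi$ are Young functions such that $\bar\Phi\in B_{p,s}$ and $\bar\Psi\in B_{q',s'}$. If a pair $(U,V)$ of matrix weights satisfies $$[U,V]_{p,q,\alpha,\psi_\theta,\Phi,\Psi}:=\sup_Q\frac{|Q|^{\alpha/d+1/q-1/p}}{\psi_{\theta/3}(Q)}\Big\|\big\|U(x)^{1/q}V(y)^{-1/q}\big\|_{\Phi_y,Q}\Big\|_{\Psi_x,Q}<\infty,$$ then $$\|L^{-\alpha/2}\vec f\|_{L^q(U)}\lesssim[U,V]_{p,q,\alpha,\psi_\theta,\Phi,\Psi}\|\vec f\|_{L^p(V^{p/q})}\qquad\text{for all }\vec f\in L^p(V^{p/q}).$$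
   Context: Critical radius function: $\rho:\mathbb{R}^d\to(0,\infty)$ for which there are constants $C_0,N_0>0$ with $C_0^{-1}\rho(x)(1+\frac{|x-y|}{\rho(x)})^{-N_0}\le\rho(y)\le C_0\rho(x)(1+\frac{|x-y|}{\rho(x)})^{\frac{N_0}{N_0+1}}$ for all $x,y\in\mathbb{R}^d$. For a cube $Q\subset\mathbb{R}^d$ with center $x_Q$ and side-length $l_Q$, $\psi_\theta(Q):=(1+l_Q/\rho(x_Q))^\theta$. A matrix weight $W:\mathbb{R}^d\to\mathbb{C}^{n\times n}$ is a self-adjoint matrix function with locally integrable entries which is positive definite almost everywhere; powers are defined by the spectral calculus. $L^r(W)$ is the space of measurable $\vec f:\mathbb{R}^d\to\mathbb{C}^n$ with $\|\vec f\|_{L^r(W)}:=(\int|W(x)^{1/r}\vec f(x)|^rdx)^{1/r}<\infty$; in particular $\|\vec f\|_{L^p(V^{p/q})}=(\int|V(x)^{1/q}\vec f(x)|^pdx)^{1/p}$. A Young function is a continuous, increasing, convex $\Phi:[0,\infty)\to[0,\infty)$ with $\Phi(0)=0$ and $\lim_{t\to\infty}\Phi(t)/t=\infty$; its complementary function is $\bar\Phi(t)=\sup_{s>0}\{st-\Phi(s)\}$. For $1<a\le b<\infty$, a Young function $A$ is in $B_{a,b}$ if $\int_1^\infty\frac{A(t)^{b/a}}{t^b}\frac{dt}{t}<\infty$. The localized Orlicz norm is $\|f\|_{\Phi,Q}:=\inf\{\lambda>0:\frac1{|Q|}\int_Q\Phi(|f(x)|/\lambda)dx\le1\}$; for matrix-valued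 functions, the norm of the scalar function obtained by taking the operator norm $|\cdot|_{op}$. $\|\cdot\|_{\Phi_y,Q}$ (resp. $\|\cdot\|_{\Psi_x,Q}$) means the Orlicz norm is taken in the variable $y$ (resp. $x$). The supremum is over all cubes $Q$. $L^{-\alpha/2}f(x):=\int_0^\infty e^{-tL}f(x)\,t^{\frac{\alpha}{2}-1}dt$, acting componentwise on $\mathbb{C}^n$-valued functions (where $e^{-tL}f(x)=\int p_t(x,y)f(y)dy$). $A\lesssim B$ means $A\le CB$ with $C$ independent of $U,V,\vec f$ (it may depend on $d,n,p,q,s,\alpha,\theta,\rho,L,\Phi,\Psi$). $r'=r/(r-1)$. *)

theory Defs
  imports "HOL-Analysis.Analysis"
begin

section \<open>Critical radius functions and cubes\<close>

definition critical_radius :: "(real^'d \<Rightarrow> real) \<Rightarrow> bool" where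
  "critical_radius \<rho> \<longleftrightarrow> (\<forall>x. \<rho> x > 0) \<and>
     (\<exists>C0>0. \<exists>N0>0. \<forall>x y.
        inverse C0 * \<rho> x * (1 + norm (x - y) / \<rho> x) powr (- N0) \<le> \<rho> y \<and>
        \<rho> y \<le> C0 * \<rho> x * (1 + norm (x - y) / \<rho> x) powr (N0 / (N0 + 1)))"

text \<open>Cubes have sides parallel to the axes; \<open>cube x l\<close> has center \<open>x\<close> and side-length \<open>l\<close>.\<close>

definition cube :: "real^'d \<Rightarrow> real \<Rightarrow> (real^'d) set" where
  "cube x l = cbox (x - vec (l / 2)) (x + vec (l / 2))"

definition psi :: "(real^'d \<Rightarrow> real) \<Rightarrow> real \<Rightarrow> real^'d \<Rightarrow> real \<Rightarrow> real" where
  "psi \<rho> \<theta> x l = (1 + l / \<rho> x) powr \<theta>"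


section \<open>Matrix weights\<close>

definition cinner_vec :: "complex^'n \<Rightarrow> complex^'n \<Rightarrow> complex" where
  "cinner_vec u v = (\<Sum>i\<in>UNIV. u $ i * cnj (v $ i))"

definition adj :: "complex^'n^'n \<Rightarrow> complex^'n^'n" where
  "adj A = (\<chi> i j. cnj (A $ j $ i))"

definition hermitian :: "complex^'n^'n \<Rightarrow> bool" where
  "hermitian A \<longleftrightarrow> adj A = A"

definition pos_def :: "complex^'n^'n \<Rightarrow> bool" where
  "pos_def A \<longleftrightarrow> hermitian A \<and> (\<forall>v. v \<noteq> 0 \<longrightarrow> 0 < Re (cinner_vec (A *v v) v))"

definition unitary :: "complex^'n^'n \<Rightarrow> bool" where
  "unitary A \<longleftrightarrow> adj A ** A = mat 1 \<and> A ** adj A = mat 1"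

definition diag :: "('n \<Rightarrow> real) \<Rightarrow> complex^'n^'n" where
  "diag a = (\<chi> i j. if i = j then complex_of_real (a i) else 0)"

text \<open>
  The spectral calculus: if \<open>A = S diag(a) S*\<close> with \<open>S\<close> unitary and \<open>a\<close> real, then
  \<open>g(A) = S diag(g(a)) S*\<close>, which does not depend on the choice of \<open>S\<close> and \<open>a\<close>.
  Only hermitian \<open>A\<close> are meaningful arguments.
\<close>

definition spectral_fun :: "(real \<Rightarrow> real) \<Rightarrow> complex^'n^'n \<Rightarrow> complex^'n^'n" where
  "spectral_fun g A =
     (THE B. \<exists>S a. unitary S \<and> A = S ** diag a ** adj S \<and> B = S ** diag (\<lambda>i. g (a i)) ** adj S)"

definition mpow :: "complex^'n^'n \<Rightarrow> real \<Rightarrow> complex^'n^'n" where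
  "mpow A r = spectral_fun (\<lambda>a. a powr r) A"

definition op_norm :: "complex^'n^'n \<Rightarrow> real" where
  "op_norm A = onorm ((*v) A)"

definition matrix_weight :: "(real^'d \<Rightarrow> complex^'n^'n) \<Rightarrow> bool" where
  "matrix_weight W \<longleftrightarrow>
     (\<forall>x. hermitian (W x)) \<and>
     (\<forall>i j K. compact K \<longrightarrow> set_integrable lebesgue K (\<lambda>x. W x $ i $ j)) \<and>
     (AE x in lebesgue. pos_def (W x))"

definition ennreal_powr :: "ennreal \<Rightarrow> real \<Rightarrow> ennreal" where
  "ennreal_powr z a = (if z = \<infinity> then \<infinity> else ennreal (enn2real z powr a))"

definition weighted_norm :: "real \<Rightarrow> (real^'d \<Rightarrow> complex^'n^'n) \<Rightarrow> (real^'d \<Rightarrow> complex^'n) \<Rightarrow> ennreal" where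
  "weighted_norm r W f =
     ennreal_powr (\<integral>\<^sup>+x. ennreal (norm (mpow (W x) (1 / r) *v f x) powr r) \<partial>lebesgue) (1 / r)"

definition weighted_space :: "real \<Rightarrow> (real^'d \<Rightarrow> complex^'n^'n) \<Rightarrow> (real^'d \<Rightarrow> complex^'n) set" where
  "weighted_space r W = {f. f \<in> borel_measurable lebesgue \<and> weighted_norm r W f < \<infinity>}"


section \<open>Young functions and Orlicz norms\<close>

text \<open>Young functions live on \<open>[0,\<infinity>)\<close>; their values at negative arguments are never used.
  Increasing is meant in the weak sense, so that complementary functions of Young functions
  are again Young functions.\<close>

definition young_function :: "(real \<Rightarrow> real) \<Rightarrow> bool" where
  "young_function \<Phi> \<longleftrightarrow>
     (\<forall>t\<ge>0. \<Phi> t \<ge> 0) \<and> continuous_on {0..} \<Phi> \<and> mono_on {0..} \<Phi> \<and> convex_on {0..} \<Phi> \<and>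
     \<Phi> 0 = 0 \<and> filterlim (\<lambda>t. \<Phi> t / t) at_top at_top"

definition complementary :: "(real \<Rightarrow> real) \<Rightarrow> real \<Rightarrow> real" where
  "complementary \<Phi> t = (SUP s\<in>{0<..}. s * t - \<Phi> s)"

definition B_class :: "real \<Rightarrow> real \<Rightarrow> (real \<Rightarrow> real) set" where
  "B_class a b = {A. young_function A \<and>
     (\<integral>\<^sup>+t\<in>{1..}. ennreal (A t powr (b / a) / t powr b / t) \<partial>lborel) < \<infinity>}"

text \<open>The Orlicz norm is defined for \<open>[0,\<infinity>]\<close>-valued functions, since the inner norm in the
  bump condition may be infinite; accordingly \<open>\<Phi>\<close> is extended by \<open>\<Phi>(\<infinity>) = \<infinity>\<close>.
  The infimum of the empty set is \<open>\<infinity>\<close>.\<close>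

definition young_ext :: "(real \<Rightarrow> real) \<Rightarrow> ennreal \<Rightarrow> ennreal" where
  "young_ext \<Phi> z = (if z = \<infinity> then \<infinity> else ennreal (\<Phi> (enn2real z)))"

definition orlicz_norm :: "(real \<Rightarrow> real) \<Rightarrow> (real^'d) set \<Rightarrow> (real^'d \<Rightarrow> ennreal) \<Rightarrow> ennreal" where
  "orlicz_norm \<Phi> Q f =
     Inf {ennreal c | c. c > 0 \<and>
       (\<integral>\<^sup>+x\<in>Q. young_ext \<Phi> (f x / ennreal c) \<partial>lebesgue) / emeasure lebesgue Q \<le> 1}"

definition bump_const ::
  "(real^'d \<Rightarrow> real) \<Rightarrow> real \<Rightarrow> real \<Rightarrow> real \<Rightarrow> real \<Rightarrow> (real \<Rightarrow> real) \<Rightarrow> (real \<Rightarrow> real) \<Rightarrow>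
   (real^'d \<Rightarrow> complex^'n^'n) \<Rightarrow> (real^'d \<Rightarrow> complex^'n^'n) \<Rightarrow> ennreal" where
  "bump_const \<rho> p q \<alpha> \<theta> \<Phi> \<Psi> U V =
     (SUP (z, l)\<in>UNIV \<times> {0<..}.
        ennreal (measure lebesgue (cube z l) powr (\<alpha> / real CARD('d) + 1 / q - 1 / p)
                 / psi \<rho> (\<theta> / 3) z l) *
        orlicz_norm \<Psi> (cube z l) (\<lambda>x.
          orlicz_norm \<Phi> (cube z l) (\<lambda>y.
            ennreal (op_norm (mpow (U x) (1 / q) ** mpow (V y) (- 1 / q))))))"


section \<open>Operators on \<open>L\<^sup>2\<close> and semigroups\<close>

text \<open>
  Elements of \<open>L\<^sup>2\<close> are represented by functions, with almost everywhere equality in place of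
  equality. An unbounded operator is represented by its graph, a set of pairs of functions that
  is closed under almost everywhere equality.
\<close>

definition L2fun :: "('a::euclidean_space \<Rightarrow> complex) set" where
  "L2fun = {f. f \<in> borel_measurable lebesgue \<and> integrable lebesgue (\<lambda>x. (norm (f x))\<^sup>2)}"

definition L2inner :: "('a::euclidean_space \<Rightarrow> complex) \<Rightarrow> ('a \<Rightarrow> complex) \<Rightarrow> complex" where
  "L2inner f g = (LINT x|lebesgue. f x * cnj (g x))"

definition L2norm :: "('a::euclidean_space \<Rightarrow> complex) \<Rightarrow> real" where
  "L2norm f = sqrt (LINT x|lebesgue. (norm (f x))\<^sup>2)"

type_synonym 'a L2op = "(('a \<Rightarrow> complex) \<times> ('a \<Rightarrow> complex)) set"

definition densely_defined :: "'a::euclidean_space L2op \<Rightarrow> bool" where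
  "densely_defined L \<longleftrightarrow> (\<forall>f\<in>L2fun. \<forall>\<epsilon>>0. \<exists>(u, v)\<in>L. L2norm (\<lambda>x. f x - u x) < \<epsilon>)"

definition adjoint_op :: "'a::euclidean_space L2op \<Rightarrow> 'a L2op" where
  "adjoint_op L = {(f, g). f \<in> L2fun \<and> g \<in> L2fun \<and> (\<forall>(u, v)\<in>L. L2inner v f = L2inner u g)}"

text \<open>The equation \<open>adjoint_op L = L\<close> makes \<open>L\<close> linear and closed under almost everywhere
  equality, and together with density of the domain it makes \<open>L\<close> single-valued up to
  almost everywhere equality.\<close>

definition selfadjoint_op :: "'a::euclidean_space L2op \<Rightarrow> bool" where
  "selfadjoint_op L \<longleftrightarrow> L \<subseteq> L2fun \<times> L2fun \<and> densely_defined L \<and> adjoint_op L = L"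

definition nonneg_op :: "'a::euclidean_space L2op \<Rightarrow> bool" where
  "nonneg_op L \<longleftrightarrow> (\<forall>(f, g)\<in>L. 0 \<le> Re (L2inner g f))"

definition C0_semigroup :: "(real \<Rightarrow> ('a::euclidean_space \<Rightarrow> complex) \<Rightarrow> ('a \<Rightarrow> complex)) \<Rightarrow> bool" where
  "C0_semigroup T \<longleftrightarrow>
     (\<forall>t\<ge>0. \<forall>f\<in>L2fun. T t f \<in> L2fun) \<and>
     (\<forall>t\<ge>0. \<forall>f\<in>L2fun. \<forall>g\<in>L2fun. \<forall>a b.
        AE x in lebesgue. T t (\<lambda>y. a * f y + b * g y) x = a * T t f x + b * T t g x) \<and>
     (\<forall>t\<ge>0. \<exists>M. \<forall>f\<in>L2fun. L2norm (T t f) \<le> M * L2norm f) \<and>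
     (\<forall>f\<in>L2fun. AE x in lebesgue. T 0 f x = f x) \<and>
     (\<forall>s\<ge>0. \<forall>t\<ge>0. \<forall>f\<in>L2fun. AE x in lebesgue. T (s + t) f x = T s (T t f) x) \<and>
     (\<forall>f\<in>L2fun. ((\<lambda>t. L2norm (\<lambda>x. T t f x - f x)) \<longlongrightarrow> 0) (at_right 0))"

definition generator :: "(real \<Rightarrow> ('a::euclidean_space \<Rightarrow> complex) \<Rightarrow> ('a \<Rightarrow> complex)) \<Rightarrow> 'a L2op" where
  "generator T = {(f, g). f \<in> L2fun \<and> g \<in> L2fun \<and>
     ((\<lambda>t. L2norm (\<lambda>x. (T t f x - f x) / complex_of_real t - g x)) \<longlongrightarrow> 0) (at_right 0)}"

text \<open>\<open>T t = e\<^sup>-\<^sup>t\<^sup>L\<close>: the strongly continuous semigroup generated by \<open>-L\<close>.\<close>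

definition exp_semigroup ::
  "'a::euclidean_space L2op \<Rightarrow> (real \<Rightarrow> ('a \<Rightarrow> complex) \<Rightarrow> ('a \<Rightarrow> complex)) \<Rightarrow> bool" where
  "exp_semigroup L T \<longleftrightarrow> C0_semigroup T \<and> generator T = {(f, \<lambda>x. - g x) | f g. (f, g) \<in> L}"

definition kernel_op :: "('a::euclidean_space \<Rightarrow> 'a \<Rightarrow> complex) \<Rightarrow> ('a \<Rightarrow> complex) \<Rightarrow> 'a \<Rightarrow> complex" where
  "kernel_op k f x = (LINT y|lebesgue. k x y * f y)"

text \<open>Joint measurability in all variables is what makes the \<open>t\<close>-integral of
  \<open>kernel_op (k t) f x\<close> for fixed \<open>x\<close> meaningful.\<close>

definition semigroup_kernel ::
  "(real \<Rightarrow> ('a::euclidean_space \<Rightarrow> complex) \<Rightarrow> ('a \<Rightarrow> complex)) \<Rightarrow> (real \<Rightarrow> 'a \<Rightarrow> 'a \<Rightarrow> complex) \<Rightarrow> bool" where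
  "semigroup_kernel T k \<longleftrightarrow>
     (\<lambda>(t, x, y). k t x y) \<in> borel_measurable (lebesgue_on ({0<..} \<times> UNIV)) \<and>
     (\<forall>t>0. (\<lambda>(x, y). k t x y) \<in> borel_measurable lebesgue) \<and>
     (\<forall>t>0. \<forall>f\<in>L2fun. AE x in lebesgue.
        integrable lebesgue (\<lambda>y. k t x y * f y) \<and> T t f x = kernel_op (k t) f x)"

definition gaussian_bounds :: "(real^'d \<Rightarrow> real) \<Rightarrow> (real \<Rightarrow> real^'d \<Rightarrow> real^'d \<Rightarrow> complex) \<Rightarrow> bool" where
  "gaussian_bounds \<rho> k \<longleftrightarrow>
     (\<forall>N>0. \<exists>c>0. \<exists>C>0. \<forall>x y. \<forall>t>0.
        norm (k t x y) \<le> C / t powr (real CARD('d) / 2) * exp (- (norm (x - y))\<^sup>2 / (c * t)) *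
          (1 + sqrt t / \<rho> x + sqrt t / \<rho> y) powr (- N))"


section \<open>The negative power \<open>L\<^sup>-\<^sup>\<alpha>\<^sup>/\<^sup>2\<close>\<close>

definition frac_integrand ::
  "(real \<Rightarrow> 'a::euclidean_space \<Rightarrow> 'a \<Rightarrow> complex) \<Rightarrow> real \<Rightarrow> ('a \<Rightarrow> complex) \<Rightarrow> 'a \<Rightarrow> real \<Rightarrow> complex" where
  "frac_integrand k \<alpha> f x t = kernel_op (k t) f x * complex_of_real (t powr (\<alpha> / 2 - 1))"

definition frac_power ::
  "(real \<Rightarrow> 'a::euclidean_space \<Rightarrow> 'a \<Rightarrow> complex) \<Rightarrow> real \<Rightarrow> ('a \<Rightarrow> complex^'n) \<Rightarrow> 'a \<Rightarrow> complex^'n" where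
  "frac_power k \<alpha> f x = (\<chi> i. LINT t:{0<..}|lebesgue. frac_integrand k \<alpha> (\<lambda>y. f y $ i) x t)"

text \<open>Since divergent Bochner integrals have the value \<open>0\<close>, convergence of the integrals that
  define \<open>frac_power\<close> has to be stated separately.\<close>

definition frac_power_converges ::
  "(real \<Rightarrow> 'a::euclidean_space \<Rightarrow> 'a \<Rightarrow> complex) \<Rightarrow> real \<Rightarrow> ('a \<Rightarrow> complex^'n) \<Rightarrow> bool" where
  "frac_power_converges k \<alpha> f \<longleftrightarrow> (AE x in lebesgue. \<forall>i.
     (AE t in lebesgue. t > 0 \<longrightarrow> integrable lebesgue (\<lambda>y. k t x y * f y $ i)) \<and>
     set_integrable lebesgue {0<..} (frac_integrand k \<alpha> (\<lambda>y. f y $ i) x))"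

end

theory Submission
  imports Defs
begin

text \<open>
  Integrating the gaussian bounds in \<open>t\<close> dominates the kernel of \<open>L\<^sup>-\<^sup>\<alpha>\<^sup>/\<^sup>2\<close> by a sum over dyadic cubes \<open>Q\<close>
  of \<open>|Q|\<^bsup>\<alpha>/d-1\<^esup> / \<psi>(3Q)\<close>, where \<open>x\<close> lies in \<open>Q\<close> and \<open>y\<close> in a neighbour \<open>Q + e\<close> of the same size. With the
  weight \<open>|U(x)\<^bsup>1/q\<^esup> V(y)\<^bsup>-1/q\<^esup>|\<close> inserted, two applications of the Orlicz space Hoelder inequality on
  \<open>3Q\<close>, the bump condition and duality reduce the theorem, for scalar \<open>h\<close> and \<open>g\<close>, to
  \<open>\<Sum>\<^sub>Q |Q|\<^bsup>1/p+1/q'\<^esup> a(Q + e) b(Q) \<lesssim> \<parallel>h\<parallel>\<^sub>p \<parallel>g\<parallel>\<^bsub>q'\<^esub>\<close>, where \<open>a\<close> and \<open>b\<close> are the Orlicz averages of \<open>h\<close>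
  and \<open>g\<close> for the complementary functions of \<open>\<Phi>\<close> and \<open>\<Psi>\<close>.

  Since \<open>p < q\<close>, one of \<open>p < s\<close> and \<open>s < q\<close> holds. The cubes are grouped below the maximal cubes of
  the level sets \<open>a > 2\<^sup>j\<close> of the other factor; the sum over subcubes is geometric because
  \<open>1/p + 1/q' > 1\<close>. The conditions \<open>B\<^bsub>p,s\<^esub>\<close> and \<open>B\<^bsub>q',s'\<^esub>\<close> bound the \<open>\<ell>\<^sup>s\<close> and \<open>\<ell>\<^bsup>s'\<^esup>\<close> sums over such maximal
  cubes.
\<close>

section \<open>Spectral calculus of positive definite matrices\<close>

text \<open>A critical radius function grows with an exponent N0/(N0+1) < 1, so decay of high order
  in 1+l/\<rho>(x) beats any fixed power of 1+l/\<rho>(z) when |x-z| is at most a multiple of l, and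
  \<open>psi\<close> may be taken at the centre of a cube. Then \<rho> and \<alpha> disappear:
  |Q|^(\<alpha>/d-1) from the kernel, |3Q|^2 from the Hoelder steps and |3Q|^(-(\<alpha>/d+1/q-1/p))
  from the bump condition combine to |Q|^(1+1/p-1/q) up to a constant.

  At p = s only the sum over maximal cubes is bounded here; the sum over all cubes uses p < s. The
  bilinear sum therefore takes maximal cubes of one factor and all cubes of the other, which fit
  together because a cube is maximal for boundedly many levels. Neighbours stay in one grid:
  ancestors of neighbours are neighbours of ancestors.

  The matrices enter only through |U(x)^(1/q) f(y)| \<le> |U(x)^(1/q) V(y)^(-1/q)| |V(y)^(1/q)
  f(y)|. The weights are merely Lebesgue measurable, so iterated integrals are computed with Borel
  representatives; a divergent integral has the value 0, so convergence has to come out of the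
  estimate itself.\<close>

lemma inner_eq_Re_cinner: "u \<bullet> v = Re (cinner_vec u v)" for u v :: "complex^'n"
  by (simp add: inner_vec_def cinner_vec_def inner_complex_def)

lemma cinner_self: "cinner_vec v v = complex_of_real ((norm v)\<^sup>2)"
proof -
  have "cinner_vec v v = (\<Sum>i\<in>UNIV. complex_of_real ((norm (v $ i))\<^sup>2))"
    unfolding cinner_vec_def by (intro sum.cong refl complex_norm_square[symmetric])
  also have "\<dots> = complex_of_real ((norm v)\<^sup>2)"
    by (simp add: norm_vec_def L2_set_def sum_nonneg)
  finally show ?thesis .
qed

lemma cinner_adj: "cinner_vec (A *v u) v = cinner_vec u (adj A *v v)"
proof -
  have "cinner_vec (A *v u) v = (\<Sum>i\<in>UNIV. \<Sum>j\<in>UNIV. A $ i $ j * u $ j * cnj (v $ i))"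
    by (simp add: cinner_vec_def matrix_vector_mult_def sum_distrib_right)
  also have "\<dots> = (\<Sum>j\<in>UNIV. \<Sum>i\<in>UNIV. A $ i $ j * u $ j * cnj (v $ i))"
    by (rule sum.swap)
  also have "\<dots> = cinner_vec u (adj A *v v)"
    by (simp add: cinner_vec_def matrix_vector_mult_def adj_def sum_distrib_left mult_ac)
  finally show ?thesis .
qed

lemma cinner_add_left: "cinner_vec (u + v) w = cinner_vec u w + cinner_vec v w"
  by (simp add: cinner_vec_def distrib_right sum.distrib)

lemma cinner_smult_left: "cinner_vec (c *s u) w = c * cinner_vec u w"
  by (simp add: cinner_vec_def sum_distrib_left mult_ac)

lemma cinner_smult_right: "cinner_vec u (c *s w) = cnj c * cinner_vec u w"
  by (simp add: cinner_vec_def sum_distrib_left mult_ac)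

lemma scaleR_eq_smult: "r *\<^sub>R v = complex_of_real r *s v" for v :: "complex^'n"
  by (simp only: vec_eq_iff vector_scaleR_component vector_smult_component scaleR_conv_of_real[where 'a=complex])
    simp

lemma cinner_scaleR_left: "cinner_vec (r *\<^sub>R u) w = of_real r * cinner_vec u w"
  by (simp add: scaleR_eq_smult cinner_smult_left)

lemma cinner_cnj: "cinner_vec v u = cnj (cinner_vec u v)"
  by (simp add: cinner_vec_def mult_ac)

lemma bounded_linear_matrix_vector: "bounded_linear ((*v) A)" for A :: "complex^'n^'m"
proof -
  have "linear ((*v) A)"
    by (rule linearI) (simp_all add: vec_eq_iff matrix_vector_mult_def distrib_left sum.distrib scaleR_sum_right)
  then show ?thesis by (simp add: linear_conv_bounded_linear)
qed

text \<open>A zero row excludes a right inverse, hence also a left inverse, and a square matrix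
  without left inverse has a kernel. This replaces a dimension count: fewer than n orthogonality
  conditions, written as a square matrix with a zero row, have a common nonzero solution.\<close>

lemma exists_nonzero_kernel_of_zero_row:
  fixes B :: "complex^'n^'n"
  assumes "\<And>k. B $ i $ k = 0"
  shows "\<exists>w. w \<noteq> 0 \<and> B *v w = 0"
proof (rule ccontr)
  assume "\<not> ?thesis"
  then have "\<exists>C. C ** B = mat 1"
    using matrix_left_invertible_ker[of B] by blast
  then obtain C where C: "C ** B = mat 1" by blast
  then have "B ** C = mat 1" using matrix_left_right_inverse by blast
  then have "(B ** C) $ i $ i = 1" by (simp add: mat_def)
  then show False using assms by (simp add: matrix_matrix_mult_def)
qed

lemma hermitian_inner_sym:
  assumes "hermitian A"
  shows "(A *v u) \<bullet> v = u \<bullet> (A *v v)"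
  using assms by (simp add: inner_eq_Re_cinner cinner_adj hermitian_def)

text \<open>The orthogonal complement \<open>W\<close> of the given eigenvectors is invariant under
  \<open>A\<close>, and a maximiser of the quadratic form of \<open>A\<close> on the unit sphere of
  \<open>W\<close> is an eigenvector. The variation uses the real inner product
  \<open>\<bullet>\<close>, so real parameters suffice. The index \<open>i\<close> outside
  \<open>F\<close> guarantees that \<open>W\<close> is not zero.\<close>

lemma eigenvector_orthogonal_to_eigenvectors:
  fixes A :: "complex^'n^'n" and v :: "'n \<Rightarrow> complex^'n"
  assumes A: "hermitian A" and iF: "i \<notin> F"
    and eig: "\<And>j. j \<in> F \<Longrightarrow> A *v v j = complex_of_real (a j) *s v j"
  shows "\<exists>w \<mu>. norm w = 1 \<and> (\<forall>j\<in>F. cinner_vec w (v j) = 0) \<and> A *v w = complex_of_real \<mu> *s w"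
proof -
  define W where "W = {w. \<forall>j\<in>F. cinner_vec w (v j) = 0}"
  \<comment> \<open>The kernel of \<open>B\<close> is \<open>W\<close>; its row \<open>i\<close>
    vanishes because \<open>i\<close> is not in \<open>F\<close>.\<close>
  define B :: "complex^'n^'n" where "B = (\<chi> j k. if j \<in> F then cnj (v j $ k) else 0)"
  obtain w0 where w0: "w0 \<noteq> 0" "B *v w0 = 0"
    using exists_nonzero_kernel_of_zero_row[of B i] iF by (auto simp: B_def)
  have "cinner_vec w0 (v j) = (B *v w0) $ j" if "j \<in> F" for j
    using that by (simp add: B_def matrix_vector_mult_def cinner_vec_def mult_ac)
  then have w0W: "w0 \<in> W" using w0 by (simp add: W_def)
  have W_scale: "r *\<^sub>R x \<in> W" if "x \<in> W" for r x
    using that by (simp add: W_def cinner_scaleR_left)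
  have W_add: "x + y \<in> W" if "x \<in> W" "y \<in> W" for x y
    using that by (simp add: W_def cinner_add_left)
  have W_A: "A *v x \<in> W" if "x \<in> W" for x
  proof -
    have "cinner_vec (A *v x) (v j) = 0" if "j \<in> F" for j
    proof -
      have "cinner_vec (A *v x) (v j) = cinner_vec x (A *v v j)"
        using A by (simp add: cinner_adj hermitian_def)
      also have "\<dots> = 0" using that \<open>x \<in> W\<close> by (simp add: eig cinner_smult_right W_def)
      finally show ?thesis .
    qed
    then show ?thesis by (simp add: W_def)
  qed
  have "closed W"
  proof -
    have "W = (\<Inter>j\<in>F. {w. cinner_vec w (v j) = 0})" by (auto simp: W_def)
    moreover have "closed {w. cinner_vec w (v j) = 0}" for j
      unfolding cinner_vec_def by (intro closed_Collect_eq continuous_intros)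
    ultimately show ?thesis by auto
  qed
  then have comp: "compact (W \<inter> sphere 0 1)"
    by (simp add: closed_Int_compact)
  have ne: "W \<inter> sphere 0 1 \<noteq> {}"
  proof -
    have "(1 / norm w0) *\<^sub>R w0 \<in> W \<inter> sphere 0 1" using w0 w0W W_scale by auto
    then show ?thesis by blast
  qed
  have cont: "continuous_on (W \<inter> sphere 0 1) (\<lambda>x. (A *v x) \<bullet> x)"
    by (intro continuous_intros linear_continuous_on bounded_linear_matrix_vector)
  obtain w where w: "w \<in> W" "norm w = 1"
    and max: "\<And>x. x \<in> W \<Longrightarrow> norm x = 1 \<Longrightarrow> (A *v x) \<bullet> x \<le> (A *v w) \<bullet> w"
    using continuous_attains_sup[OF comp ne cont] by auto
  define \<mu> where "\<mu> = (A *v w) \<bullet> w"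
  define q where "q x = (A *v x) \<bullet> x - \<mu> * (x \<bullet> x)" for x
  have lin: "linear ((*v) A)" using bounded_linear_matrix_vector bounded_linear.linear by blast
  have q_le: "q x \<le> 0" if "x \<in> W" for x
  proof (cases "x = 0")
    case False
    define y where "y = (1 / norm x) *\<^sub>R x"
    have y: "y \<in> W" "norm y = 1" using that False W_scale by (auto simp: y_def)
    have x: "x = norm x *\<^sub>R y" using False by (simp add: y_def)
    have "q x = (norm x)\<^sup>2 * ((A *v y) \<bullet> y - \<mu>)"
      unfolding q_def by (subst (1 2 3 4) x)
        (simp add: linear_cmul[OF lin] power2_eq_square right_diff_distrib y power2_norm_eq_inner[symmetric])
    also have "\<dots> \<le> 0" using max[OF y] by (simp add: \<mu>_def mult_nonneg_nonpos)
    finally show ?thesis .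
  qed (simp add: q_def)
  \<comment> \<open>\<open>u\<close> is the defect of the eigenvalue equation and lies in
    \<open>W\<close>. Maximality at \<open>w\<close>, tested along w + t u, gives 2t|u|^2 + t^2 q(u)
    \<le> 0, which fails for small t > 0 unless u = 0.\<close>
  define u where "u = A *v w - \<mu> *\<^sub>R w"
  have uW: "u \<in> W" using W_add[OF W_A[OF w(1)] W_scale[OF w(1), of "- \<mu>"]] by (simp add: u_def)
  have wu: "u \<bullet> u = (A *v w) \<bullet> u - \<mu> * (w \<bullet> u)"
    by (simp add: u_def inner_diff_left)
  have exp: "q (w + t *\<^sub>R u) = 2 * t * (u \<bullet> u) + t\<^sup>2 * q u" for t
  proof -
    have "(A *v w) \<bullet> w = \<mu>" "w \<bullet> w = 1" using w by (simp_all add: \<mu>_def norm_eq_1)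
    moreover have "(A *v u) \<bullet> w = (A *v w) \<bullet> u" using hermitian_inner_sym[OF A, of u w] by (simp add: inner_commute)
    ultimately have "q (w + t *\<^sub>R u) = 2 * t * ((A *v w) \<bullet> u - \<mu> * (w \<bullet> u)) + t\<^sup>2 * q u"
      unfolding q_def linear_add[OF lin] linear_cmul[OF lin]
      by (simp add: inner_add_left inner_add_right inner_commute[of u w] power2_eq_square algebra_simps)
    then show ?thesis by (simp only: wu)
  qed
  have "u \<bullet> u = 0"
  proof (rule ccontr)
    assume "u \<bullet> u \<noteq> 0"
    then have pos: "u \<bullet> u > 0" using inner_ge_zero[of u] by linarith
    \<comment> \<open>With this choice t |q(u)| is at most |u|^2, half of the linear coefficient;
      the \<open>+ 1\<close> guards against q(u) = 0.\<close>
    define t where "t = (u \<bullet> u) / (\<bar>q u\<bar> + 1)"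
    have t: "t > 0" unfolding t_def using pos by (intro divide_pos_pos) auto
    have "t * \<bar>q u\<bar> \<le> u \<bullet> u"
    proof -
      have "t * \<bar>q u\<bar> = (u \<bullet> u) * (\<bar>q u\<bar> / (\<bar>q u\<bar> + 1))" by (simp add: t_def)
      also have "\<dots> \<le> (u \<bullet> u) * 1" by (intro mult_left_mono) (auto simp: divide_simps)
      finally show ?thesis by simp
    qed
    then have "t * q u \<ge> - (u \<bullet> u)" using t by (smt (verit) abs_mult abs_of_pos abs_le_iff)
    then have "0 < 2 * (u \<bullet> u) + t * q u" using pos by linarith
    then have "0 < t * (2 * (u \<bullet> u) + t * q u)" using t by simp
    also have "\<dots> = q (w + t *\<^sub>R u)" unfolding exp by (simp add: power2_eq_square algebra_simps)
    finally show False using q_le[OF W_add[OF w(1) W_scale[OF uW]], of t] by simp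
  qed
  then have "A *v w = complex_of_real \<mu> *s w" by (simp add: u_def scaleR_eq_smult)
  then show ?thesis using w by (auto simp: W_def)
qed

lemma orthonormal_eigenvectors:
  fixes A :: "complex^'n^'n" and I :: "'n set"
  assumes "hermitian A" and "finite I"
  shows "\<exists>v a. (\<forall>i\<in>I. A *v v i = complex_of_real (a i) *s v i) \<and>
    (\<forall>i\<in>I. \<forall>j\<in>I. cinner_vec (v i) (v j) = (if i = j then 1 else 0))"
  using assms(2)
proof (induction I rule: finite_induct)
  case (insert i F)
  then obtain v :: "'n \<Rightarrow> complex^'n" and a where va:
    "\<forall>i\<in>F. A *v v i = complex_of_real (a i) *s v i"
    "\<forall>i\<in>F. \<forall>j\<in>F. cinner_vec (v i) (v j) = (if i = j then 1 else 0)" by blast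
  obtain w \<mu> where w: "norm w = 1" "\<forall>j\<in>F. cinner_vec w (v j) = 0" "A *v w = complex_of_real \<mu> *s w"
    using eigenvector_orthogonal_to_eigenvectors[OF assms(1) insert.hyps(2), of v a] va by blast
  have w': "\<forall>j\<in>F. cinner_vec (v j) w = 0" using w(2) by (subst cinner_cnj) simp
  have "cinner_vec w w = 1" using w(1) by (simp add: cinner_self)
  then show ?case using va w w' insert.hyps
    by (intro exI[of _ "v(i := w)"] exI[of _ "a(i := \<mu>)"]) auto
qed simp

lemma spectral_decomposition:
  fixes A :: "complex^'n^'n"
  assumes "hermitian A"
  shows "\<exists>S a. unitary S \<and> A = S ** diag a ** adj S"
proof -
  obtain v :: "'n \<Rightarrow> complex^'n" and a where v:
    "\<And>i. A *v v i = complex_of_real (a i) *s v i"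
    "\<And>i j. cinner_vec (v i) (v j) = (if i = j then 1 else 0)"
    using orthonormal_eigenvectors[OF assms finite, of UNIV] by auto
  define S :: "complex^'n^'n" where "S = (\<chi> k i. v i $ k)"
  have "adj S ** S = mat 1"
    unfolding vec_eq_iff
  proof (intro allI)
    fix i j
    have "(adj S ** S) $ i $ j = cinner_vec (v j) (v i)"
      by (simp add: matrix_matrix_mult_def adj_def S_def cinner_vec_def mult_ac)
    then show "(adj S ** S) $ i $ j = mat 1 $ i $ j" by (auto simp: v mat_def)
  qed
  then have S: "adj S ** S = mat 1" "S ** adj S = mat 1"
    using matrix_left_right_inverse by blast+
  have "A ** S = S ** diag a"
    unfolding vec_eq_iff
  proof (intro allI)
    fix k i
    have "(A ** S) $ k $ i = (A *v v i) $ k"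
      by (simp add: matrix_matrix_mult_def matrix_vector_mult_def S_def)
    also have "\<dots> = of_real (a i) * v i $ k" by (simp add: v)
    also have "\<dots> = (S ** diag a) $ k $ i"
      by (simp add: matrix_matrix_mult_def S_def diag_def if_distrib[where f="(*) _"] mult_ac cong: if_cong)
    finally show "(A ** S) $ k $ i = (S ** diag a) $ k $ i" .
  qed
  then have "S ** diag a ** adj S = A ** (S ** adj S)" by (simp add: matrix_mul_assoc)
  then have "A = S ** diag a ** adj S" using S by simp
  then show ?thesis using S by (auto simp: unitary_def)
qed

text \<open>The matrix \<open>adj R ** S\<close> intertwines \<open>diag a\<close> and
  \<open>diag b\<close>, so each of its entries is zero or connects equal eigenvalues. It therefore
  also intertwines the diagonal matrices of the values of \<open>g\<close>. Hence the description
  that defines \<open>spectral_fun\<close> is unambiguous.\<close>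

lemma spectral_fun_unique:
  fixes S R :: "complex^'n^'n"
  assumes S: "unitary S" and R: "unitary R" and eq: "S ** diag a ** adj S = R ** diag b ** adj R"
  shows "S ** diag (\<lambda>i. g (a i)) ** adj S = R ** diag (\<lambda>i. g (b i)) ** adj R"
proof -
  define M where "M = adj R ** S"
  have SS: "adj S ** S = mat 1" "S ** adj S = mat 1" and RR: "adj R ** R = mat 1" "R ** adj R = mat 1"
    using S R by (auto simp: unitary_def)
  have "M ** diag a = adj R ** (S ** diag a ** adj S) ** S"
    by (simp add: M_def matrix_mul_assoc[symmetric] SS)
  also have "\<dots> = diag b ** M"
    unfolding eq by (simp add: M_def matrix_mul_assoc RR)
  finally have c: "M ** diag a = diag b ** M" .
  have l: "(M ** diag f) $ i $ j = M $ i $ j * of_real (f j)" for f i j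
    by (simp add: matrix_matrix_mult_def diag_def if_distrib[where f="(*) _"] cong: if_cong)
  have r: "(diag f ** M) $ i $ j = of_real (f i) * M $ i $ j" for f i j
    by (simp add: matrix_matrix_mult_def diag_def if_distrib[where f="\<lambda>x. x * _"] cong: if_cong)
  have "M ** diag (\<lambda>i. g (a i)) = diag (\<lambda>i. g (b i)) ** M"
    unfolding vec_eq_iff
  proof (intro allI)
    fix i j
    have "M $ i $ j * of_real (a j) = of_real (b i) * M $ i $ j"
      using c l[of a] r[of b] by metis
    then have "M $ i $ j = 0 \<or> a j = b i" by auto
    then show "(M ** diag (\<lambda>i. g (a i))) $ i $ j = (diag (\<lambda>i. g (b i)) ** M) $ i $ j"
      unfolding l r by auto
  qed
  then have "R ** (M ** diag (\<lambda>i. g (a i))) ** adj S = R ** (diag (\<lambda>i. g (b i)) ** M) ** adj S" by simp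
  moreover have "R ** (M ** D) ** adj S = S ** D ** adj S" for D
    by (simp add: M_def matrix_mul_assoc RR)
  moreover have "R ** (D ** M) ** adj S = R ** D ** adj R" for D
  proof -
    have "R ** (D ** M) ** adj S = R ** D ** adj R ** (S ** adj S)"
      unfolding M_def by (simp add: matrix_mul_assoc)
    then show ?thesis by (simp add: SS)
  qed
  ultimately show ?thesis by simp
qed

lemma mpow_decomposition:
  assumes "unitary S"
  shows "mpow (S ** diag a ** adj S) r = S ** diag (\<lambda>i. a i powr r) ** adj S"
  unfolding mpow_def spectral_fun_def
proof (rule the_equality)
  show "\<exists>S' a'. unitary S' \<and> S ** diag a ** adj S = S' ** diag a' ** adj S' \<and>
      S ** diag (\<lambda>i. a i powr r) ** adj S = S' ** diag (\<lambda>i. a' i powr r) ** adj S'"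
    using assms by blast
next
  fix B assume "\<exists>S' a'. unitary S' \<and> S ** diag a ** adj S = S' ** diag a' ** adj S' \<and>
      B = S' ** diag (\<lambda>i. a' i powr r) ** adj S'"
  then show "B = S ** diag (\<lambda>i. a i powr r) ** adj S"
    using spectral_fun_unique[OF assms, of _ a _ "\<lambda>x. x powr r"] by metis
qed

text \<open>The columns of \<open>S\<close> are eigenvectors, and testing positive definiteness on
  the \<open>i\<close>-th column shows that its eigenvalue is positive.\<close>

lemma pos_def_decomposition:
  fixes A :: "complex^'n^'n"
  assumes "pos_def A"
  obtains S a where "unitary S" "A = S ** diag a ** adj S" "\<And>i. a i > 0"
proof -
  obtain S a where S: "unitary S" and A: "A = S ** diag a ** adj S"
    using spectral_decomposition[of A] assms unfolding pos_def_def by blast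
  have SS: "adj S ** S = mat 1" using S by (simp add: unitary_def)
  have "a i > 0" for i
  proof -
    define e where "e = S *v axis i 1"
    have Se: "adj S *v e = axis i 1" by (simp add: e_def matrix_vector_mul_assoc SS)
    have "e \<noteq> 0"
    proof
      assume "e = 0"
      then have "axis i 1 = (0 :: complex^'n)" using Se by simp
      then show False by (simp add: axis_eq_0_iff)
    qed
    have "A *v e = S *v (diag a *v axis i 1)"
      unfolding A by (simp add: matrix_vector_mul_assoc[symmetric] Se)
    also have "diag a *v axis i 1 = of_real (a i) *s axis i 1"
      by (simp add: vec_eq_iff matrix_vector_mult_def diag_def axis_def if_distrib[where f="(*) _"] cong: if_cong)
    finally have "A *v e = of_real (a i) *s e"
      by (simp add: e_def vector_scalar_commute)
    then have "cinner_vec (A *v e) e = of_real (a i * (norm e)\<^sup>2)"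
      by (simp add: cinner_smult_left cinner_self)
    then show ?thesis using assms \<open>e \<noteq> 0\<close> by (auto simp: pos_def_def zero_less_mult_iff)
  qed
  then show ?thesis using that S A by blast
qed

lemma diag_mult: "diag a ** diag b = diag (\<lambda>i. a i * b i)"
  by (simp add: vec_eq_iff matrix_matrix_mult_def diag_def if_distrib[where f="\<lambda>x. x * _"] cong: if_cong)

lemma unitary_conj_mult:
  assumes "unitary S"
  shows "(S ** D ** adj S) ** (S ** E ** adj S) = S ** (D ** E) ** adj S"
proof -
  have "(S ** D ** adj S) ** (S ** E ** adj S) = S ** D ** (adj S ** S) ** E ** adj S"
    by (simp only: matrix_mul_assoc)
  also have "\<dots> = S ** (D ** E) ** adj S"
    using assms by (simp add: unitary_def) (simp only: matrix_mul_assoc)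
  finally show ?thesis .
qed

lemma mpow_mpow:
  assumes "pos_def A"
  shows "mpow (mpow A r) s = mpow A (r * s)"
proof -
  obtain S a where S: "unitary S" and A: "A = S ** diag a ** adj S" "\<And>i. a i > 0"
    using pos_def_decomposition[OF assms] by blast
  show ?thesis using A(2) unfolding A(1) mpow_decomposition[OF S] by (simp add: powr_powr)
qed

text \<open>Since \<open>0 powr r\<close> is 0, the identity rests on the eigenvalues being
  nonzero.\<close>

lemma mpow_uminus_mult:
  assumes "pos_def A"
  shows "mpow A (- r) ** mpow A r = mat 1"
proof -
  obtain S a where S: "unitary S" and A: "A = S ** diag a ** adj S" and a: "\<And>i. a i > 0"
    using pos_def_decomposition[OF assms] by blast
  have "mpow A (- r) ** mpow A r = S ** diag (\<lambda>i. a i powr (- r) * a i powr r) ** adj S"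
    unfolding A mpow_decomposition[OF S] unitary_conj_mult[OF S] diag_mult ..
  also have "(\<lambda>i. a i powr (- r) * a i powr r) = (\<lambda>i. 1)"
    using less_imp_neq[OF a] by (auto simp: powr_minus)
  also have "diag (\<lambda>i. 1) = mat 1" by (simp add: diag_def mat_def vec_eq_iff)
  finally show ?thesis using S by (simp add: unitary_def)
qed


subsection \<open>Measurability of matrix powers\<close>

primrec mat_pow :: "complex^'n^'n \<Rightarrow> nat \<Rightarrow> complex^'n^'n" where
  "mat_pow A 0 = mat 1"
| "mat_pow A (Suc i) = A ** mat_pow A i"

lemma mat_pow_decomposition:
  fixes S :: "complex^'n^'n"
  assumes "unitary S"
  shows "mat_pow (S ** diag a ** adj S) i = S ** diag (\<lambda>j. a j ^ i) ** adj S"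
proof (induction i)
  case 0
  have "diag (\<lambda>i::'n. 1) = mat 1" by (simp add: diag_def mat_def vec_eq_iff)
  then show ?case using assms by (simp add: unitary_def matrix_mul_rid)
next
  case (Suc i)
  then show ?case by (simp add: unitary_conj_mult[OF assms] diag_mult)
qed

lemma conj_diag_component:
  "(S ** diag f ** adj S) $ k $ l = (\<Sum>j\<in>UNIV. complex_of_real (f j) * (S $ k $ j * cnj (S $ l $ j)))"
  by (simp add: matrix_matrix_mult_def diag_def adj_def if_distrib[where f="(*) _"] mult_ac cong: if_cong)

text \<open>Weierstrass approximation on the intervals [1/(m+1), m+1], with error 1/(m+1); these
  intervals exhaust the positive half-line. The coefficients do not depend on \<open>x\<close>, and
  this uniformity is what carries over to matrices.\<close>

lemma powr_limit_of_polynomials: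
  "\<exists>(c :: nat \<Rightarrow> nat \<Rightarrow> real) N. \<forall>x>0. (\<lambda>m::nat. \<Sum>i\<le>(N m :: nat). c m i * x ^ i) \<longlonglongrightarrow> x powr r"
proof -
  have "\<exists>(c :: nat \<Rightarrow> real) (N::nat). \<forall>x\<in>{1 / real (Suc m)..real (Suc m)}. \<bar>x powr r - (\<Sum>i\<le>N. c i * x ^ i)\<bar> < 1 / real (Suc m)" for m
  proof -
    have "continuous_on {1 / real (Suc m)..real (Suc m)} (\<lambda>x. x powr r)"
    proof (intro continuous_intros ballI)
      fix x :: real assume "x \<in> {1 / real (Suc m)..real (Suc m)}"
      moreover have "1 / real (Suc m) > 0" by simp
      ultimately have "x > 0" by (metis atLeastAtMost_iff less_le_trans)
      then show "x \<noteq> 0" by simp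
    qed
    then obtain g where g: "real_polynomial_function g"
      "\<And>x. x \<in> {1 / real (Suc m)..real (Suc m)} \<Longrightarrow> \<bar>x powr r - g x\<bar> < 1 / real (Suc m)"
      using Stone_Weierstrass_real_polynomial_function[of "{1 / real (Suc m)..real (Suc m)}" "\<lambda>x. x powr r" "1 / real (Suc m)"]
      by auto
    then show ?thesis unfolding real_polynomial_function_iff_sum by blast
  qed
  then obtain c and N :: "nat \<Rightarrow> nat" where cN:
    "\<And>m x. x \<in> {1 / real (Suc m)..real (Suc m)} \<Longrightarrow> \<bar>x powr r - (\<Sum>i\<le>N m. c m i * x ^ i)\<bar> < 1 / real (Suc m)"
    by metis
  have "(\<lambda>m. \<Sum>i\<le>N m. c m i * x ^ i) \<longlonglongrightarrow> x powr r" if "x > 0" for x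
  proof -
    have lim: "(\<lambda>m. 1 / real (Suc m)) \<longlonglongrightarrow> 0" using LIMSEQ_inverse_real_of_nat by (simp add: inverse_eq_divide)
    have "\<forall>\<^sub>F m in sequentially. 1 / real (Suc m) < x" using order_tendstoD(2)[OF lim that] .
    moreover have "\<forall>\<^sub>F m in sequentially. x \<le> real (Suc m)"
      using eventually_ge_at_top[of "nat \<lceil>x\<rceil>"] by eventually_elim linarith
    ultimately have "\<forall>\<^sub>F m in sequentially. norm ((\<Sum>i\<le>N m. c m i * x ^ i) - x powr r) \<le> 1 / real (Suc m)"
    proof eventually_elim
      case (elim m)
      then show ?case using cN[of x m] by (simp add: abs_minus_commute)
    qed
    then have "(\<lambda>m. (\<Sum>i\<le>N m. c m i * x ^ i) - x powr r) \<longlonglongrightarrow> 0"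
      by (rule Lim_null_comparison[OF _ lim])
    then show ?thesis using Lim_null by blast
  qed
  then show ?thesis by blast
qed

text \<open>A polynomial in a matrix acts on its eigenvalues, so scalar convergence at each
  eigenvalue gives convergence of the entries. One sequence of polynomials serves every positive
  definite matrix; this makes matrix powers measurable without a measurable choice of
  eigenvectors.\<close>

lemma mpow_limit_of_polynomials:
  "\<exists>c N. \<forall>A::complex^'n^'n. pos_def A \<longrightarrow>
     (\<forall>k l. (\<lambda>m::nat. \<Sum>i\<le>(N m :: nat). complex_of_real (c m i) * mat_pow A i $ k $ l) \<longlonglongrightarrow> mpow A r $ k $ l)"
proof -
  obtain c and N :: "nat \<Rightarrow> nat" where
    cN: "\<And>x. x > 0 \<Longrightarrow> (\<lambda>m::nat. \<Sum>i\<le>N m. c m i * x ^ i) \<longlonglongrightarrow> x powr r"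
    using powr_limit_of_polynomials by blast
  have "(\<lambda>m::nat. \<Sum>i\<le>N m. complex_of_real (c m i) * mat_pow A i $ k $ l) \<longlonglongrightarrow> mpow A r $ k $ l"
    if A: "pos_def A" for A :: "complex^'n^'n" and k l
  proof -
    obtain S a where S: "unitary S" and A: "A = S ** diag a ** adj S" and a: "\<And>i. a i > 0"
      using pos_def_decomposition[OF A] by blast
    have "(\<lambda>m. \<Sum>j\<in>UNIV. complex_of_real (\<Sum>i\<le>N m. c m i * a j ^ i) * (S $ k $ j * cnj (S $ l $ j)))
        \<longlonglongrightarrow> (\<Sum>j\<in>UNIV. complex_of_real (a j powr r) * (S $ k $ j * cnj (S $ l $ j)))"
      by (intro tendsto_intros cN a)
    also have "(\<lambda>m. \<Sum>j\<in>UNIV. complex_of_real (\<Sum>i\<le>N m. c m i * a j ^ i) * (S $ k $ j * cnj (S $ l $ j))) =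
        (\<lambda>m. \<Sum>i\<le>N m. complex_of_real (c m i) * mat_pow A i $ k $ l)"
    proof
      fix m
      have "(\<Sum>i\<le>N m. complex_of_real (c m i) * mat_pow A i $ k $ l) =
          (\<Sum>i\<le>N m. \<Sum>j\<in>UNIV. complex_of_real (c m i * a j ^ i) * (S $ k $ j * cnj (S $ l $ j)))"
        unfolding A mat_pow_decomposition[OF S] conj_diag_component by (simp add: sum_distrib_left mult_ac)
      also have "\<dots> = (\<Sum>j\<in>UNIV. \<Sum>i\<le>N m. complex_of_real (c m i * a j ^ i) * (S $ k $ j * cnj (S $ l $ j)))"
        by (rule sum.swap)
      finally show "(\<Sum>j\<in>UNIV. complex_of_real (\<Sum>i\<le>N m. c m i * a j ^ i) * (S $ k $ j * cnj (S $ l $ j))) =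
          (\<Sum>i\<le>N m. complex_of_real (c m i) * mat_pow A i $ k $ l)"
        by (simp add: sum_distrib_right)
    qed
    finally show ?thesis unfolding A mpow_decomposition[OF S] conj_diag_component .
  qed
  then show ?thesis by blast
qed

lemma borel_measurable_vecI:
  fixes F :: "'a \<Rightarrow> ('b::euclidean_space)^'n"
  assumes "\<And>i. (\<lambda>x. F x $ i) \<in> borel_measurable M"
  shows "F \<in> borel_measurable M"
  unfolding borel_measurable_euclidean_space[of F]
  using assms by (auto simp: Basis_vec_def inner_axis)

lemma borel_measurable_vec_nth:
  fixes F :: "'a \<Rightarrow> ('b::euclidean_space)^'n"
  assumes "F \<in> borel_measurable M"
  shows "(\<lambda>x. F x $ i) \<in> borel_measurable M"
proof -
  have "(\<lambda>v::'b^'n. v $ i) \<in> borel_measurable borel"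
    by (intro borel_measurable_continuous_onI continuous_intros)
  then show ?thesis using measurable_compose[OF assms] by blast
qed

lemma borel_measurable_mat_pow:
  fixes W :: "'a \<Rightarrow> complex^'n^'n"
  assumes "W \<in> borel_measurable M"
  shows "(\<lambda>x. mat_pow (W x) i) \<in> borel_measurable M"
proof (induction i)
  case (Suc i)
  show ?case
    unfolding mat_pow.simps matrix_matrix_mult_def
    by (intro borel_measurable_vecI, simp)
       (intro borel_measurable_sum borel_measurable_times borel_measurable_vec_nth Suc assms)
qed simp

lemma lebesgue_measurable_borel_representative:
  fixes f :: "'a::euclidean_space \<Rightarrow> 'b::euclidean_space"
  assumes "f \<in> borel_measurable lebesgue"
  shows "\<exists>f'. f' \<in> borel_measurable borel \<and> (AE x in lborel. f x = f' x)"
proof -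
  have "\<exists>g. g \<in> borel_measurable lborel \<and> (AE x in lborel. f x \<bullet> b = g x)" for b
    using completion_ex_borel_measurable_real[of "\<lambda>x. f x \<bullet> b" lborel] assms by auto
  then obtain g where g: "\<And>b. g b \<in> borel_measurable lborel" "\<And>b. AE x in lborel. f x \<bullet> b = g b x"
    by metis
  have "AE x in lborel. \<forall>b\<in>Basis. f x \<bullet> b = g b x"
    using g(2) by (intro AE_finite_allI) auto
  then have "AE x in lborel. f x = (\<Sum>b\<in>Basis. g b x *\<^sub>R b)"
  proof eventually_elim
    case (elim x)
    then show ?case using euclidean_representation[of "f x"] by (metis (no_types, lifting) sum.cong)
  qed
  moreover have "(\<lambda>x. \<Sum>b\<in>Basis. g b x *\<^sub>R b) \<in> borel_measurable borel"
    using g(1) by (intro borel_measurable_sum borel_measurable_scaleR) (auto simp: measurable_lborel1)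
  ultimately show ?thesis by blast
qed

text \<open>Local integrability contains measurability on every ball, and each entry is the limit of
  its restrictions to growing balls.\<close>

lemma matrix_weight_measurable:
  fixes W :: "real^'d \<Rightarrow> complex^'n^'n"
  assumes "matrix_weight W"
  shows "W \<in> borel_measurable lebesgue"
proof (intro borel_measurable_vecI)
  fix i j
  have m: "(\<lambda>x. indicator (cball 0 (real n)) x *\<^sub>R (W x $ i $ j)) \<in> borel_measurable lebesgue" for n
    using assms unfolding matrix_weight_def set_integrable_def by (meson borel_measurable_integrable compact_cball)
  have "(\<lambda>n. indicator (cball 0 (real n)) x *\<^sub>R (W x $ i $ j)) \<longlonglongrightarrow> W x $ i $ j" for x
  proof (rule tendsto_eventually)
    show "\<forall>\<^sub>F n in sequentially. indicator (cball 0 (real n)) x *\<^sub>R (W x $ i $ j) = W x $ i $ j"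
      using eventually_ge_at_top[of "nat \<lceil>norm x\<rceil>"]
    proof eventually_elim
      case (elim n)
      then have "norm x \<le> real n" by linarith
      then show ?case by simp
    qed
  qed
  then show "(\<lambda>x. W x $ i $ j) \<in> borel_measurable lebesgue"
    by (rule borel_measurable_LIMSEQ_metric[OF m])
qed

text \<open>The approximating polynomials are evaluated at a Borel version of \<open>W\<close>.
  Their \<open>lim\<close> is Borel everywhere, and it is the matrix power wherever the limit is
  known, that is, almost everywhere.\<close>

lemma matrix_weight_mpow_borel_representative:
  fixes W :: "real^'d \<Rightarrow> complex^'n^'n"
  assumes "matrix_weight W"
  shows "\<exists>u. u \<in> borel_measurable borel \<and> (AE x in lborel. u x = mpow (W x) r)"
proof -
  obtain W' where W': "W' \<in> borel_measurable borel" "AE x in lborel. W x = W' x"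
    using lebesgue_measurable_borel_representative[OF matrix_weight_measurable[OF assms]] by blast
  obtain c and N :: "nat \<Rightarrow> nat" where cN: "\<And>A::complex^'n^'n. \<And>k l. pos_def A \<Longrightarrow>
     (\<lambda>m. \<Sum>i\<le>N m. complex_of_real (c m i) * mat_pow A i $ k $ l) \<longlonglongrightarrow> mpow A r $ k $ l"
    using mpow_limit_of_polynomials by blast
  define u :: "real^'d \<Rightarrow> complex^'n^'n" where
    "u x = (\<chi> k l. lim (\<lambda>m. \<Sum>i\<le>N m. complex_of_real (c m i) * mat_pow (W' x) i $ k $ l))" for x
  have "u \<in> borel_measurable borel"
    unfolding u_def
    by (intro borel_measurable_vecI, simp)
       (intro borel_measurable_lim_metric borel_measurable_sum borel_measurable_times
         borel_measurable_vec_nth borel_measurable_mat_pow W' borel_measurable_const)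
  moreover have "AE x in lborel. pos_def (W x)"
    using assms AE_completion_iff unfolding matrix_weight_def by blast
  then have "AE x in lborel. u x = mpow (W x) r"
    using W'(2)
  proof eventually_elim
    case (elim x)
    then have "u x $ k $ l = mpow (W x) r $ k $ l" for k l
      using cN[of "W x" k l, THEN limI] by (simp add: u_def)
    then show ?case by (simp add: vec_eq_iff)
  qed
  ultimately show ?thesis by blast
qed

subsection \<open>The operator norm\<close>

lemma norm_matrix_vector_le_op_norm:
  fixes A :: "complex^'n^'n"
  shows "norm (A *v v) \<le> op_norm A * norm v"
  unfolding op_norm_def by (rule onorm[OF bounded_linear_matrix_vector])

lemma op_norm_nonneg: "0 \<le> op_norm A" for A :: "complex^'n^'n"
  unfolding op_norm_def by (rule onorm_pos_le[OF bounded_linear_matrix_vector])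

text \<open>The constant is crude; it serves to show that \<open>op_norm\<close> is Lipschitz and
  hence Borel.\<close>

lemma op_norm_le_norm:
  fixes A :: "complex^'n^'n"
  shows "op_norm A \<le> real CARD('n) * real CARD('n) * norm A"
  unfolding op_norm_def
proof (rule onorm_le)
  fix v :: "complex^'n"
  have "norm ((A *v v) $ i) \<le> real CARD('n) * (norm A * norm v)" for i
  proof -
    have "norm ((A *v v) $ i) \<le> (\<Sum>j\<in>UNIV. norm (A $ i $ j * v $ j))"
      by (simp add: matrix_vector_mult_def norm_sum)
    also have "\<dots> \<le> (\<Sum>j\<in>(UNIV::'n set). norm A * norm v)"
      unfolding norm_mult
      by (intro sum_mono mult_mono Finite_Cartesian_Product.norm_nth_le order_trans[OF Finite_Cartesian_Product.norm_nth_le]) auto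
    finally show ?thesis by simp
  qed
  then have "(\<Sum>i\<in>UNIV. norm ((A *v v) $ i)) \<le> (\<Sum>i\<in>(UNIV::'n set). real CARD('n) * (norm A * norm v))"
    by (rule sum_mono)
  moreover have "norm (A *v v) \<le> (\<Sum>i\<in>UNIV. norm ((A *v v) $ i))"
    unfolding norm_vec_def by (rule L2_set_le_sum) simp
  ultimately show "norm (A *v v) \<le> real CARD('n) * real CARD('n) * norm A * norm v"
    by (simp add: mult_ac)
qed

lemma op_norm_diff_le: "op_norm A \<le> op_norm B + op_norm (A - B)" for A B :: "complex^'n^'n"
proof -
  have "(*v) A = (\<lambda>v. B *v v + (A - B) *v v)"
    by (auto simp: matrix_vector_mult_diff_rdistrib)
  then have "op_norm A = onorm (\<lambda>v. B *v v + (A - B) *v v)" unfolding op_norm_def by simp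
  also have "\<dots> \<le> op_norm B + op_norm (A - B)"
    unfolding op_norm_def by (rule onorm_triangle[OF bounded_linear_matrix_vector bounded_linear_matrix_vector])
  finally show ?thesis .
qed

lemma borel_measurable_op_norm: "(op_norm :: complex^'n^'n \<Rightarrow> real) \<in> borel_measurable borel"
proof -
  have "\<bar>op_norm A - op_norm B\<bar> \<le> real CARD('n) * real CARD('n) * norm (A - B)" for A B :: "complex^'n^'n"
    using op_norm_diff_le[of A B] op_norm_diff_le[of B A] op_norm_le_norm[of "A - B"] op_norm_le_norm[of "B - A"]
    by (simp add: norm_minus_commute)
  then have "(real CARD('n) * real CARD('n))-lipschitz_on UNIV (op_norm :: complex^'n^'n \<Rightarrow> real)"
    by (intro lipschitz_onI) (auto simp: dist_norm)
  then show ?thesis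
    by (intro borel_measurable_continuous_onI lipschitz_on_continuous_on)
qed

lemma borel_measurable_op_norm_mult:
  fixes u v :: "'a \<Rightarrow> complex^'n^'n"
  assumes "u \<in> borel_measurable M" "v \<in> borel_measurable M"
  shows "(\<lambda>x. op_norm (u x ** v x)) \<in> borel_measurable M"
proof -
  have "(\<lambda>x. u x ** v x) \<in> borel_measurable M"
    unfolding matrix_matrix_mult_def
    by (intro borel_measurable_vecI, simp)
       (intro borel_measurable_sum borel_measurable_times borel_measurable_vec_nth assms)
  then show ?thesis by (rule measurable_compose[OF _ borel_measurable_op_norm])
qed

section \<open>Lower integrals\<close>

text \<open>The inner Orlicz norm of the bump condition is not known to be measurable in \<open>x\<close>, and the
  integral of a nonmeasurable function is its lower integral.\<close>

lemma nn_integral_add_le: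
  fixes f g :: "'a \<Rightarrow> ennreal"
  assumes g: "g \<in> borel_measurable M"
  shows "(\<integral>\<^sup>+x. f x + g x \<partial>M) \<le> (\<integral>\<^sup>+x. f x \<partial>M) + (\<integral>\<^sup>+x. g x \<partial>M)"
  unfolding nn_integral_def_finite[of M "\<lambda>x. f x + g x"]
proof (rule SUP_least)
  fix s assume "s \<in> {s. simple_function M s \<and> s \<le> (\<lambda>x. f x + g x) \<and> (\<forall>x. s x < top)}"
  then have s: "simple_function M s" "\<And>x. s x \<le> f x + g x" "\<And>x. s x < top" by (auto simp: le_fun_def)
  have sm: "s \<in> borel_measurable M" using s(1) by (rule borel_measurable_simple_function)
  have "integral\<^sup>S M s = (\<integral>\<^sup>+x. s x \<partial>M)" using s(1) by (rule nn_integral_eq_simple_integral[symmetric])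
  \<comment> \<open>The truncated difference \<open>s - g\<close> is a measurable minorant of
    \<open>f\<close>. That \<open>s\<close> is finite excludes differences of two infinite
    values.\<close>
  also have "\<dots> \<le> (\<integral>\<^sup>+x. (s x - g x) + g x \<partial>M)"
  proof (intro nn_integral_mono)
    fix x
    show "s x \<le> (s x - g x) + g x"
    proof (cases "g x \<le> s x")
      case False
      then have "s x \<le> 0 + g x" by simp
      also have "\<dots> \<le> (s x - g x) + g x" by (intro add_right_mono) simp
      finally show ?thesis .
    qed (simp add: diff_add_cancel_ennreal)
  qed
  also have "\<dots> = (\<integral>\<^sup>+x. s x - g x \<partial>M) + (\<integral>\<^sup>+x. g x \<partial>M)"
    using sm g by (intro nn_integral_add) auto
  also have "(\<integral>\<^sup>+x. s x - g x \<partial>M) \<le> (\<integral>\<^sup>+x. f x \<partial>M)"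
  proof (intro nn_integral_mono)
    fix x
    show "s x - g x \<le> f x" using s(2)[of x] s(3)[of x] by (auto simp: ennreal_minus_le_iff add.commute)
  qed
  finally show "integral\<^sup>S M s \<le> (\<integral>\<^sup>+x. f x \<partial>M) + (\<integral>\<^sup>+x. g x \<partial>M)" by (simp add: add_right_mono)
qed

text \<open>A simple function below c f, divided by c, lies below f; this is the inequality that
  survives for a nonmeasurable \<open>f\<close>.\<close>

lemma nn_integral_cmult_le:
  fixes f :: "'a \<Rightarrow> ennreal"
  assumes c: "0 < c"
  shows "(\<integral>\<^sup>+x. ennreal c * f x \<partial>M) \<le> ennreal c * (\<integral>\<^sup>+x. f x \<partial>M)"
  unfolding nn_integral_def_finite[of M "\<lambda>x. ennreal c * f x"]
proof (rule SUP_least)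
  fix s assume "s \<in> {s. simple_function M s \<and> s \<le> (\<lambda>x. ennreal c * f x) \<and> (\<forall>x. s x < top)}"
  then have s: "simple_function M s" "\<And>x. s x \<le> ennreal c * f x" by (auto simp: le_fun_def)
  have sm: "s \<in> borel_measurable M" using s(1) by (rule borel_measurable_simple_function)
  have inv: "ennreal c * (ennreal (1 / c) * z) = z" "ennreal (1 / c) * (ennreal c * z) = z" for z
    using c by (simp_all add: mult.assoc[symmetric] ennreal_mult[symmetric])
  have "integral\<^sup>S M s = (\<integral>\<^sup>+x. s x \<partial>M)" using s(1) by (rule nn_integral_eq_simple_integral[symmetric])
  also have "\<dots> = ennreal c * (\<integral>\<^sup>+x. ennreal (1 / c) * s x \<partial>M)"
    using sm by (subst nn_integral_cmult[symmetric]) (auto simp: inv)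
  also have "\<dots> \<le> ennreal c * (\<integral>\<^sup>+x. f x \<partial>M)"
  proof (intro mult_left_mono nn_integral_mono)
    fix x
    have "ennreal (1 / c) * s x \<le> ennreal (1 / c) * (ennreal c * f x)" by (intro mult_left_mono s) simp
    then show "ennreal (1 / c) * s x \<le> f x" by (simp add: inv)
  qed simp
  finally show "integral\<^sup>S M s \<le> ennreal c * (\<integral>\<^sup>+x. f x \<partial>M)" .
qed

lemma nn_integral_count_space_disjoint_le:
  assumes "\<And>i j. P i \<Longrightarrow> P j \<Longrightarrow> i = j"
  shows "(\<integral>\<^sup>+i. (if P i then c else 0) \<partial>count_space UNIV) \<le> (c :: ennreal)"
proof (cases "\<exists>i. P i")
  case True
  then obtain i where i: "P i" by blast
  have "(\<integral>\<^sup>+i. (if P i then c else 0) \<partial>count_space UNIV) = (\<integral>\<^sup>+i. (if P i then c else 0) \<partial>count_space {i})"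
    using assms i by (intro nn_integral_count_space_eq) auto
  then show ?thesis using i by (simp add: nn_integral_count_space_finite)
qed simp

text \<open>Orlicz norms are infima, so estimates become available only for numbers strictly above
  the norm. This is the passage to the norm itself; the perturbation is additive, so that
  \<open>N = 0\<close> is included.\<close>

lemma ennreal_le_mult_of_forall_gt:
  assumes K: "K < \<infinity>" and N: "N < \<infinity>" and le: "\<And>c::real. N < ennreal c \<Longrightarrow> X \<le> K * ennreal c"
  shows "X \<le> K * N"
proof -
  obtain k where k: "K = ennreal k" "k \<ge> 0" using K by (cases K) auto
  obtain n where n: "N = ennreal n" "n \<ge> 0" using N by (cases N) auto
  show ?thesis
  proof (rule ennreal_le_epsilon)
    fix e :: real assume e: "e > 0"
    \<comment> \<open>The perturbation is divided by k + 1 rather than by k, which may be 0.\<close>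
    have "X \<le> K * ennreal (n + e / (k + 1))"
      using e k n by (intro le) (auto simp: ennreal_less_iff)
    also have "\<dots> = ennreal (k * n + e * (k / (k + 1)))"
      using e k n by (simp add: ennreal_mult[symmetric] distrib_left mult_ac)
    also have "\<dots> \<le> ennreal (k * n + e)"
      using e k by (intro ennreal_leI add_left_mono) (simp add: divide_simps)
    finally show "X \<le> K * N + ennreal e" using k n e by (simp add: ennreal_mult)
  qed
qed

section \<open>Young functions and Orlicz norms\<close>

lemma young_function_nonneg: "young_function A \<Longrightarrow> 0 \<le> t \<Longrightarrow> 0 \<le> A t"
  by (simp add: young_function_def)

lemma young_function_mono: "young_function A \<Longrightarrow> 0 \<le> s \<Longrightarrow> s \<le> t \<Longrightarrow> A s \<le> A t"
  unfolding young_function_def mono_on_def by auto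

lemma young_function_scale:
  assumes A: "young_function A" and "0 \<le> t" "0 \<le> c" "c \<le> 1"
  shows "A (c * t) \<le> c * A t"
proof -
  have "convex_on {0..} A" "A 0 = 0" using A by (auto simp: young_function_def)
  then show ?thesis using convex_onD[of "{0..}" A c 0 t] assms by simp
qed

text \<open>The maximum with 0 is there because nothing is known about a Young function at negative
  arguments.\<close>

lemma young_function_borel:
  assumes A: "young_function A"
  shows "(\<lambda>t. A (max 0 t)) \<in> borel_measurable borel"
proof (rule borel_measurable_continuous_onI)
  have "continuous_on {0..} A" using A by (simp add: young_function_def)
  then show "continuous_on UNIV (\<lambda>t. A (max 0 t))"
    by (rule continuous_on_compose2) (auto intro!: continuous_intros)
qed

lemma young_function_comp_measurable:
  assumes A: "young_function A" and h: "h \<in> borel_measurable M" "\<And>x. 0 \<le> h x" and c: "c > 0"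
  shows "(\<lambda>x. ennreal (A (h x / c))) \<in> borel_measurable M"
proof -
  have "(\<lambda>x. A (max 0 (h x / c))) \<in> borel_measurable M"
    using h(1) by (intro measurable_compose[OF _ young_function_borel[OF A]]) simp
  moreover have "max 0 (h x / c) = h x / c" for x using h(2)[of x] c by (simp add: max_def)
  ultimately show ?thesis by simp
qed

lemma young_ext_mono:
  assumes A: "young_function A" and "z \<le> w"
  shows "young_ext A z \<le> young_ext A w"
  using assms young_function_mono[OF A, of "enn2real z" "enn2real w"]
  by (auto simp: young_ext_def intro!: ennreal_leI enn2real_mono simp: top.extremum_unique less_top)

lemma young_ext_ennreal:
  assumes "0 \<le> t" "0 < c"
  shows "young_ext A (ennreal t / ennreal c) = ennreal (A (t / c))"
  using assms by (simp add: young_ext_def divide_ennreal)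

section \<open>Orlicz norms expressed through modular integrals\<close>

lemma divide_le_one_iff_ennreal:
  fixes a V :: ennreal
  assumes "0 < V" "V < \<infinity>"
  shows "a / V \<le> 1 \<longleftrightarrow> a \<le> V"
proof -
  obtain v where v: "V = ennreal v" "v > 0" using assms by (cases V) auto
  show ?thesis
  proof (cases a)
    case (real r)
    then show ?thesis using v by (simp add: divide_ennreal)
  next
    case top
    then show ?thesis using v by (simp add: ennreal_top_divide top_unique)
  qed
qed

text \<open>A number strictly above the infimum lies above an admissible one, and the modular
  integral decreases in the constant. Strictness avoids the question whether the infimum is
  attained, which would ask for a convergence theorem for the possibly nonmeasurable
  \<open>f\<close>.\<close>

lemma orlicz_norm_less_imp:
  assumes A: "young_function A" and Q: "0 < emeasure lebesgue Q" "emeasure lebesgue Q < \<infinity>"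
    and less: "orlicz_norm A Q f < ennreal c"
  shows "(\<integral>\<^sup>+x\<in>Q. young_ext A (f x / ennreal c) \<partial>lebesgue) \<le> emeasure lebesgue Q"
proof -
  obtain c' where c': "c' > 0" "ennreal c' < ennreal c"
    "(\<integral>\<^sup>+x\<in>Q. young_ext A (f x / ennreal c') \<partial>lebesgue) / emeasure lebesgue Q \<le> 1"
    using less unfolding orlicz_norm_def Inf_less_iff by auto
  then have "(\<integral>\<^sup>+x\<in>Q. young_ext A (f x / ennreal c') \<partial>lebesgue) \<le> emeasure lebesgue Q"
    using divide_le_one_iff_ennreal[OF Q] by simp
  moreover have "inverse (ennreal c) \<le> inverse (ennreal c')"
    using c'(1,2) by (simp add: inverse_ennreal ennreal_less_iff ennreal_leI le_imp_inverse_le)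
  then have "(\<integral>\<^sup>+x\<in>Q. young_ext A (f x / ennreal c) \<partial>lebesgue) \<le> (\<integral>\<^sup>+x\<in>Q. young_ext A (f x / ennreal c') \<partial>lebesgue)"
    unfolding divide_ennreal_def
    by (intro nn_integral_mono mult_right_mono young_ext_mono[OF A] mult_left_mono) auto
  ultimately show ?thesis by simp
qed

lemma orlicz_norm_le:
  assumes Q: "0 < emeasure lebesgue Q" "emeasure lebesgue Q < \<infinity>" and c: "c > 0"
    and le: "(\<integral>\<^sup>+x\<in>Q. young_ext A (f x / ennreal c) \<partial>lebesgue) \<le> emeasure lebesgue Q"
  shows "orlicz_norm A Q f \<le> ennreal c"
  unfolding orlicz_norm_def
  by (rule Inf_lower) (use le c divide_le_one_iff_ennreal[OF Q] in auto)

lemma orlicz_norm_cong_AE: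
  assumes "AE x in lebesgue. f x = g x"
  shows "orlicz_norm A Q f = orlicz_norm A Q g"
proof -
  have "(\<integral>\<^sup>+x\<in>Q. young_ext A (f x / ennreal c) \<partial>lebesgue) = (\<integral>\<^sup>+x\<in>Q. young_ext A (g x / ennreal c) \<partial>lebesgue)" for c
    using assms by (intro nn_integral_cong_AE) (auto elim!: eventually_mono)
  then show ?thesis by (simp add: orlicz_norm_def)
qed

text \<open>The real supremum that defines \<open>complementary\<close> is an upper bound only if
  the set is bounded above; the superlinear growth of \<Phi> supplies this.\<close>

lemma young_inequality:
  assumes \<Phi>: "young_function \<Phi>" and \<Phi>': "young_function (complementary \<Phi>)" and "0 \<le> s" "0 \<le> t"
  shows "s * t \<le> \<Phi> s + complementary \<Phi> t"
proof (cases "s = 0")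
  case True
  then show ?thesis using assms young_function_nonneg by simp
next
  case False
  have lim: "filterlim (\<lambda>t. \<Phi> t / t) at_top at_top" using \<Phi> by (simp add: young_function_def)
  then have "\<forall>\<^sub>F u in at_top. t \<le> \<Phi> u / u" by (simp add: filterlim_at_top)
  then obtain S where S: "\<And>u. u \<ge> S \<Longrightarrow> t \<le> \<Phi> u / u" by (auto simp: eventually_at_top_linorder)
  have "u * t - \<Phi> u \<le> \<bar>S\<bar> * t" if "u > 0" for u
  proof (cases "u \<ge> S")
    case True
    then have "t * u \<le> \<Phi> u" using S[OF True] that by (simp add: pos_le_divide_eq)
    moreover have "0 \<le> \<bar>S\<bar> * t" using \<open>0 \<le> t\<close> by simp
    ultimately show ?thesis by (simp add: mult.commute)
  next
    case False
    have "u * t \<le> \<bar>S\<bar> * t" using False \<open>0 \<le> t\<close> by (intro mult_right_mono) auto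
    then show ?thesis using young_function_nonneg[OF \<Phi>, of u] that by simp
  qed
  then have "bdd_above ((\<lambda>s. s * t - \<Phi> s) ` {0<..})" by (auto intro!: bdd_aboveI2)
  then have "s * t - \<Phi> s \<le> complementary \<Phi> t"
    unfolding complementary_def using False assms by (intro cSUP_upper) auto
  then show ?thesis by simp
qed

text \<open>Young's inequality for f/N and g/c is integrated over \<open>Q\<close>; both modular
  integrals are at most |Q|, whence the factor 2. The function \<open>f\<close> is arbitrary because
  it will be an inner Orlicz norm, and \<open>g\<close> enters through an admissible constant
  \<open>c\<close> instead of its norm.\<close>

lemma orlicz_hoelder:
  assumes \<Phi>: "young_function \<Phi>" and \<Phi>': "young_function (complementary \<Phi>)"
    and Q: "Q \<in> sets lebesgue" "0 < emeasure lebesgue Q" "emeasure lebesgue Q < \<infinity>"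
    and g: "g \<in> borel_measurable lebesgue" "\<And>x. 0 \<le> g x" and c: "c > 0"
    and le: "(\<integral>\<^sup>+x\<in>Q. ennreal (complementary \<Phi> (g x / c)) \<partial>lebesgue) \<le> emeasure lebesgue Q"
  shows "(\<integral>\<^sup>+x\<in>Q. f x * ennreal (g x) \<partial>lebesgue) \<le> 2 * emeasure lebesgue Q * ennreal c * orlicz_norm \<Phi> Q f"
proof (cases "orlicz_norm \<Phi> Q f = \<infinity>")
  case True
  then show ?thesis using Q c by (simp add: ennreal_mult_top ennreal_zero_less_mult_iff top_unique)
next
  case False
  show ?thesis
  proof (rule ennreal_le_mult_of_forall_gt)
    show "2 * emeasure lebesgue Q * ennreal c < \<infinity>" using Q by (simp add: ennreal_mult_less_top)
    show "orlicz_norm \<Phi> Q f < \<infinity>" using False by (simp add: less_top)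
  next
    fix N :: real assume N: "orlicz_norm \<Phi> Q f < ennreal N"
    then have N0: "N > 0" by (cases "N > 0") (auto simp: ennreal_neg)
    have point: "f x * ennreal (g x) \<le> ennreal (N * c) * (young_ext \<Phi> (f x / ennreal N) + ennreal (complementary \<Phi> (g x / c)))" for x
    proof (cases "f x = \<infinity>")
      case True
      then have "young_ext \<Phi> (f x / ennreal N) = \<infinity>" by (simp add: young_ext_def ennreal_top_divide)
      then show ?thesis using N0 c by (simp add: ennreal_mult_top)
    next
      case False
      then obtain u where u: "f x = ennreal u" "u \<ge> 0" by (cases "f x") auto
      have "u / N * (g x / c) \<le> \<Phi> (u / N) + complementary \<Phi> (g x / c)"
        using u N0 c g(2)[of x] by (intro young_inequality[OF \<Phi> \<Phi>']) auto
      then have "(N * c) * (u / N * (g x / c)) \<le> (N * c) * (\<Phi> (u / N) + complementary \<Phi> (g x / c))"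
        using N0 c by (intro mult_left_mono) auto
      then have "u * g x \<le> (N * c) * (\<Phi> (u / N) + complementary \<Phi> (g x / c))" using N0 c by simp
      moreover have "0 \<le> \<Phi> (u / N)" "0 \<le> complementary \<Phi> (g x / c)"
        using young_function_nonneg[OF \<Phi>] young_function_nonneg[OF \<Phi>'] u N0 c g(2)[of x] by simp_all
      ultimately show ?thesis unfolding u(1) young_ext_ennreal[OF u(2) N0]
        using u N0 c g(2)[of x] by (simp add: ennreal_mult[symmetric] ennreal_plus[symmetric] del: ennreal_plus)
    qed
    have m: "(\<lambda>x. ennreal (complementary \<Phi> (g x / c)) * indicator Q x) \<in> borel_measurable lebesgue"
      using young_function_comp_measurable[OF \<Phi>' g c] Q(1) by (intro borel_measurable_times_ennreal) auto
    have "(\<integral>\<^sup>+x\<in>Q. f x * ennreal (g x) \<partial>lebesgue) \<le>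
      (\<integral>\<^sup>+x. ennreal (N * c) * (young_ext \<Phi> (f x / ennreal N) * indicator Q x + ennreal (complementary \<Phi> (g x / c)) * indicator Q x) \<partial>lebesgue)"
      using point by (intro nn_integral_mono) (auto split: split_indicator)
    also have "\<dots> \<le> ennreal (N * c) * (\<integral>\<^sup>+x. (young_ext \<Phi> (f x / ennreal N) * indicator Q x + ennreal (complementary \<Phi> (g x / c)) * indicator Q x) \<partial>lebesgue)"
      using N0 c by (intro nn_integral_cmult_le) simp
    also have "\<dots> \<le> ennreal (N * c) * ((\<integral>\<^sup>+x\<in>Q. young_ext \<Phi> (f x / ennreal N) \<partial>lebesgue) + (\<integral>\<^sup>+x\<in>Q. ennreal (complementary \<Phi> (g x / c)) \<partial>lebesgue))"
      by (intro mult_left_mono nn_integral_add_le m) simp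
    also have "\<dots> \<le> ennreal (N * c) * (emeasure lebesgue Q + emeasure lebesgue Q)"
      by (intro mult_left_mono add_mono le orlicz_norm_less_imp[OF \<Phi> Q(2,3) N]) simp
    also have "\<dots> = 2 * emeasure lebesgue Q * ennreal c * ennreal N"
      using N0 c by (simp add: ennreal_mult mult_ac flip: mult_2)
    finally show "(\<integral>\<^sup>+x\<in>Q. f x * ennreal (g x) \<partial>lebesgue) \<le> 2 * emeasure lebesgue Q * ennreal c * ennreal N" .
  qed
qed

text \<open>The majorant splits off the values below the threshold \<open>t\<^sub>0\<close> with \<open>A t\<^sub>0 \<le> 1/2\<close>; the
  integrability condition of \<open>B\<^sub>p\<^sub>,\<^sub>s\<close> becomes a bound on a sum over dyadic levels.\<close>

lemma B_class_dyadic_majorant: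
  assumes AB: "A \<in> B_class p s" and p: "1 < p" "p \<le> s"
  shows "\<exists>\<phi> M. M > 0 \<and> (\<forall>t. 0 \<le> \<phi> t \<and> \<phi> t \<le> M) \<and> \<phi> \<in> borel_measurable borel \<and>
    (\<forall>t\<ge>0. A t \<le> 1 / 2 + \<phi> t * t powr p) \<and>
    (\<forall>t\<ge>0. (\<integral>\<^sup>+j. ennreal (\<phi> (t / 2 powr real_of_int j) powr (s / p)) \<partial>count_space UNIV) \<le> ennreal M)"
proof -
  have A: "young_function A"
    and fin: "(\<integral>\<^sup>+t\<in>{1..}. ennreal (A t powr (s / p) / t powr s / t) \<partial>lborel) < \<infinity>"
    using AB by (auto simp: B_class_def)
  define r where "r = s / p"
  have r: "r \<ge> 1" "r > 0" using p by (auto simp: r_def)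
  have r_p: "p * r = s" using p by (simp add: r_def)
  \<comment> \<open>Convexity gives A(t0) \<le> t0 A(1), which this choice makes at most 1/2; the
    \<open>+ 1\<close> covers A(1) = 0 and gives t0 \<le> 1.\<close>
  define t0 where "t0 = 1 / (2 * (A 1 + 1))"
  have A1: "A 1 \<ge> 0" using young_function_nonneg[OF A] by simp
  have t0: "t0 > 0" "t0 \<le> 1" using A1 by (auto simp: t0_def divide_simps)
  have half: "A t \<le> 1 / 2" if "0 \<le> t" "t \<le> t0" for t
  proof -
    have "A t \<le> A (t0 * 1)" using that by (intro young_function_mono[OF A]) auto
    also have "\<dots> \<le> t0 * A 1" using t0 by (intro young_function_scale[OF A]) auto
    also have "\<dots> \<le> 1 / 2" using A1 by (simp add: t0_def divide_simps)
    finally show ?thesis .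
  qed
  \<comment> \<open>The integrand of the class condition. That condition controls it on [1,
    infinity), and it is bounded on [t0, 1], so \<open>F\<close> is integrable from t0 on.\<close>
  define F where "F t = ennreal (A (max 0 t) powr r / t powr s / t)" for t
  have Fm: "F \<in> borel_measurable borel" unfolding F_def using young_function_borel[OF A] by measurable
  have "(\<integral>\<^sup>+t\<in>{t0..}. F t \<partial>lborel) < \<infinity>"
  proof -
    have "(\<integral>\<^sup>+t\<in>{t0..}. F t \<partial>lborel) \<le> (\<integral>\<^sup>+t. F t * indicator {1..} t + ennreal (A 1 powr r / t0 powr s / t0) * indicator {t0..1} t \<partial>lborel)"
    proof (intro nn_integral_mono)
      fix t
      have "F t \<le> ennreal (A 1 powr r / t0 powr s / t0)" if "t0 \<le> t" "t \<le> 1"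
        unfolding F_def using that t0 r p A1 young_function_nonneg[OF A] 
        by (intro ennreal_leI frac_le divide_nonneg_nonneg powr_mono2 young_function_mono[OF A]) auto
      then show "F t * indicator {t0..} t \<le> F t * indicator {1..} t + ennreal (A 1 powr r / t0 powr s / t0) * indicator {t0..1} t"
        by (auto split: split_indicator)
    qed
    also have "\<dots> = (\<integral>\<^sup>+t\<in>{1..}. F t \<partial>lborel) + ennreal (A 1 powr r / t0 powr s / t0) * emeasure lborel {t0..1}"
      using Fm by (subst nn_integral_add) (auto simp: nn_integral_cmult)
    also have "(\<integral>\<^sup>+t\<in>{1..}. F t \<partial>lborel) = (\<integral>\<^sup>+t\<in>{1..}. ennreal (A t powr (s / p) / t powr s / t) \<partial>lborel)"
      by (intro nn_integral_cong) (auto simp: F_def r_def split: split_indicator)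
    finally show ?thesis using fin t0 by (auto simp: ennreal_mult_less_top intro: le_less_trans)
  qed
  then obtain K where K: "(\<integral>\<^sup>+t\<in>{t0..}. F t \<partial>lborel) = ennreal K" "K \<ge> 0"
    by (cases "\<integral>\<^sup>+t\<in>{t0..}. F t \<partial>lborel") auto
  \<comment> \<open>Above the threshold \<phi>(t) t^p is A(t), and \<phi>^(s/p) is the factor
    A(t)^(s/p)/t^s of the class condition.\<close>
  define \<phi> where "\<phi> t = (if t > t0 then A (max 0 t) / t powr p else 0)" for t
  have \<phi>0: "\<phi> t \<ge> 0" for t using young_function_nonneg[OF A] by (simp add: \<phi>_def)
  have \<phi>m: "\<phi> \<in> borel_measurable borel" unfolding \<phi>_def using young_function_borel[OF A] by measurable
  have Aphi: "A t \<le> 1 / 2 + \<phi> t * t powr p" if "t \<ge> 0" for t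
    using that half[of t] t0 by (auto simp: \<phi>_def max_def)
  define u where "u t j = t / 2 powr real_of_int j" for t :: real and j :: int
  \<comment> \<open>As \<open>A\<close> is monotone, the integrand on [\<tau>, 2\<tau>) is at least
    a multiple of \<phi>(\<tau>)^(s/p)/\<tau>, and the interval has length \<tau>. The factor
    2^(s+1) pays for replacing \<tau> by 2\<tau> in the denominators.\<close>
  have level: "ennreal (\<phi> \<tau> powr r) \<le> ennreal (2 powr (s + 1)) * (\<integral>\<^sup>+t. F t * indicator {t0..} t * indicator {\<tau>..<2 * \<tau>} t \<partial>lborel)" for \<tau>
  proof (cases "\<tau> > t0")
    case False
    then show ?thesis by (simp add: \<phi>_def)
  next
    case True
    then have \<tau>: "\<tau> > 0" using t0 by simp
    have A\<tau>: "A \<tau> \<ge> 0" using young_function_nonneg[OF A] \<tau> by simp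
    have "F t * indicator {t0..} t * indicator {\<tau>..<2 * \<tau>} t \<ge> ennreal (A \<tau> powr r / (2 * \<tau>) powr s / (2 * \<tau>)) * indicator {\<tau>..<2 * \<tau>} t" for t
    proof (cases "t \<in> {\<tau>..<2 * \<tau>}")
      case in_int: True
      have "A \<tau> powr r / (2 * \<tau>) powr s / (2 * \<tau>) \<le> A (max 0 t) powr r / t powr s / t"
        using in_int \<tau> r p A\<tau> by (intro frac_le divide_nonneg_nonneg powr_mono2 young_function_mono[OF A]) auto
      then show ?thesis using in_int True by (simp add: F_def ennreal_leI)
    qed simp
    then have "(\<integral>\<^sup>+t. F t * indicator {t0..} t * indicator {\<tau>..<2 * \<tau>} t \<partial>lborel) \<ge>
        (\<integral>\<^sup>+t. ennreal (A \<tau> powr r / (2 * \<tau>) powr s / (2 * \<tau>)) * indicator {\<tau>..<2 * \<tau>} t \<partial>lborel)"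
      by (intro nn_integral_mono)
    moreover have "(\<integral>\<^sup>+t. ennreal (A \<tau> powr r / (2 * \<tau>) powr s / (2 * \<tau>)) * indicator {\<tau>..<2 * \<tau>} t \<partial>lborel) =
        ennreal (A \<tau> powr r / (2 * \<tau>) powr s / (2 * \<tau>) * \<tau>)"
    proof -
      have "emeasure lborel {\<tau>..<2 * \<tau>} = ennreal \<tau>" using \<tau> by simp
      then show ?thesis
        using \<tau> by (subst nn_integral_cmult_indicator) (simp_all add: ennreal_mult[symmetric] del: times_divide_eq_left)
    qed
    ultimately have "ennreal (2 powr (s + 1)) * (\<integral>\<^sup>+t. F t * indicator {t0..} t * indicator {\<tau>..<2 * \<tau>} t \<partial>lborel) \<ge>
        ennreal (2 powr (s + 1)) * ennreal (A \<tau> powr r / (2 * \<tau>) powr s / (2 * \<tau>) * \<tau>)"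
      by (simp add: mult_left_mono)
    also have "ennreal (2 powr (s + 1)) * ennreal (A \<tau> powr r / (2 * \<tau>) powr s / (2 * \<tau>) * \<tau>) = ennreal (A \<tau> powr r / \<tau> powr s)"
      using \<tau> by (simp add: ennreal_mult[symmetric] powr_mult powr_add)
    also have "A \<tau> powr r / \<tau> powr s = \<phi> \<tau> powr r"
      using True \<tau> A\<tau> by (simp add: \<phi>_def powr_divide powr_powr r_p)
    finally show ?thesis .
  qed
  \<comment> \<open>The intervals [2^(-j) \<tau>, 2^(1-j) \<tau>) are disjoint, so the level bounds
    add up to one integral of \<open>F\<close>.\<close>
  have sum: "(\<integral>\<^sup>+j. ennreal (\<phi> (u \<tau> j) powr r) \<partial>count_space UNIV) \<le> ennreal (2 powr (s + 1) * K)" if "\<tau> \<ge> 0" for \<tau>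
  proof -
    have "(\<integral>\<^sup>+j. ennreal (\<phi> (u \<tau> j) powr r) \<partial>count_space UNIV) \<le>
      (\<integral>\<^sup>+j. ennreal (2 powr (s + 1)) * (\<integral>\<^sup>+t. F t * indicator {t0..} t * indicator {u \<tau> j..<2 * u \<tau> j} t \<partial>lborel) \<partial>count_space UNIV)"
      by (intro nn_integral_mono level)
    also have "\<dots> = ennreal (2 powr (s + 1)) * (\<integral>\<^sup>+j. (\<integral>\<^sup>+t. F t * indicator {t0..} t * indicator {u \<tau> j..<2 * u \<tau> j} t \<partial>lborel) \<partial>count_space UNIV)"
      by (intro nn_integral_cmult) simp
    also have "(\<integral>\<^sup>+j. (\<integral>\<^sup>+t. F t * indicator {t0..} t * indicator {u \<tau> j..<2 * u \<tau> j} t \<partial>lborel) \<partial>count_space UNIV) =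
      (\<integral>\<^sup>+t. (\<integral>\<^sup>+j. F t * indicator {t0..} t * indicator {u \<tau> j..<2 * u \<tau> j} t \<partial>count_space UNIV) \<partial>lborel)"
      using Fm by (intro nn_integral_count_space_nn_integral[symmetric]) auto
    also have "\<dots> \<le> (\<integral>\<^sup>+t. F t * indicator {t0..} t \<partial>lborel)"
    proof (intro nn_integral_mono)
      fix t
      have "(\<integral>\<^sup>+j. F t * indicator {t0..} t * indicator {u \<tau> j..<2 * u \<tau> j} t \<partial>count_space UNIV) =
        (\<integral>\<^sup>+j. (if t \<in> {u \<tau> j..<2 * u \<tau> j} then F t * indicator {t0..} t else 0) \<partial>count_space UNIV)"
        by (intro nn_integral_cong) auto
      also have "\<dots> \<le> F t * indicator {t0..} t"
      proof (rule nn_integral_count_space_disjoint_le)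
        have aux: "i \<le> j" if "t \<in> {u \<tau> i..<2 * u \<tau> i}" "t \<in> {u \<tau> j..<2 * u \<tau> j}" for i j
        proof (rule ccontr)
          assume "\<not> i \<le> j"
          then have "real_of_int j + 1 \<le> real_of_int i" by linarith
          then have "2 powr (real_of_int j + 1) \<le> 2 powr real_of_int i" by simp
          then have "\<tau> / 2 powr real_of_int i \<le> \<tau> / 2 powr (real_of_int j + 1)"
            using \<open>\<tau> \<ge> 0\<close> by (intro divide_left_mono) auto
          then have "2 * u \<tau> i \<le> u \<tau> j" by (simp add: u_def powr_add)
          then show False using that by auto
        qed
        show "i = j" if "t \<in> {u \<tau> i..<2 * u \<tau> i}" "t \<in> {u \<tau> j..<2 * u \<tau> j}" for i j
          using aux[of i j] aux[of j i] that by linarith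
      qed
      finally show "(\<integral>\<^sup>+j. F t * indicator {t0..} t * indicator {u \<tau> j..<2 * u \<tau> j} t \<partial>count_space UNIV) \<le> F t * indicator {t0..} t" .
    qed
    finally show ?thesis using K by (simp add: ennreal_mult mult_left_mono)
  qed
  define M0 where "M0 = 2 powr (s + 1) * K"
  \<comment> \<open>One constant for two bounds: the first summand bounds \<phi>, by the term j = 0
    of the sum, and the second bounds the sum itself. The \<open>+ 1\<close> makes it
    positive.\<close>
  define M where "M = M0 powr (1 / r) + M0 + 1"
  have M0: "M0 \<ge> 0" using K by (simp add: M0_def)
  have "\<phi> t \<le> M" for t
  proof (cases "t > 0")
    case True
    have "ennreal (\<phi> (u t 0) powr r) \<le> (\<integral>\<^sup>+j. ennreal (\<phi> (u t j) powr r) \<partial>count_space UNIV)"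
      by (rule nn_integral_ge_point) simp
    also have "\<dots> \<le> ennreal M0" unfolding M0_def using True by (intro sum) simp
    finally have "\<phi> t powr r \<le> M0" using M0 by (simp add: u_def)
    then have "(\<phi> t powr r) powr (1 / r) \<le> M0 powr (1 / r)" using r by (intro powr_mono2) auto
    then show ?thesis using r \<phi>0[of t] M0 by (simp add: powr_powr M_def)
  next
    case False
    then show ?thesis using t0 M0 by (simp add: \<phi>_def M_def add_nonneg_nonneg)
  qed
  moreover have "(\<integral>\<^sup>+j. ennreal (\<phi> (t / 2 powr real_of_int j) powr (s / p)) \<partial>count_space UNIV) \<le> ennreal M" if "t \<ge> 0" for t
  proof -
    have "ennreal (2 powr (s + 1) * K) \<le> ennreal M" using M0 unfolding M_def M0_def[symmetric] by (intro ennreal_leI) simp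
    then show ?thesis using sum[OF that] unfolding u_def r_def by (rule order_trans[rotated])
  qed
  moreover have "M > 0" using M0 by (simp add: M_def add_nonneg_pos)
  ultimately show ?thesis using \<phi>0 \<phi>m Aphi by blast
qed

section \<open>Dyadic cubes\<close>

lemma nn_integral_count_space_swap:
  "(\<integral>\<^sup>+x. \<integral>\<^sup>+y. f x y \<partial>count_space UNIV \<partial>count_space UNIV) =
   (\<integral>\<^sup>+y. \<integral>\<^sup>+x. f x y \<partial>count_space UNIV \<partial>count_space UNIV)"
  by (rule trans[OF nn_integral_fst_count_space[of "\<lambda>(x, y). f x y", unfolded split_conv]
    nn_integral_snd_count_space[of "\<lambda>(x, y). f x y", unfolded split_conv, symmetric]])

lemma nn_integral_count_space_geometric:
  assumes "0 \<le> x" "x < (1::real)"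
  shows "(\<integral>\<^sup>+n. ennreal (x ^ n) \<partial>count_space UNIV) = ennreal (1 / (1 - x))"
proof -
  have "(\<Sum>n. ennreal (x ^ n)) = ennreal (\<Sum>n. x ^ n)"
    using assms by (intro suminf_ennreal2 summable_geometric) auto
  then show ?thesis using assms by (simp only: nn_integral_count_space_nat suminf_geometric real_norm_def abs_of_nonneg)
qed

text \<open>The dyadic cube with index \<open>(k, m)\<close> is \<open>\<Prod>\<^sub>i [m\<^sub>i 2\<^sup>k, (m\<^sub>i + 1) 2\<^sup>k)\<close>.\<close>

definition dyadic :: "int \<times> ('d \<Rightarrow> int) \<Rightarrow> (real^'d) set" where
  "dyadic Q = {x. \<forall>i. \<lfloor>x $ i / 2 powr real_of_int (fst Q)\<rfloor> = snd Q i}"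

text \<open>The dyadic ancestor \<open>n\<close> generations up; \<open>div\<close> rounds towards
  minus infinity, as the floor in \<open>dyadic\<close> does.\<close>

definition anc :: "nat \<Rightarrow> int \<times> ('d \<Rightarrow> int) \<Rightarrow> int \<times> ('d \<Rightarrow> int)" where
  "anc n Q = (fst Q + int n, \<lambda>i. snd Q i div 2 ^ n)"

definition shift :: "('d \<Rightarrow> int) \<Rightarrow> int \<times> ('d \<Rightarrow> int) \<Rightarrow> int \<times> ('d \<Rightarrow> int)" where
  "shift e Q = (fst Q, \<lambda>i. snd Q i + e i)"

definition vol :: "int \<times> ('d::finite \<Rightarrow> int) \<Rightarrow> real" where
  "vol Q = 2 powr (real_of_int (fst Q) * real CARD('d))"

definition neighbours :: "('d::finite \<Rightarrow> int) set" where
  "neighbours = {e. \<forall>i. e i \<in> {-1, 0, 1}}"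

lemma finite_neighbours: "finite (neighbours :: ('d::finite \<Rightarrow> int) set)"
proof -
  have "neighbours = PiE UNIV (\<lambda>_::'d. {-1, 0, 1::int})" by (auto simp: neighbours_def PiE_def)
  moreover have "finite (PiE UNIV (\<lambda>_::'d. {-1, 0, 1::int}))" by (intro finite_PiE) auto
  ultimately show ?thesis by metis
qed

lemma vol_pos: "vol Q > 0"
  by (simp add: vol_def)

lemma dyadic_iff:
  "x \<in> dyadic Q \<longleftrightarrow> (\<forall>i. real_of_int (snd Q i) * 2 powr real_of_int (fst Q) \<le> x $ i \<and>
     x $ i < (real_of_int (snd Q i) + 1) * 2 powr real_of_int (fst Q))"
  unfolding dyadic_def mem_Collect_eq floor_eq_iff
  by (simp add: pos_le_divide_eq pos_divide_less_eq)

lemma dyadic_borel: "dyadic Q \<in> sets borel"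
proof -
  have "dyadic Q = (\<Inter>i. {x. real_of_int (snd Q i) * 2 powr real_of_int (fst Q) \<le> x $ i} \<inter>
     {x. x $ i < (real_of_int (snd Q i) + 1) * 2 powr real_of_int (fst Q)})"
    by (auto simp: dyadic_iff)
  also have "\<dots> \<in> sets borel"
    by (intro sets.countable_INT' sets.Int borel_closed borel_open closed_Collect_le open_Collect_less
      continuous_intros) auto
  finally show ?thesis .
qed

lemma dyadic_sets: "dyadic Q \<in> sets lebesgue"
  using dyadic_borel[of Q] by (intro sets_completionI_sets) simp

lemma emeasure_dyadic: "emeasure lebesgue (dyadic Q) = ennreal (vol Q)"
  for Q :: "int \<times> ('d::finite \<Rightarrow> int)"
proof -
  define c where "c = 2 powr real_of_int (fst Q)"
  define a b :: "real^'d" where "a = (\<chi> i. real_of_int (snd Q i) * c)" and "b = (\<chi> i. (real_of_int (snd Q i) + 1) * c)"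
  have c: "c > 0" by (simp add: c_def)
  have ba: "(b - a) \<bullet> v = c" if "v \<in> Basis" for v
    using that by (auto simp: Basis_vec_def inner_axis a_def b_def algebra_simps)
  then have ab: "a \<bullet> v \<le> b \<bullet> v" if "v \<in> Basis" for v
    using ba[OF that] c by (simp add: inner_diff_left)
  have prod: "(\<Prod>v\<in>Basis. (b - a) \<bullet> v) = vol Q"
    using ba by (simp add: vol_def c_def powr_powr powr_realpow[symmetric])
  have "box a b \<subseteq> dyadic Q" "dyadic Q \<subseteq> cbox a b"
    by (auto simp: dyadic_iff mem_box_cart a_def b_def c_def less_imp_le)
  then have "emeasure lborel (box a b) \<le> emeasure lborel (dyadic Q)" "emeasure lborel (dyadic Q) \<le> emeasure lborel (cbox a b)"
    by (intro emeasure_mono; use dyadic_borel[of Q] in simp)+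
  then have "emeasure lborel (dyadic Q) = ennreal (vol Q)"
    using ab by (simp add: emeasure_lborel_box emeasure_lborel_cbox prod)
  then show ?thesis using dyadic_borel[of Q] by simp
qed

lemma dyadic_disjoint:
  assumes "fst P = fst Q" "x \<in> dyadic P" "x \<in> dyadic Q"
  shows "P = Q"
  using assms by (auto simp: dyadic_def prod_eq_iff)

lemma dyadic_subset_anc: "dyadic Q \<subseteq> dyadic (anc n Q)"
proof
  fix x assume x: "x \<in> dyadic Q"
  have "\<lfloor>x $ i / 2 powr real_of_int (fst Q + int n)\<rfloor> = \<lfloor>x $ i / 2 powr real_of_int (fst Q)\<rfloor> div 2 ^ n" for i
  proof -
    have "x $ i / 2 powr real_of_int (fst Q + int n) = (x $ i / 2 powr real_of_int (fst Q)) / real_of_int (2 ^ n)"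
      by (simp add: powr_add powr_realpow)
    then show ?thesis using floor_divide_real_eq_div[of "2 ^ n" "x $ i / 2 powr real_of_int (fst Q)"] by (simp only: zero_le_power zero_le_numeral simp_thms)
  qed
  then show "x \<in> dyadic (anc n Q)" using x by (simp add: dyadic_def anc_def)
qed

lemma anc_anc: "anc m (anc n Q) = anc (n + m) Q"
  by (simp add: anc_def zdiv_zmult2_eq power_add)

lemma anc_0: "anc 0 Q = Q"
  by (simp add: anc_def)

lemma vol_anc: "vol (anc n Q) = 2 powr (real n * real CARD('d)) * vol Q"
  for Q :: "int \<times> ('d::finite \<Rightarrow> int)"
  by (simp add: vol_def anc_def powr_add[symmetric] algebra_simps)

lemma vol_shift: "vol (shift e Q) = vol Q"
  by (simp add: vol_def shift_def)

lemma bij_shift: "bij (shift e)"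
  by (rule bijI', (simp add: shift_def prod_eq_iff fun_eq_iff),
      rule_tac x="shift (\<lambda>i. - e i) y" in exI, simp add: shift_def)

lemma nn_integral_shift: "(\<integral>\<^sup>+Q. f (shift e Q) \<partial>count_space UNIV) = (\<integral>\<^sup>+Q. f Q \<partial>count_space UNIV)"
  by (rule nn_integral_bij_count_space[OF bij_shift])

lemma dyadic_meet_imp_anc:
  assumes "x \<in> dyadic P" "x \<in> dyadic Q" "fst P \<le> fst Q"
  shows "Q = anc (nat (fst Q - fst P)) P"
proof (rule dyadic_disjoint)
  show "x \<in> dyadic (anc (nat (fst Q - fst P)) P)" using assms(1) dyadic_subset_anc by blast
qed (use assms in \<open>auto simp: anc_def\<close>)

text \<open>Passing from m to m+1 changes m div 2^n by 0 or 1, so an offset from {-1, 0, 1} turns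
  into another one. A sum over descendants \<open>Q\<close> of \<open>P\<close> that involves
  \<open>Q + e\<close> thereby becomes a sum over descendants of neighbours of
  \<open>P\<close>.\<close>

lemma anc_shift:
  assumes "e \<in> neighbours"
  shows "\<exists>e'\<in>neighbours. anc n (shift e Q) = shift e' (anc n Q)"
proof -
  define e' where "e' i = (snd Q i + e i) div 2 ^ n - snd Q i div 2 ^ n" for i
  have "e' i \<in> {-1, 0, 1}" for i
  proof -
    have "e i \<in> {-1, 0, 1}" using assms by (simp add: neighbours_def)
    moreover have "(m + 1) div 2 ^ n - m div 2 ^ n \<in> {0, 1}" for m :: int
    proof -
      have "m div 2 ^ n \<le> (m + 1) div 2 ^ n" by (intro zdiv_mono1) auto
      moreover have "(m + 1) div 2 ^ n \<le> (m + 2 ^ n) div 2 ^ n" by (intro zdiv_mono1) auto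
      moreover have "(m + 2 ^ n) div 2 ^ n = m div 2 ^ n + 1" by simp
      ultimately show ?thesis by auto
    qed
    from this[of "snd Q i"] this[of "snd Q i - 1"] \<open>e i \<in> {-1, 0, 1}\<close> show ?thesis
      by (auto simp: e'_def)
  qed
  then show ?thesis
    by (intro bexI[of _ e']) (auto simp: neighbours_def anc_def shift_def e'_def)
qed

text \<open>The sum runs over all indices with a case distinction, so that Tonelli over the
  countable index type applies; at each point at most one term survives.\<close>

lemma sum_disjoint_dyadic_le:
  fixes S :: "(int \<times> ('d::finite \<Rightarrow> int)) set" and F :: "real^'d \<Rightarrow> ennreal"
  assumes F: "F \<in> borel_measurable lebesgue"
    and disj: "\<And>P Q x. P \<in> S \<Longrightarrow> Q \<in> S \<Longrightarrow> x \<in> dyadic P \<Longrightarrow> x \<in> dyadic Q \<Longrightarrow> P = Q"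
    and sub: "\<And>P. P \<in> S \<Longrightarrow> dyadic P \<subseteq> R"
  shows "(\<integral>\<^sup>+Q. (if Q \<in> S then \<integral>\<^sup>+x\<in>dyadic Q. F x \<partial>lebesgue else 0) \<partial>count_space UNIV) \<le> (\<integral>\<^sup>+x\<in>R. F x \<partial>lebesgue)"
proof -
  have "(\<integral>\<^sup>+Q. (if Q \<in> S then \<integral>\<^sup>+x\<in>dyadic Q. F x \<partial>lebesgue else 0) \<partial>count_space UNIV) =
    (\<integral>\<^sup>+Q. \<integral>\<^sup>+x. (if Q \<in> S then F x * indicator (dyadic Q) x else 0) \<partial>lebesgue \<partial>count_space UNIV)"
    by (intro nn_integral_cong) auto
  also have "\<dots> = (\<integral>\<^sup>+x. \<integral>\<^sup>+Q. (if Q \<in> S then F x * indicator (dyadic Q) x else 0) \<partial>count_space UNIV \<partial>lebesgue)"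
  proof (intro nn_integral_count_space_nn_integral[symmetric] countableI_type)
    fix Q
    show "(\<lambda>x. if Q \<in> S then F x * indicator (dyadic Q) x else 0) \<in> borel_measurable lebesgue"
      by (cases "Q \<in> S") (use F dyadic_sets[of Q] in \<open>simp_all add: borel_measurable_times_ennreal borel_measurable_indicator\<close>)
  qed
  also have "\<dots> \<le> (\<integral>\<^sup>+x\<in>R. F x \<partial>lebesgue)"
  proof (intro nn_integral_mono)
    fix x
    have "(\<integral>\<^sup>+Q. (if Q \<in> S then F x * indicator (dyadic Q) x else 0) \<partial>count_space UNIV) =
      (\<integral>\<^sup>+Q. (if Q \<in> S \<and> x \<in> dyadic Q then F x * indicator R x else 0) \<partial>count_space UNIV)"
      using sub by (intro nn_integral_cong) (auto split: split_indicator)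
    also have "\<dots> \<le> F x * indicator R x"
      by (rule nn_integral_count_space_disjoint_le) (use disj in blast)
    finally show "(\<integral>\<^sup>+Q. (if Q \<in> S then F x * indicator (dyadic Q) x else 0) \<partial>count_space UNIV) \<le> F x * indicator R x" .
  qed
  finally show ?thesis .
qed

lemma sum_descendants_le:
  fixes P :: "int \<times> ('d::finite \<Rightarrow> int)" and F :: "real^'d \<Rightarrow> ennreal"
  assumes "F \<in> borel_measurable lebesgue"
  shows "(\<integral>\<^sup>+Q. (if anc n Q = P then \<integral>\<^sup>+x\<in>dyadic Q. F x \<partial>lebesgue else 0) \<partial>count_space UNIV) \<le> (\<integral>\<^sup>+x\<in>dyadic P. F x \<partial>lebesgue)"
proof -
  have "P' = Q" if "anc n P' = P" "anc n Q = P" "x \<in> dyadic P'" "x \<in> dyadic Q" for P' Q x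
  proof (rule dyadic_disjoint)
    have "fst (anc n P') = fst (anc n Q)" using that by simp
    then show "fst P' = fst Q" by (simp add: anc_def)
  qed (use that in auto)
  moreover have "dyadic Q \<subseteq> dyadic P" if "anc n Q = P" for Q using dyadic_subset_anc[of Q n] that by simp
  ultimately show ?thesis
    by (rule sum_disjoint_dyadic_le[OF assms, where S="{Q. anc n Q = P}" and R="dyadic P", unfolded mem_Collect_eq])
qed

lemma sum_vol_descendants_le:
  fixes P :: "int \<times> ('d::finite \<Rightarrow> int)"
  shows "(\<integral>\<^sup>+Q. (if anc n Q = P then ennreal (vol Q) else 0) \<partial>count_space UNIV) \<le> ennreal (vol P)"
  using sum_descendants_le[of "\<lambda>_. 1" n P] by (simp add: emeasure_dyadic dyadic_sets cong: if_cong)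

section \<open>Two convexity inequalities\<close>

lemma powr_sum_ineq:
  fixes a b :: real
  assumes "1 < s" "1 < s'" "1 / s + 1 / s' = 1" "0 \<le> a" "0 \<le> b"
  shows "a * b \<le> a powr s + b powr s'"
proof -
  have "a * b \<le> a powr s / s + b powr s' / s'" using assms by (intro Youngs_inequality)
  also have "\<dots> \<le> a powr s / 1 + b powr s' / 1" using assms by (intro add_mono divide_left_mono) auto
  finally show ?thesis by simp
qed

text \<open>Jensen's inequality through the tangent r m^(r-1) f \<le> f^r + (r-1) m^r, a case of
  Young's inequality. Integrated against \<open>w\<close> it gives the claim for total mass at most
  1, without normalising \<open>w\<close> to a probability density.\<close>

lemma weighted_jensen:
  fixes w f :: "'a \<Rightarrow> real"
  assumes w: "w \<in> borel_measurable M" "\<And>x. 0 \<le> w x" "(\<integral>\<^sup>+x. ennreal (w x) \<partial>M) \<le> 1"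
    and f: "f \<in> borel_measurable M" "\<And>x. 0 \<le> f x" and r: "1 \<le> r" and m: "0 \<le> m"
    and eq: "(\<integral>\<^sup>+x. ennreal (w x * f x) \<partial>M) = ennreal m"
  shows "ennreal (m powr r) \<le> (\<integral>\<^sup>+x. ennreal (w x * f x powr r) \<partial>M)"
proof (cases "r = 1")
  case True
  then show ?thesis using eq m f by simp
next
  case False
  then have r: "r > 1" using r by simp
  define q where "q = r / (r - 1)"
  have q: "q > 1" "1 / r + 1 / q = 1" using r by (auto simp: q_def divide_simps)
  have mm: "m powr (r - 1) * m = m powr r" using m by (cases "m = 0") (auto simp: powr_mult_base mult.commute)
  have point: "r * m powr (r - 1) * f x \<le> f x powr r + (r - 1) * m powr r" for x
  proof -
    have "f x * m powr (r - 1) \<le> f x powr r / r + (m powr (r - 1)) powr q / q"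
      using q r f m by (intro Youngs_inequality) auto
    also have "(m powr (r - 1)) powr q = m powr r" using r by (simp add: powr_powr q_def)
    finally have "r * (f x * m powr (r - 1)) \<le> r * (f x powr r / r + m powr r / q)" using r by (intro mult_left_mono) auto
    also have "\<dots> = f x powr r + (r - 1) * m powr r" using r by (simp add: q_def field_simps)
    finally show ?thesis by (simp add: mult_ac)
  qed
  have "ennreal (r * m powr r) = ennreal (r * m powr (r - 1)) * (\<integral>\<^sup>+x. ennreal (w x * f x) \<partial>M)"
    using r m mm unfolding eq by (simp add: ennreal_mult[symmetric] mult.assoc)
  also have "\<dots> = (\<integral>\<^sup>+x. ennreal (r * m powr (r - 1)) * ennreal (w x * f x) \<partial>M)"
    using w f by (intro nn_integral_cmult[symmetric]) simp
  also have "\<dots> \<le> (\<integral>\<^sup>+x. ennreal (w x * f x powr r) + ennreal ((r - 1) * m powr r) * ennreal (w x) \<partial>M)"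
  proof (intro nn_integral_mono)
    fix x
    have "w x * (r * m powr (r - 1) * f x) \<le> w x * (f x powr r + (r - 1) * m powr r)"
      using point w by (intro mult_left_mono) auto
    then have "ennreal ((r * m powr (r - 1)) * (w x * f x)) \<le> ennreal (w x * f x powr r + ((r - 1) * m powr r) * w x)"
      by (intro ennreal_leI) (simp add: algebra_simps)
    then show "ennreal (r * m powr (r - 1)) * ennreal (w x * f x) \<le> ennreal (w x * f x powr r) + ennreal ((r - 1) * m powr r) * ennreal (w x)"
      using r w(2)[of x] f(2)[of x] by (simp add: ennreal_mult ennreal_plus)
  qed
  also have "\<dots> = (\<integral>\<^sup>+x. ennreal (w x * f x powr r) \<partial>M) + ennreal ((r - 1) * m powr r) * (\<integral>\<^sup>+x. ennreal (w x) \<partial>M)"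
    using w f by (subst nn_integral_add) (auto simp: nn_integral_cmult)
  also have "\<dots> \<le> (\<integral>\<^sup>+x. ennreal (w x * f x powr r) \<partial>M) + ennreal ((r - 1) * m powr r) * 1"
    by (intro add_left_mono mult_left_mono w) simp
  finally have *: "ennreal (r * m powr r) \<le> (\<integral>\<^sup>+x. ennreal (w x * f x powr r) \<partial>M) + ennreal ((r - 1) * m powr r)" by simp
  show ?thesis
  proof (cases "\<integral>\<^sup>+x. ennreal (w x * f x powr r) \<partial>M")
    case (real z)
    have "0 \<le> (r - 1) * m powr r" using r by simp
    then have "ennreal (r * m powr r) \<le> ennreal (z + (r - 1) * m powr r)" using * real by simp
    then have "r * m powr r \<le> z + (r - 1) * m powr r"
      using real \<open>0 \<le> (r - 1) * m powr r\<close> by (subst (asm) ennreal_le_iff) simp_all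
    then show ?thesis using real by (simp add: algebra_simps ennreal_leI)
  qed simp
qed

section \<open>Orlicz averages over dyadic cubes\<close>

text \<open>\<open>\<phi>\<close> and \<open>M\<close> are the majorant and the constant obtained
  for \<open>A\<close> from \<open>B_class p s\<close>. The function \<open>h\<close> has p-norm at
  most 1, so that the bounds on sums over cubes do not depend on it.\<close>

locale dyadic_averages =
  fixes A \<phi> :: "real \<Rightarrow> real" and M p s :: real and h :: "real^'d \<Rightarrow> real"
  assumes A: "young_function A" and p: "1 < p" and ps: "p \<le> s"
    and M: "M > 0" and \<phi>: "\<And>t. 0 \<le> \<phi> t" "\<And>t. \<phi> t \<le> M" "\<phi> \<in> borel_measurable borel"
    and A_le: "\<And>t. 0 \<le> t \<Longrightarrow> A t \<le> 1 / 2 + \<phi> t * t powr p"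
    and sum_\<phi>: "\<And>t. 0 \<le> t \<Longrightarrow>
      (\<integral>\<^sup>+j. ennreal (\<phi> (t / 2 powr real_of_int j) powr (s / p)) \<partial>count_space UNIV) \<le> ennreal M"
    and h: "h \<in> borel_measurable lebesgue" "\<And>x. 0 \<le> h x" "(\<integral>\<^sup>+x. ennreal (h x powr p) \<partial>lebesgue) \<le> 1"
begin

definition avg_norm :: "int \<times> ('d \<Rightarrow> int) \<Rightarrow> ennreal" where
  "avg_norm Q = orlicz_norm A (dyadic Q) (\<lambda>x. ennreal (h x))"

definition avg :: "int \<times> ('d \<Rightarrow> int) \<Rightarrow> real" where
  "avg Q = enn2real (avg_norm Q)"

text \<open>Its multiple by 2^(-jp) majorises A(h/2^j) - 1/2, while it stays below M h^p for every
  \<open>j\<close>.\<close>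

definition level_fun :: "int \<Rightarrow> real^'d \<Rightarrow> real" where
  "level_fun j x = h x powr p * \<phi> (h x / 2 powr real_of_int j)"

section \<open>Modular estimates at dyadic levels\<close>

lemma emeasure_dyadic_pos_fin:
  "0 < emeasure lebesgue (dyadic Q)" "emeasure lebesgue (dyadic Q) < \<infinity>" for Q :: "int \<times> ('d \<Rightarrow> int)"
  using vol_pos[of Q] by (simp_all add: emeasure_dyadic)

lemma avg_norm_less_imp:
  assumes "avg_norm Q < ennreal c"
  shows "(\<integral>\<^sup>+x\<in>dyadic Q. ennreal (A (h x / c)) \<partial>lebesgue) \<le> ennreal (vol Q)"
proof -
  have c: "c > 0" using assms by (cases "c > 0") (auto simp: ennreal_neg)
  show ?thesis
    using orlicz_norm_less_imp[OF A emeasure_dyadic_pos_fin assms[unfolded avg_norm_def]] h(2) c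
    by (simp add: young_ext_ennreal emeasure_dyadic)
qed

lemma avg_norm_le:
  assumes "c > 0" "(\<integral>\<^sup>+x\<in>dyadic Q. ennreal (A (h x / c)) \<partial>lebesgue) \<le> ennreal (vol Q)"
  shows "avg_norm Q \<le> ennreal c"
  unfolding avg_norm_def
  by (rule orlicz_norm_le[OF emeasure_dyadic_pos_fin]) (use assms h(2) in \<open>simp_all add: young_ext_ennreal emeasure_dyadic\<close>)

lemma A_h_measurable: "c > 0 \<Longrightarrow> (\<lambda>x. ennreal (A (h x / c))) \<in> borel_measurable lebesgue"
  using young_function_comp_measurable[OF A h(1,2)] .

lemma level_fun_nonneg: "0 \<le> level_fun j x"
  by (simp add: level_fun_def \<phi>)

lemma \<phi>_measurable: "(\<lambda>x. \<phi> (h x / 2 powr real_of_int j)) \<in> borel_measurable lebesgue"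
  using h(1) by (intro measurable_compose[OF _ \<phi>(3)]) simp

lemma level_fun_measurable: "level_fun j \<in> borel_measurable lebesgue"
  unfolding level_fun_def by (intro borel_measurable_times \<phi>_measurable) (use h(1) in simp)

lemma integral_level_fun_le: "(\<integral>\<^sup>+x. ennreal (level_fun j x) \<partial>lebesgue) \<le> ennreal M"
proof -
  have "(\<integral>\<^sup>+x. ennreal (level_fun j x) \<partial>lebesgue) \<le> (\<integral>\<^sup>+x. ennreal M * ennreal (h x powr p) \<partial>lebesgue)"
  proof (intro nn_integral_mono)
    fix x
    have "level_fun j x \<le> M * h x powr p"
      using mult_left_mono[OF \<phi>(2), of "h x powr p" "h x / 2 powr real_of_int j"] by (simp add: level_fun_def mult.commute)
    then show "ennreal (level_fun j x) \<le> ennreal M * ennreal (h x powr p)"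
      using M by (simp add: ennreal_mult[symmetric] ennreal_leI)
  qed
  also have "\<dots> = ennreal M * (\<integral>\<^sup>+x. ennreal (h x powr p) \<partial>lebesgue)"
    using h(1) by (intro nn_integral_cmult) auto
  also have "\<dots> \<le> ennreal M * 1" by (intro mult_left_mono h) simp
  finally show ?thesis by simp
qed

lemma A_level_le: "A (h x / 2 powr real_of_int j) \<le> 1 / 2 + 2 powr (- real_of_int j * p) * level_fun j x"
proof -
  have "A (h x / 2 powr real_of_int j) \<le> 1 / 2 + \<phi> (h x / 2 powr real_of_int j) * (h x / 2 powr real_of_int j) powr p"
    using h(2) by (intro A_le) simp
  also have "(h x / 2 powr real_of_int j) powr p = h x powr p * 2 powr (- real_of_int j * p)"
    using h(2) by (simp add: powr_divide powr_powr powr_minus_divide)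
  finally show ?thesis by (simp add: level_fun_def mult_ac)
qed

lemma integral_A_level_le:
  "(\<integral>\<^sup>+x\<in>dyadic Q. ennreal (A (h x / 2 powr real_of_int j)) \<partial>lebesgue) \<le>
   ennreal (vol Q / 2) + ennreal (2 powr (- real_of_int j * p)) * (\<integral>\<^sup>+x\<in>dyadic Q. ennreal (level_fun j x) \<partial>lebesgue)"
proof -
  have "(\<integral>\<^sup>+x\<in>dyadic Q. ennreal (A (h x / 2 powr real_of_int j)) \<partial>lebesgue) \<le>
    (\<integral>\<^sup>+x. ennreal (1 / 2) * indicator (dyadic Q) x + ennreal (2 powr (- real_of_int j * p)) * (ennreal (level_fun j x) * indicator (dyadic Q) x) \<partial>lebesgue)"
  proof (intro nn_integral_mono)
    fix x
    have "ennreal (A (h x / 2 powr real_of_int j)) \<le> ennreal (1 / 2 + 2 powr (- real_of_int j * p) * level_fun j x)"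
      by (intro ennreal_leI A_level_le)
    also have "\<dots> = ennreal (1 / 2) + ennreal (2 powr (- real_of_int j * p)) * ennreal (level_fun j x)"
      using level_fun_nonneg by (simp only: ennreal_mult ennreal_plus powr_ge_zero mult_nonneg_nonneg divide_nonneg_nonneg zero_le_one zero_le_numeral)
    finally show "ennreal (A (h x / 2 powr real_of_int j)) * indicator (dyadic Q) x \<le>
      ennreal (1 / 2) * indicator (dyadic Q) x + ennreal (2 powr (- real_of_int j * p)) * (ennreal (level_fun j x) * indicator (dyadic Q) x)"
      by (cases "x \<in> dyadic Q") auto
  qed
  also have "\<dots> = ennreal (1 / 2) * ennreal (vol Q) + ennreal (2 powr (- real_of_int j * p)) * (\<integral>\<^sup>+x\<in>dyadic Q. ennreal (level_fun j x) \<partial>lebesgue)"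
    using level_fun_measurable dyadic_sets[of Q]
    by (subst nn_integral_add) (auto simp: nn_integral_cmult emeasure_dyadic intro!: borel_measurable_times_ennreal)
  also have "ennreal (1 / 2) * ennreal (vol Q) = ennreal (vol Q / 2)"
    using vol_pos[of Q] by (subst ennreal_mult[symmetric]) auto
  finally show ?thesis .
qed

text \<open>The constant 1/2 uses up half of |Q|; the remaining part is at most 2^(-jp) M because
  the integral of h^p is at most 1. Hence averages are small on large cubes, which is what makes
  maximal cubes exist.\<close>

lemma avg_norm_le_of_large_vol:
  assumes "2 * M * 2 powr (- real_of_int j * p) \<le> vol Q"
  shows "avg_norm Q \<le> ennreal (2 powr real_of_int j)"
proof (rule avg_norm_le)
  have "(\<integral>\<^sup>+x\<in>dyadic Q. ennreal (level_fun j x) \<partial>lebesgue) \<le> (\<integral>\<^sup>+x. ennreal (level_fun j x) \<partial>lebesgue)"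
    by (intro nn_integral_mono) (auto split: split_indicator)
  also have "\<dots> \<le> ennreal M" by (rule integral_level_fun_le)
  finally have "(\<integral>\<^sup>+x\<in>dyadic Q. ennreal (level_fun j x) \<partial>lebesgue) \<le> ennreal M" .
  then have "(\<integral>\<^sup>+x\<in>dyadic Q. ennreal (A (h x / 2 powr real_of_int j)) \<partial>lebesgue) \<le>
      ennreal (vol Q / 2) + ennreal (2 powr (- real_of_int j * p)) * ennreal M"
    using integral_A_level_le[where Q=Q and j=j] by (meson add_left_mono mult_left_mono order_trans zero_le)
  also have "\<dots> = ennreal (vol Q / 2 + 2 powr (- real_of_int j * p) * M)"
    using M vol_pos[of Q] by (simp add: ennreal_mult)
  also have "\<dots> \<le> ennreal (vol Q)" using assms by (intro ennreal_leI) (simp add: mult_ac)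
  finally show "(\<integral>\<^sup>+x\<in>dyadic Q. ennreal (A (h x / 2 powr real_of_int j)) \<partial>lebesgue) \<le> ennreal (vol Q)" .
qed simp

text \<open>A norm above 2^j forces the modular integral at 2^j above |Q|. The constant 1/2 accounts
  for half of |Q| only, so \<open>level_fun\<close> must carry the other half, whence the factor
  2.\<close>

lemma vol_le_integral_level_fun:
  assumes "ennreal (2 powr real_of_int j) < avg_norm Q"
  shows "ennreal (vol Q) \<le> ennreal (2 * 2 powr (- real_of_int j * p)) * (\<integral>\<^sup>+x\<in>dyadic Q. ennreal (level_fun j x) \<partial>lebesgue)"
proof -
  have "\<not> (\<integral>\<^sup>+x\<in>dyadic Q. ennreal (A (h x / 2 powr real_of_int j)) \<partial>lebesgue) \<le> ennreal (vol Q)"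
    using avg_norm_le[of "2 powr real_of_int j" Q] assms by (metis leD powr_gt_zero zero_neq_numeral)
  then have le: "ennreal (vol Q) \<le> ennreal (vol Q / 2) + ennreal (2 powr (- real_of_int j * p)) * (\<integral>\<^sup>+x\<in>dyadic Q. ennreal (level_fun j x) \<partial>lebesgue)"
    using integral_A_level_le[of j Q] by (auto simp: not_le intro: less_imp_le less_le_trans)
  show ?thesis
  proof (cases "\<integral>\<^sup>+x\<in>dyadic Q. ennreal (level_fun j x) \<partial>lebesgue")
    case (real I)
    have "ennreal (vol Q) \<le> ennreal (vol Q / 2 + 2 powr (- real_of_int j * p) * I)"
      using le vol_pos[of Q] real by (simp add: ennreal_mult ennreal_plus)
    then have "vol Q \<le> 2 * 2 powr (- real_of_int j * p) * I"
      using real vol_pos[of Q] by (subst (asm) ennreal_le_iff) (auto simp: add_nonneg_nonneg)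
    then show ?thesis using real by (simp add: ennreal_mult[symmetric] ennreal_leI)
  next
    case top
    then show ?thesis by (simp add: ennreal_mult_top)
  qed
qed

lemma avg_norm_finite: "avg_norm Q < \<infinity>"
proof -
  \<comment> \<open>The maximum with 0 makes the rounded level nonnegative, so that multiplying it
    by p > 1 does not decrease it.\<close>
  define b where "b = max 0 (log 2 (2 * M / vol Q))"
  have "2 * M / vol Q = 2 powr (log 2 (2 * M / vol Q))" using M vol_pos[of Q] by simp
  also have "\<dots> \<le> 2 powr (real_of_int \<lceil>b\<rceil> * p)"
  proof (intro powr_mono)
    have "log 2 (2 * M / vol Q) \<le> real_of_int \<lceil>b\<rceil> * 1" "0 \<le> real_of_int \<lceil>b\<rceil>" by (auto simp: b_def) linarith
    then show "log 2 (2 * M / vol Q) \<le> real_of_int \<lceil>b\<rceil> * p"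
      using p mult_left_mono[of 1 p "real_of_int \<lceil>b\<rceil>"] by linarith
  qed simp
  finally have "2 * M * 2 powr (- real_of_int \<lceil>b\<rceil> * p) \<le> vol Q"
    using vol_pos[of Q] by (simp add: powr_minus divide_simps mult.commute)
  then have "avg_norm Q \<le> ennreal (2 powr real_of_int \<lceil>b\<rceil>)" by (rule avg_norm_le_of_large_vol)
  then show ?thesis by (simp add: le_less_trans)
qed

lemma avg_norm_eq: "avg_norm Q = ennreal (avg Q)" and avg_nonneg: "0 \<le> avg Q"
  using avg_norm_finite[of Q] by (simp_all add: avg_def)

lemma avg_less_iff: "0 \<le> c \<Longrightarrow> ennreal c < avg_norm Q \<longleftrightarrow> c < avg Q"
  by (simp add: avg_norm_eq ennreal_less_iff)

text \<open>The parent has 2^d times the volume, and A(t/D) \<le> A(t)/D for D \<ge> 1 by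
  convexity.\<close>

lemma avg_parent: "avg Q \<le> 2 ^ CARD('d) * avg (anc 1 Q)"
proof -
  define D :: real where "D = 2 ^ CARD('d)"
  have D: "D \<ge> 1" by (simp add: D_def)
  have "avg_norm Q \<le> ennreal D * avg_norm (anc 1 Q)"
  proof (rule ennreal_le_mult_of_forall_gt)
    fix c assume c: "avg_norm (anc 1 Q) < ennreal c"
    then have c0: "c > 0" by (cases "c > 0") (auto simp: ennreal_neg)
    have volQ: "vol (anc 1 Q) = D * vol Q" by (simp add: vol_anc D_def powr_realpow)
    have "avg_norm Q \<le> ennreal (D * c)"
    proof (rule avg_norm_le)
      show "D * c > 0" using D c0 by simp
      have "(\<integral>\<^sup>+x\<in>dyadic Q. ennreal (A (h x / (D * c))) \<partial>lebesgue) \<le> (\<integral>\<^sup>+x. ennreal (1 / D) * (ennreal (A (h x / c)) * indicator (dyadic (anc 1 Q)) x) \<partial>lebesgue)"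
      proof (intro nn_integral_mono)
        fix x
        have "A ((1 / D) * (h x / c)) \<le> (1 / D) * A (h x / c)"
          using D c0 h(2)[of x] by (intro young_function_scale[OF A]) auto
        then have "ennreal (A (h x / (D * c))) \<le> ennreal (1 / D) * ennreal (A (h x / c))"
          using D c0 h(2)[of x] young_function_nonneg[OF A, of "h x / c"] by (simp add: ennreal_mult[symmetric] ennreal_leI)
        then show "ennreal (A (h x / (D * c))) * indicator (dyadic Q) x \<le> ennreal (1 / D) * (ennreal (A (h x / c)) * indicator (dyadic (anc 1 Q)) x)"
          using dyadic_subset_anc[of Q 1] by (auto split: split_indicator)
      qed
      also have "\<dots> = ennreal (1 / D) * (\<integral>\<^sup>+x\<in>dyadic (anc 1 Q). ennreal (A (h x / c)) \<partial>lebesgue)"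
        by (intro nn_integral_cmult borel_measurable_times_ennreal A_h_measurable c0 borel_measurable_indicator dyadic_sets)
      also have "\<dots> \<le> ennreal (1 / D) * ennreal (vol (anc 1 Q))"
        by (intro mult_left_mono avg_norm_less_imp c) simp
      also have "\<dots> = ennreal (vol Q)" using D vol_pos[of Q] unfolding volQ by (simp add: ennreal_mult[symmetric])
      finally show "(\<integral>\<^sup>+x\<in>dyadic Q. ennreal (A (h x / (D * c))) \<partial>lebesgue) \<le> ennreal (vol Q)" .
    qed
    then show "avg_norm Q \<le> ennreal D * ennreal c" using D c0 by (simp add: ennreal_mult)
  qed (use avg_norm_finite[of "anc 1 Q"] in auto)
  then show ?thesis using D avg_nonneg[of "anc 1 Q"] by (simp add: avg_norm_eq ennreal_mult[symmetric] D_def)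
qed

text \<open>Orlicz averages are not additive over cubes, so they are first linearised. For
  \<open>c\<close> above the average on \<open>P\<close>, convexity makes \<mu> c admissible on
  \<open>Q\<close>, where \<mu> is 1 plus the mean of A(h/c) over \<open>Q\<close>. Hence |Q| times
  the average on \<open>Q\<close> is at most c(|Q| + integral of A(h/c) over Q), and this sums to at
  most 2c|P| over disjoint \<open>Q\<close> in \<open>P\<close>.\<close>

lemma sum_descendants_avg_le:
  "(\<integral>\<^sup>+Q. (if anc n Q = P then ennreal (vol Q * avg Q) else 0) \<partial>count_space UNIV) \<le> ennreal (2 * vol P * avg P)"
proof -
  have "(\<integral>\<^sup>+Q. (if anc n Q = P then ennreal (vol Q * avg Q) else 0) \<partial>count_space UNIV) \<le> ennreal (2 * vol P) * avg_norm P"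
  proof (rule ennreal_le_mult_of_forall_gt)
    fix c assume c: "avg_norm P < ennreal c"
    then have c0: "c > 0" by (cases "c > 0") (auto simp: ennreal_neg)
    define I where "I Q = (\<integral>\<^sup>+x\<in>dyadic Q. ennreal (A (h x / c)) \<partial>lebesgue)" for Q :: "int \<times> ('d \<Rightarrow> int)"
    have IP: "I P \<le> ennreal (vol P)" unfolding I_def by (rule avg_norm_less_imp[OF c])
    have "ennreal (vol Q * avg Q) \<le> ennreal c * (ennreal (vol Q) + I Q)" if Q: "anc n Q = P" for Q
    proof -
      have "I Q \<le> I P" unfolding I_def using dyadic_subset_anc[of Q n] Q
        by (intro nn_integral_mono) (auto split: split_indicator)
      then have "I Q < \<infinity>" using IP by (simp add: le_less_trans)
      then obtain i where i: "I Q = ennreal i" "i \<ge> 0" by (cases "I Q") auto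
      define \<mu> where "\<mu> = 1 + i / vol Q"
      have \<mu>: "\<mu> \<ge> 1" using i vol_pos[of Q] by (simp add: \<mu>_def)
      have "avg_norm Q \<le> ennreal (\<mu> * c)"
      proof (rule avg_norm_le)
        show "\<mu> * c > 0" using \<mu> c0 by simp
        have "(\<integral>\<^sup>+x\<in>dyadic Q. ennreal (A (h x / (\<mu> * c))) \<partial>lebesgue) \<le> (\<integral>\<^sup>+x. ennreal (1 / \<mu>) * (ennreal (A (h x / c)) * indicator (dyadic Q) x) \<partial>lebesgue)"
        proof (intro nn_integral_mono)
          fix x
          have "A ((1 / \<mu>) * (h x / c)) \<le> (1 / \<mu>) * A (h x / c)"
            using \<mu> c0 h(2)[of x] by (intro young_function_scale[OF A]) auto
          then have "ennreal (A (h x / (\<mu> * c))) \<le> ennreal (1 / \<mu>) * ennreal (A (h x / c))"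
            using \<mu> c0 h(2)[of x] young_function_nonneg[OF A, of "h x / c"] by (simp add: ennreal_mult[symmetric] ennreal_leI)
          then show "ennreal (A (h x / (\<mu> * c))) * indicator (dyadic Q) x \<le> ennreal (1 / \<mu>) * (ennreal (A (h x / c)) * indicator (dyadic Q) x)"
            by (auto split: split_indicator)
        qed
        also have "\<dots> = ennreal (1 / \<mu>) * I Q"
          unfolding I_def by (intro nn_integral_cmult borel_measurable_times_ennreal A_h_measurable c0 borel_measurable_indicator dyadic_sets)
        also have "\<dots> = ennreal (i / \<mu>)" using \<mu> i by (simp add: ennreal_mult[symmetric])
        also have "\<dots> \<le> ennreal (vol Q)"
        proof (intro ennreal_leI)
          have "vol Q * \<mu> = vol Q + i" using vol_pos[of Q] by (simp add: \<mu>_def distrib_left)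
          then have "i \<le> vol Q * \<mu>" using vol_pos[of Q] by simp
          then show "i / \<mu> \<le> vol Q" using \<mu> by (subst pos_divide_le_eq) auto
        qed
        finally show "(\<integral>\<^sup>+x\<in>dyadic Q. ennreal (A (h x / (\<mu> * c))) \<partial>lebesgue) \<le> ennreal (vol Q)" .
      qed
      then have "avg Q \<le> \<mu> * c" using \<mu> c0 by (simp add: avg_norm_eq)
      then have "vol Q * avg Q \<le> vol Q * (\<mu> * c)" using vol_pos[of Q] by (intro mult_left_mono) auto
      also have "\<dots> = c * (vol Q + i)" using vol_pos[of Q] by (simp add: \<mu>_def field_simps)
      finally show ?thesis using i vol_pos[of Q] c0 by (simp add: ennreal_mult[symmetric] ennreal_plus[symmetric] ennreal_leI del: ennreal_plus)
    qed
    then have "(\<integral>\<^sup>+Q. (if anc n Q = P then ennreal (vol Q * avg Q) else 0) \<partial>count_space UNIV) \<le>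
        (\<integral>\<^sup>+Q. ennreal c * ((if anc n Q = P then ennreal (vol Q) else 0) + (if anc n Q = P then I Q else 0)) \<partial>count_space UNIV)"
      by (intro nn_integral_mono) auto
    also have "\<dots> = ennreal c * ((\<integral>\<^sup>+Q. (if anc n Q = P then ennreal (vol Q) else 0) \<partial>count_space UNIV) + (\<integral>\<^sup>+Q. (if anc n Q = P then I Q else 0) \<partial>count_space UNIV))"
      by (simp add: nn_integral_cmult nn_integral_add)
    also have "\<dots> \<le> ennreal c * (ennreal (vol P) + ennreal (vol P))"
      using sum_vol_descendants_le[of n P] order_trans[OF sum_descendants_le[OF A_h_measurable[OF c0], of n P] IP[unfolded I_def]]
      unfolding I_def by (intro mult_left_mono add_mono) auto
    also have "\<dots> = ennreal (2 * vol P) * ennreal c"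
      using vol_pos[of P] c0 by (simp add: ennreal_mult[symmetric] ennreal_plus[symmetric] mult_ac del: ennreal_plus)
    finally show "(\<integral>\<^sup>+Q. (if anc n Q = P then ennreal (vol Q * avg Q) else 0) \<partial>count_space UNIV) \<le> ennreal (2 * vol P) * ennreal c" .
  qed (use avg_norm_finite[of P] in auto)
  then show ?thesis using vol_pos[of P] avg_nonneg by (simp add: avg_norm_eq ennreal_mult[symmetric])
qed

subsection \<open>Maximal cubes\<close>

text \<open>All proper ancestors are tested, not just the parent, since averages need not be
  monotone along the chain of ancestors.\<close>

definition max_cubes :: "int \<Rightarrow> (int \<times> ('d \<Rightarrow> int)) set" where
  "max_cubes j = {P. 2 powr real_of_int j < avg P \<and> (\<forall>n>0. avg (anc n P) \<le> 2 powr real_of_int j)}"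

lemma max_cubes_disjoint:
  assumes "P \<in> max_cubes j" "P' \<in> max_cubes j" "x \<in> dyadic P" "x \<in> dyadic P'"
  shows "P = P'"
proof -
  have aux: "P = P'" if "P \<in> max_cubes j" "P' \<in> max_cubes j" "x \<in> dyadic P" "x \<in> dyadic P'" "fst P \<le> fst P'" for P P'
  proof -
    define n where "n = nat (fst P' - fst P)"
    have P': "P' = anc n P" unfolding n_def by (rule dyadic_meet_imp_anc[OF that(3-5)])
    have "n = 0"
    proof (rule ccontr)
      assume "n \<noteq> 0"
      then have "avg P' \<le> 2 powr real_of_int j" using that(1) unfolding P' by (simp add: max_cubes_def)
      then show False using that(2) by (simp add: max_cubes_def)
    qed
    then show ?thesis using P' by (simp add: anc_0)
  qed
  show ?thesis using aux[of P P'] aux[of P' P] assms by (cases "fst P \<le> fst P'") auto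
qed

text \<open>The n-th ancestor has volume at least 2^n |Q|, so
  \<open>avg_norm_le_of_large_vol\<close> applies from some generation on. Only finitely many
  ancestors exceed the level, and the last of them is maximal.\<close>

lemma exists_max_cube:
  assumes "2 powr real_of_int j < avg Q"
  shows "\<exists>n. anc n Q \<in> max_cubes j"
proof -
  define N where "N = {n. 2 powr real_of_int j < avg (anc n Q)}"
  obtain n0 :: nat where n0: "2 * M * 2 powr (- real_of_int j * p) / vol Q < real n0"
    using reals_Archimedean2 by blast
  have "n < n0" if "n \<in> N" for n
  proof (rule ccontr)
    assume "\<not> n < n0"
    then have "real n0 \<le> 2 powr real n"
    proof -
      have "n < 2 ^ n" by (rule less_exp)
      then have "n0 \<le> 2 ^ n" using \<open>\<not> n < n0\<close> by linarith
      then have "real n0 \<le> real (2 ^ n)" by (simp only: of_nat_le_iff)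
      then show ?thesis by (simp add: powr_realpow)
    qed
    also have "\<dots> \<le> 2 powr (real n * real CARD('d))"
      by (intro powr_mono) (auto simp: mult_le_cancel_left1 Suc_le_eq)
    finally have "2 * M * 2 powr (- real_of_int j * p) / vol Q \<le> 2 powr (real n * real CARD('d))" using n0 by linarith
    then have "2 * M * 2 powr (- real_of_int j * p) \<le> vol (anc n Q)"
      using vol_pos[of Q] by (simp add: vol_anc pos_divide_le_eq)
    then have "avg (anc n Q) \<le> 2 powr real_of_int j" using avg_norm_le_of_large_vol avg_norm_eq avg_nonneg by simp
    then show False using that by (simp add: N_def)
  qed
  then have fin: "finite N" by (meson finite_nat_set_iff_bounded)
  have "0 \<in> N" using assms by (simp add: N_def anc_0)
  then have max: "Max N \<in> N" using fin by (intro Max_in) auto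
  have "avg (anc n (anc (Max N) Q)) \<le> 2 powr real_of_int j" if "n > 0" for n
  proof (rule ccontr)
    assume "\<not> ?thesis"
    then have "Max N + n \<in> N" by (simp add: N_def anc_anc)
    then show False using Max_ge[OF fin, of "Max N + n"] that by simp
  qed
  then have "anc (Max N) Q \<in> max_cubes j" using max by (auto simp: max_cubes_def N_def)
  then show ?thesis by blast
qed

text \<open>If \<open>P\<close> is maximal at the levels i and j, then 2^i < avg(P) \<le> 2^d
  avg(parent) \<le> 2^(d+j), so two such levels differ by less than d.\<close>

lemma max_cubes_multiplicity:
  "(\<integral>\<^sup>+j. (if P \<in> max_cubes j then c else 0) \<partial>count_space UNIV) \<le> ennreal (2 * real CARD('d)) * c"
proof (cases "\<exists>j. P \<in> max_cubes j")
  case True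
  then obtain j0 where j0: "P \<in> max_cubes j0" by blast
  define d where "d = int CARD('d)"
  have lt: "i < j + d" if "P \<in> max_cubes i" "P \<in> max_cubes j" for i j
  proof -
    have "2 powr real_of_int i < avg P" using that by (simp add: max_cubes_def)
    also have "\<dots> \<le> 2 ^ CARD('d) * avg (anc 1 P)" by (rule avg_parent)
    also have "\<dots> \<le> 2 ^ CARD('d) * 2 powr real_of_int j" using that by (intro mult_left_mono) (auto simp: max_cubes_def)
    also have "\<dots> = 2 powr real_of_int (j + d)" by (simp add: powr_add d_def powr_realpow)
    finally show ?thesis by simp
  qed
  have "(\<integral>\<^sup>+j. (if P \<in> max_cubes j then c else 0) \<partial>count_space UNIV) \<le> (\<integral>\<^sup>+j. c * indicator {j0 - d<..<j0 + d} j \<partial>count_space UNIV)"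
    using lt[OF j0] lt[OF _ j0] by (intro nn_integral_mono) (fastforce split: split_indicator)
  also have "\<dots> = c * of_nat (card {j0 - d<..<j0 + d})"
    by (simp add: nn_integral_cmult_indicator emeasure_count_space)
  also have "\<dots> \<le> c * ennreal (2 * real CARD('d))"
    by (intro mult_left_mono) (auto simp: d_def ennreal_of_nat_eq_real_of_nat intro!: ennreal_leI)
  finally show ?thesis by (simp add: mult.commute)
qed simp

text \<open>Each \<open>Q\<close> is charged to its level 2^j < avg(Q) \<le> 2^(j+1) and to an
  ancestor in \<open>max_cubes j\<close>. The upper bound remains as a condition on the right, where
  it later replaces the factor avg(Q).\<close>

lemma sum_le_sum_max_cubes:
  fixes F :: "int \<times> ('d \<Rightarrow> int) \<Rightarrow> ennreal"
  assumes "\<And>Q. avg Q = 0 \<Longrightarrow> F Q = 0"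
  shows "(\<integral>\<^sup>+Q. F Q \<partial>count_space UNIV) \<le>
    (\<integral>\<^sup>+j. \<integral>\<^sup>+P. (if P \<in> max_cubes j then
       \<integral>\<^sup>+n. \<integral>\<^sup>+Q. (if anc n Q = P \<and> avg Q \<le> 2 powr (real_of_int j + 1) then F Q else 0)
         \<partial>count_space UNIV \<partial>count_space UNIV else 0) \<partial>count_space UNIV \<partial>count_space UNIV)"
proof -
  define G where "G j P n Q = (if P \<in> max_cubes j \<and> anc n Q = P \<and> avg Q \<le> 2 powr (real_of_int j + 1) then F Q else 0)" for j P n Q
  have point: "F Q \<le> (\<integral>\<^sup>+j. \<integral>\<^sup>+P. \<integral>\<^sup>+n. G j P n Q \<partial>count_space UNIV \<partial>count_space UNIV \<partial>count_space UNIV)" for Q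
  proof (cases "avg Q = 0")
    case False
    then have pos: "avg Q > 0" using avg_nonneg[of Q] by simp
    \<comment> \<open>The ceiling minus 1, not the floor: the lower inequality has to be strict, as
      in \<open>max_cubes\<close>.\<close>
    define j where "j = \<lceil>log 2 (avg Q)\<rceil> - 1"
    have j: "real_of_int j < log 2 (avg Q)" "log 2 (avg Q) \<le> real_of_int j + 1" unfolding j_def by linarith+
    have j1: "2 powr real_of_int j < avg Q" using j(1) pos by (simp add: less_log_iff)
    have j2: "avg Q \<le> 2 powr (real_of_int j + 1)" using j(2) pos by (simp add: log_le_iff)
    obtain n where n: "anc n Q \<in> max_cubes j" using exists_max_cube[OF j1] by blast
    have "F Q = G j (anc n Q) n Q" using n j2 by (simp add: G_def)
    also have "\<dots> \<le> (\<integral>\<^sup>+n'. G j (anc n Q) n' Q \<partial>count_space UNIV)" by (rule nn_integral_ge_point) simp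
    also have "\<dots> \<le> (\<integral>\<^sup>+P. \<integral>\<^sup>+n. G j P n Q \<partial>count_space UNIV \<partial>count_space UNIV)" by (rule nn_integral_ge_point) simp
    also have "\<dots> \<le> (\<integral>\<^sup>+j. \<integral>\<^sup>+P. \<integral>\<^sup>+n. G j P n Q \<partial>count_space UNIV \<partial>count_space UNIV \<partial>count_space UNIV)"
      by (rule nn_integral_ge_point) simp
    finally show ?thesis .
  qed (simp add: assms)
  have "(\<integral>\<^sup>+Q. F Q \<partial>count_space UNIV) \<le>
      (\<integral>\<^sup>+Q. \<integral>\<^sup>+j. \<integral>\<^sup>+P. \<integral>\<^sup>+n. G j P n Q \<partial>count_space UNIV \<partial>count_space UNIV \<partial>count_space UNIV \<partial>count_space UNIV)"
    by (intro nn_integral_mono point)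
  also have "\<dots> = (\<integral>\<^sup>+j. \<integral>\<^sup>+Q. \<integral>\<^sup>+P. \<integral>\<^sup>+n. G j P n Q \<partial>count_space UNIV \<partial>count_space UNIV \<partial>count_space UNIV \<partial>count_space UNIV)"
    by (rule nn_integral_count_space_swap)
  also have "\<dots> = (\<integral>\<^sup>+j. \<integral>\<^sup>+P. \<integral>\<^sup>+Q. \<integral>\<^sup>+n. G j P n Q \<partial>count_space UNIV \<partial>count_space UNIV \<partial>count_space UNIV \<partial>count_space UNIV)"
    by (intro nn_integral_cong nn_integral_count_space_swap)
  also have "\<dots> = (\<integral>\<^sup>+j. \<integral>\<^sup>+P. \<integral>\<^sup>+n. \<integral>\<^sup>+Q. G j P n Q \<partial>count_space UNIV \<partial>count_space UNIV \<partial>count_space UNIV \<partial>count_space UNIV)"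
    by (intro nn_integral_cong nn_integral_count_space_swap)
  also have "\<dots> = (\<integral>\<^sup>+j. \<integral>\<^sup>+P. (if P \<in> max_cubes j then
       \<integral>\<^sup>+n. \<integral>\<^sup>+Q. (if anc n Q = P \<and> avg Q \<le> 2 powr (real_of_int j + 1) then F Q else 0)
         \<partial>count_space UNIV \<partial>count_space UNIV else 0) \<partial>count_space UNIV \<partial>count_space UNIV)"
    by (intro nn_integral_cong) (simp add: G_def)
  finally show ?thesis .
qed

subsection \<open>Summation over maximal cubes and over all cubes\<close>

text \<open>The total volume is at most X = 2 2^(-jp) times the integral of
  \<open>level_fun\<close>. Each single volume is then at most X as well, so with r = s/p \<ge> 1
  the sum of the r-th powers is at most X^(r-1) X. Jensen's inequality with the weight h^p moves the
  power r onto \<phi>, where the class condition can be applied.\<close>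

lemma sum_disjoint_level_le:
  fixes S :: "(int \<times> ('d \<Rightarrow> int)) set"
  assumes disj: "\<And>P Q x. P \<in> S \<Longrightarrow> Q \<in> S \<Longrightarrow> x \<in> dyadic P \<Longrightarrow> x \<in> dyadic Q \<Longrightarrow> P = Q"
    and big: "\<And>P. P \<in> S \<Longrightarrow> 2 powr real_of_int j < avg P"
  shows "(\<integral>\<^sup>+P. (if P \<in> S then ennreal ((2 powr real_of_int j) powr s * vol P powr (s / p)) else 0) \<partial>count_space UNIV)
    \<le> ennreal (2 powr (s / p)) * (\<integral>\<^sup>+x. ennreal (h x powr p * \<phi> (h x / 2 powr real_of_int j) powr (s / p)) \<partial>lebesgue)"
proof -
  define r where "r = s / p"
  have r: "r \<ge> 1" "p * r = s" using p ps by (auto simp: r_def)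
  have "(\<integral>\<^sup>+x. ennreal (level_fun j x) \<partial>lebesgue) < \<infinity>"
    using integral_level_fun_le[of j] by (simp add: le_less_trans)
  then obtain m where m: "(\<integral>\<^sup>+x. ennreal (level_fun j x) \<partial>lebesgue) = ennreal m" "m \<ge> 0"
    by (cases "\<integral>\<^sup>+x. ennreal (level_fun j x) \<partial>lebesgue") auto
  define c where "c = 2 * 2 powr (- real_of_int j * p)"
  define X where "X = c * m"
  have c: "c > 0" by (simp add: c_def)
  have X: "X \<ge> 0" using c m by (simp add: X_def)
  have sumvol: "(\<integral>\<^sup>+P. (if P \<in> S then ennreal (vol P) else 0) \<partial>count_space UNIV) \<le> ennreal X"
  proof -
    have "(\<integral>\<^sup>+P. (if P \<in> S then ennreal (vol P) else 0) \<partial>count_space UNIV) \<le>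
      (\<integral>\<^sup>+P. ennreal c * (if P \<in> S then \<integral>\<^sup>+x\<in>dyadic P. ennreal (level_fun j x) \<partial>lebesgue else 0) \<partial>count_space UNIV)"
      using vol_le_integral_level_fun big by (intro nn_integral_mono) (auto simp: c_def avg_less_iff)
    also have "\<dots> = ennreal c * (\<integral>\<^sup>+P. (if P \<in> S then \<integral>\<^sup>+x\<in>dyadic P. ennreal (level_fun j x) \<partial>lebesgue else 0) \<partial>count_space UNIV)"
      by (intro nn_integral_cmult) simp
    also have "\<dots> \<le> ennreal c * (\<integral>\<^sup>+x\<in>UNIV. ennreal (level_fun j x) \<partial>lebesgue)"
      by (intro mult_left_mono sum_disjoint_dyadic_le[OF _ disj] measurable_compose[OF level_fun_measurable]) auto
    also have "\<dots> = ennreal X" using c m by (simp add: X_def ennreal_mult)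
    finally show ?thesis .
  qed
  have point: "(if P \<in> S then ennreal ((2 powr real_of_int j) powr s * vol P powr r) else 0) \<le>
    ennreal ((2 powr real_of_int j) powr s * X powr (r - 1)) * (if P \<in> S then ennreal (vol P) else 0)" for P
  proof (cases "P \<in> S")
    case True
    have "ennreal (vol P) \<le> (\<integral>\<^sup>+P. (if P \<in> S then ennreal (vol P) else 0) \<partial>count_space UNIV)"
      using nn_integral_ge_point[of P UNIV "\<lambda>P. if P \<in> S then ennreal (vol P) else 0"] True by simp
    also note sumvol
    finally have "vol P \<le> X" using X by simp
    then have "vol P powr (r - 1) \<le> X powr (r - 1)" using vol_pos[of P] r by (intro powr_mono2) auto
    then have "vol P powr (r - 1) * vol P \<le> X powr (r - 1) * vol P" using vol_pos[of P] by (intro mult_right_mono) auto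
    moreover have "vol P powr r = vol P powr (r - 1) * vol P" using vol_pos[of P] by (simp add: powr_diff)
    ultimately have "(2 powr real_of_int j) powr s * vol P powr r \<le> (2 powr real_of_int j) powr s * X powr (r - 1) * vol P"
      by simp
    then have "ennreal ((2 powr real_of_int j) powr s * vol P powr r) \<le> ennreal ((2 powr real_of_int j) powr s * X powr (r - 1) * vol P)"
      by (rule ennreal_leI)
    then show ?thesis using True vol_pos[of P] by (simp add: ennreal_mult)
  qed simp
  have "(\<integral>\<^sup>+P. (if P \<in> S then ennreal ((2 powr real_of_int j) powr s * vol P powr r) else 0) \<partial>count_space UNIV) \<le>
    (\<integral>\<^sup>+P. ennreal ((2 powr real_of_int j) powr s * X powr (r - 1)) * (if P \<in> S then ennreal (vol P) else 0) \<partial>count_space UNIV)"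
    by (intro nn_integral_mono point)
  also have "\<dots> = ennreal ((2 powr real_of_int j) powr s * X powr (r - 1)) * (\<integral>\<^sup>+P. (if P \<in> S then ennreal (vol P) else 0) \<partial>count_space UNIV)"
    by (intro nn_integral_cmult) simp
  also have "\<dots> \<le> ennreal ((2 powr real_of_int j) powr s * X powr (r - 1)) * ennreal X"
    by (intro mult_left_mono sumvol) simp
  also have "\<dots> = ennreal (2 powr r * m powr r)"
  proof -
    have "X powr (r - 1) * X = X powr r" using X by (cases "X = 0") (auto simp: powr_diff)
    moreover have "(2 powr real_of_int j) powr s * X powr r = 2 powr r * m powr r"
    proof -
      have "X powr r = 2 powr r * (2 powr (- real_of_int j * p)) powr r * m powr r"
        using m by (simp add: X_def c_def powr_mult)
      moreover have "(2 powr real_of_int j) powr s * (2 powr (- real_of_int j * p)) powr r = 1"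
        using r(2) by (simp add: powr_powr powr_add[symmetric] mult.assoc)
      ultimately show ?thesis by (simp add: mult_ac)
    qed
    ultimately show ?thesis using X by (simp add: ennreal_mult[symmetric] mult.assoc)
  qed
  also have "\<dots> = ennreal (2 powr r) * ennreal (m powr r)" by (simp add: ennreal_mult)
  also have "\<dots> \<le> ennreal (2 powr r) * (\<integral>\<^sup>+x. ennreal (h x powr p * \<phi> (h x / 2 powr real_of_int j) powr r) \<partial>lebesgue)"
    by (intro mult_left_mono weighted_jensen)
       (use m h \<phi> \<phi>_measurable r in \<open>auto simp: level_fun_def\<close>)
  finally show ?thesis unfolding r_def .
qed

text \<open>The sum over \<open>j\<close> is taken inside the integral over x, where it is the sum
  of the powers of \<phi>, bounded by \<open>M\<close> whatever the value h(x); the weight h^p then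
  has integral at most 1.\<close>

lemma sum_max_cubes_le:
  "(\<integral>\<^sup>+j. \<integral>\<^sup>+P. (if P \<in> max_cubes j then ennreal ((2 powr real_of_int j) powr s * vol P powr (s / p)) else 0)
     \<partial>count_space UNIV \<partial>count_space UNIV) \<le> ennreal (2 powr (s / p) * M)"
proof -
  have "(\<integral>\<^sup>+j. \<integral>\<^sup>+P. (if P \<in> max_cubes j then ennreal ((2 powr real_of_int j) powr s * vol P powr (s / p)) else 0)
     \<partial>count_space UNIV \<partial>count_space UNIV) \<le>
    (\<integral>\<^sup>+j. ennreal (2 powr (s / p)) * (\<integral>\<^sup>+x. ennreal (h x powr p * \<phi> (h x / 2 powr real_of_int j) powr (s / p)) \<partial>lebesgue) \<partial>count_space UNIV)"
  proof (intro nn_integral_mono sum_disjoint_level_le)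
    fix j P assume "P \<in> max_cubes j"
    then show "2 powr real_of_int j < avg P" by (simp add: max_cubes_def)
  qed (rule max_cubes_disjoint)
  also have "\<dots> = ennreal (2 powr (s / p)) * (\<integral>\<^sup>+j. \<integral>\<^sup>+x. ennreal (h x powr p * \<phi> (h x / 2 powr real_of_int j) powr (s / p)) \<partial>lebesgue \<partial>count_space UNIV)"
    by (intro nn_integral_cmult) simp
  also have "(\<integral>\<^sup>+j. \<integral>\<^sup>+x. ennreal (h x powr p * \<phi> (h x / 2 powr real_of_int j) powr (s / p)) \<partial>lebesgue \<partial>count_space UNIV) =
    (\<integral>\<^sup>+x. \<integral>\<^sup>+j. ennreal (h x powr p * \<phi> (h x / 2 powr real_of_int j) powr (s / p)) \<partial>count_space UNIV \<partial>lebesgue)"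
  proof (intro nn_integral_count_space_nn_integral[symmetric] countableI_type)
    fix j
    show "(\<lambda>x. ennreal (h x powr p * \<phi> (h x / 2 powr real_of_int j) powr (s / p))) \<in> borel_measurable lebesgue"
      using h(1) \<phi>_measurable[of j] by measurable
  qed
  also have "\<dots> \<le> (\<integral>\<^sup>+x. ennreal M * ennreal (h x powr p) \<partial>lebesgue)"
  proof (intro nn_integral_mono)
    fix x
    have "(\<integral>\<^sup>+j. ennreal (h x powr p * \<phi> (h x / 2 powr real_of_int j) powr (s / p)) \<partial>count_space UNIV) =
      ennreal (h x powr p) * (\<integral>\<^sup>+j. ennreal (\<phi> (h x / 2 powr real_of_int j) powr (s / p)) \<partial>count_space UNIV)"
      by (simp add: ennreal_mult nn_integral_cmult)
    also have "\<dots> \<le> ennreal (h x powr p) * ennreal M" by (intro mult_left_mono sum_\<phi> h) simp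
    finally show "(\<integral>\<^sup>+j. ennreal (h x powr p * \<phi> (h x / 2 powr real_of_int j) powr (s / p)) \<partial>count_space UNIV) \<le> ennreal M * ennreal (h x powr p)"
      by (simp add: mult.commute)
  qed
  also have "(\<integral>\<^sup>+x. ennreal M * ennreal (h x powr p) \<partial>lebesgue) = ennreal M * (\<integral>\<^sup>+x. ennreal (h x powr p) \<partial>lebesgue)"
    using h(1) by (intro nn_integral_cmult) simp
  also have "ennreal (2 powr (s / p)) * (ennreal M * (\<integral>\<^sup>+x. ennreal (h x powr p) \<partial>lebesgue)) \<le> ennreal (2 powr (s / p)) * (ennreal M * 1)"
    by (intro mult_left_mono h) simp_all
  finally show ?thesis using M by (simp add: ennreal_mult mult_left_mono)
qed

lemma vol_descendant_powr:
  fixes Q :: "int \<times> ('d \<Rightarrow> int)"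
  assumes "anc n Q = P"
  shows "vol Q powr t = (2 powr (- (real CARD('d) * t))) ^ n * vol P powr t"
proof -
  have "vol P = 2 powr (real n * real CARD('d)) * vol Q" using assms vol_anc[of n Q] by simp
  then have "vol P powr t = 2 powr (real n * (real CARD('d) * t)) * vol Q powr t"
    using vol_pos[of Q] by (simp add: powr_mult powr_powr mult.assoc)
  moreover have "(2 powr (- (real CARD('d) * t))) ^ n = 2 powr (- (real n * (real CARD('d) * t)))"
    by (simp add: powr_realpow[symmetric] powr_powr mult_ac)
  ultimately show ?thesis by (simp add: powr_minus)
qed

lemma decay_less_one: "t > 0 \<Longrightarrow> 2 powr (- (real CARD('d) * t)) < 1"
  using powr_less_mono[of "- (real CARD('d) * t)" 0 2] by simp

text \<open>When \<open>s > p\<close> the exponent \<open>s/p > 1\<close> makes the sum over the descendants of a maximal cube geometric.\<close>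

lemma sum_all_cubes_le:
  assumes "p < s"
  shows "(\<integral>\<^sup>+Q. ennreal (vol Q powr (s / p) * avg Q powr s) \<partial>count_space UNIV) \<le>
    ennreal (2 powr s / (1 - 2 powr (- (real CARD('d) * (s / p - 1)))) * (2 powr (s / p) * M))"
proof -
  define r where "r = s / p"
  define x where "x = 2 powr (- (real CARD('d) * (r - 1)))"
  have r: "r > 1" using assms p by (simp add: r_def)
  have x: "0 \<le> x" "x < 1" using decay_less_one[of "r - 1"] r by (auto simp: x_def)
  have s0: "s > 0" using p ps by simp
  have inner: "(\<integral>\<^sup>+Q. (if anc n Q = P \<and> avg Q \<le> 2 powr (real_of_int j + 1) then ennreal (vol Q powr r * avg Q powr s) else 0) \<partial>count_space UNIV)
    \<le> ennreal (2 powr s * ((2 powr real_of_int j) powr s * vol P powr r)) * ennreal (x ^ n)" for n P j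
  proof -
    \<comment> \<open>One factor |Q| is kept for the sum over descendants; the remaining |Q|^(r-1)
      gives the geometric factor x^n, and avg(Q) is replaced by 2^(j+1).\<close>
    define c where "c = 2 powr s * (2 powr real_of_int j) powr s * x ^ n * vol P powr (r - 1)"
    have c: "c \<ge> 0" using x by (simp add: c_def)
    have "vol Q powr r * avg Q powr s \<le> c * vol Q" if "anc n Q = P" "avg Q \<le> 2 powr (real_of_int j + 1)" for Q
    proof -
      have "vol Q powr r = vol Q powr (r - 1) * vol Q" using vol_pos[of Q] by (simp add: powr_diff)
      also have "vol Q powr (r - 1) = x ^ n * vol P powr (r - 1)" unfolding x_def by (rule vol_descendant_powr[OF that(1)])
      finally have v: "vol Q powr r = x ^ n * vol P powr (r - 1) * vol Q" .
      have "avg Q powr s \<le> (2 powr (real_of_int j + 1)) powr s" using that s0 avg_nonneg by (intro powr_mono2) auto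
      also have "\<dots> = 2 powr s * (2 powr real_of_int j) powr s" by (simp add: powr_powr powr_add[symmetric] algebra_simps)
      finally have "vol Q powr r * avg Q powr s \<le> vol Q powr r * (2 powr s * (2 powr real_of_int j) powr s)"
        by (intro mult_left_mono) auto
      then show ?thesis by (simp add: v c_def mult_ac)
    qed
    then have "(\<integral>\<^sup>+Q. (if anc n Q = P \<and> avg Q \<le> 2 powr (real_of_int j + 1) then ennreal (vol Q powr r * avg Q powr s) else 0) \<partial>count_space UNIV)
      \<le> (\<integral>\<^sup>+Q. ennreal c * (if anc n Q = P then ennreal (vol Q) else 0) \<partial>count_space UNIV)"
    proof (intro nn_integral_mono)
      fix Q assume le: "\<And>Q. anc n Q = P \<Longrightarrow> avg Q \<le> 2 powr (real_of_int j + 1) \<Longrightarrow> vol Q powr r * avg Q powr s \<le> c * vol Q"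
      have "ennreal (vol Q powr r * avg Q powr s) \<le> ennreal c * ennreal (vol Q)" if "anc n Q = P" "avg Q \<le> 2 powr (real_of_int j + 1)"
        using ennreal_leI[OF le[OF that]] c vol_pos[of Q] by (simp add: ennreal_mult)
      then show "(if anc n Q = P \<and> avg Q \<le> 2 powr (real_of_int j + 1) then ennreal (vol Q powr r * avg Q powr s) else 0) \<le>
          ennreal c * (if anc n Q = P then ennreal (vol Q) else 0)" by simp
    qed
    also have "\<dots> = ennreal c * (\<integral>\<^sup>+Q. (if anc n Q = P then ennreal (vol Q) else 0) \<partial>count_space UNIV)"
      by (intro nn_integral_cmult) simp
    also have "\<dots> \<le> ennreal c * ennreal (vol P)" by (intro mult_left_mono sum_vol_descendants_le) simp
    also have "\<dots> = ennreal (2 powr s * ((2 powr real_of_int j) powr s * vol P powr r)) * ennreal (x ^ n)"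
    proof -
      have "vol P powr r = vol P powr (r - 1) * vol P" using vol_pos[of P] by (simp add: powr_diff)
      then show ?thesis using c x vol_pos[of P] by (simp add: ennreal_mult[symmetric] c_def mult_ac)
    qed
    finally show ?thesis .
  qed
  have "(\<integral>\<^sup>+Q. ennreal (vol Q powr r * avg Q powr s) \<partial>count_space UNIV) \<le>
    (\<integral>\<^sup>+j. \<integral>\<^sup>+P. (if P \<in> max_cubes j then
       \<integral>\<^sup>+n. \<integral>\<^sup>+Q. (if anc n Q = P \<and> avg Q \<le> 2 powr (real_of_int j + 1) then ennreal (vol Q powr r * avg Q powr s) else 0)
         \<partial>count_space UNIV \<partial>count_space UNIV else 0) \<partial>count_space UNIV \<partial>count_space UNIV)"
    by (rule sum_le_sum_max_cubes) (use s0 in auto)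
  also have "\<dots> \<le> (\<integral>\<^sup>+j. \<integral>\<^sup>+P. ennreal (2 powr s / (1 - x)) * (if P \<in> max_cubes j then ennreal ((2 powr real_of_int j) powr s * vol P powr r) else 0)
      \<partial>count_space UNIV \<partial>count_space UNIV)"
  proof (intro nn_integral_mono)
    fix j P
    have "(\<integral>\<^sup>+n. \<integral>\<^sup>+Q. (if anc n Q = P \<and> avg Q \<le> 2 powr (real_of_int j + 1) then ennreal (vol Q powr r * avg Q powr s) else 0)
         \<partial>count_space UNIV \<partial>count_space UNIV) \<le>
      (\<integral>\<^sup>+n. ennreal (2 powr s * ((2 powr real_of_int j) powr s * vol P powr r)) * ennreal (x ^ n) \<partial>count_space UNIV)"
      by (intro nn_integral_mono inner)
    also have "\<dots> = ennreal (2 powr s * ((2 powr real_of_int j) powr s * vol P powr r)) * ennreal (1 / (1 - x))"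
      by (simp add: nn_integral_cmult nn_integral_count_space_geometric[OF x])
    also have "\<dots> = ennreal (2 powr s / (1 - x)) * ennreal ((2 powr real_of_int j) powr s * vol P powr r)"
      using x by (simp add: ennreal_mult[symmetric] mult_ac)
    finally show "(if P \<in> max_cubes j then \<integral>\<^sup>+n. \<integral>\<^sup>+Q. (if anc n Q = P \<and> avg Q \<le> 2 powr (real_of_int j + 1) then ennreal (vol Q powr r * avg Q powr s) else 0)
         \<partial>count_space UNIV \<partial>count_space UNIV else 0) \<le>
      ennreal (2 powr s / (1 - x)) * (if P \<in> max_cubes j then ennreal ((2 powr real_of_int j) powr s * vol P powr r) else 0)" by simp
  qed
  also have "\<dots> = ennreal (2 powr s / (1 - x)) * (\<integral>\<^sup>+j. \<integral>\<^sup>+P. (if P \<in> max_cubes j then ennreal ((2 powr real_of_int j) powr s * vol P powr r) else 0)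
      \<partial>count_space UNIV \<partial>count_space UNIV)"
    by (simp add: nn_integral_cmult)
  also have "\<dots> \<le> ennreal (2 powr s / (1 - x)) * ennreal (2 powr r * M)"
    unfolding r_def by (intro mult_left_mono sum_max_cubes_le) simp
  also have "\<dots> = ennreal (2 powr s / (1 - x) * (2 powr r * M))"
    using x M by (intro ennreal_mult[symmetric]) auto
  finally show ?thesis by (simp add: r_def x_def)
qed

end

subsection \<open>A bilinear estimate\<close>

text \<open>Only the second factor needs the strict inequality \<open>p\<^sub>2 < s\<^sub>2\<close>; the first one is summed over
  its maximal cubes.\<close>

lemma dyadic_bilinear_estimate:
  fixes h g :: "real^'d \<Rightarrow> real" and e :: "'d \<Rightarrow> int"
  assumes 1: "dyadic_averages A \<phi> M p\<^sub>1 s\<^sub>1 h" and 2: "dyadic_averages B \<psi> N p\<^sub>2 s\<^sub>2 g"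
    and s: "1 / s\<^sub>1 + 1 / s\<^sub>2 = 1" and less: "p\<^sub>2 < s\<^sub>2" and e: "e \<in> neighbours"
  defines "\<epsilon> \<equiv> 1 / p\<^sub>1 + 1 / p\<^sub>2 - 1"
  shows "(\<integral>\<^sup>+Q. ennreal (vol Q powr (1 + \<epsilon>) * dyadic_averages.avg A h Q * dyadic_averages.avg B g (shift e Q)) \<partial>count_space UNIV)
    \<le> ennreal (4 / (1 - 2 powr (- (real CARD('d) * \<epsilon>))) * (real (card (neighbours :: ('d \<Rightarrow> int) set)) *
        (2 powr (s\<^sub>1 / p\<^sub>1) * M + 2 * real CARD('d) * (2 powr s\<^sub>2 / (1 - 2 powr (- (real CARD('d) * (s\<^sub>2 / p\<^sub>2 - 1)))) * (2 powr (s\<^sub>2 / p\<^sub>2) * N)))))"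
proof -
  interpret H: dyadic_averages A \<phi> M p\<^sub>1 s\<^sub>1 h by (rule 1)
  interpret K: dyadic_averages B \<psi> N p\<^sub>2 s\<^sub>2 g by (rule 2)
  define a where "a = H.avg"
  define b where "b = K.avg"
  have a0: "a Q \<ge> 0" and b0: "b Q \<ge> 0" for Q by (simp_all add: a_def b_def H.avg_nonneg K.avg_nonneg)
  define x where "x = 2 powr (- (real CARD('d) * \<epsilon>))"
  define C1 where "C1 = 2 powr (s\<^sub>1 / p\<^sub>1) * M"
  define C2 where "C2 = 2 powr s\<^sub>2 / (1 - 2 powr (- (real CARD('d) * (s\<^sub>2 / p\<^sub>2 - 1)))) * (2 powr (s\<^sub>2 / p\<^sub>2) * N)"
  have p: "1 < p\<^sub>1" "p\<^sub>1 \<le> s\<^sub>1" "1 < p\<^sub>2" using H.p H.ps K.p by auto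
  have "1 / s\<^sub>1 \<le> 1 / p\<^sub>1" "1 / s\<^sub>2 < 1 / p\<^sub>2" using p less by (auto intro!: divide_left_mono divide_strict_left_mono)
  \<comment> \<open>\<epsilon> is the sum of \<open>1 / p\<^sub>1 - 1 / s\<^sub>1\<close>, which is
    nonnegative, and \<open>1 / p\<^sub>2 - 1 / s\<^sub>2\<close>, which is positive. It is the rate
    of the geometric decay over generations below a maximal cube.\<close>
  then have \<epsilon>: "\<epsilon> > 0" using s by (simp add: \<epsilon>_def)
  have x: "0 \<le> x" "x < 1" using H.decay_less_one[OF \<epsilon>] by (auto simp: x_def)
  have C1: "C1 \<ge> 0" using H.M by (simp add: C1_def)
  have C2: "C2 \<ge> 0"
    using K.M K.decay_less_one[of "s\<^sub>2 / p\<^sub>2 - 1"] less p by (auto simp: C2_def intro!: mult_nonneg_nonneg divide_nonneg_nonneg)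
  define F where "F Q = ennreal (vol Q powr (1 + \<epsilon>) * a Q * b (shift e Q))" for Q :: "int \<times> ('d \<Rightarrow> int)"
  define nb where "nb P = (\<Sum>e'\<in>neighbours. ennreal (b (shift e' P)))" for P :: "int \<times> ('d \<Rightarrow> int)"
  \<comment> \<open>For a descendant \<open>Q\<close> of \<open>P\<close> the shifted cube is a
    descendant of some neighbour of \<open>P\<close>. After reindexing by the shift, the additive
    bound for averages of \<open>g\<close> applies at each neighbour.\<close>
  have desc: "(\<integral>\<^sup>+Q. (if anc n Q = P then ennreal (vol Q * b (shift e Q)) else 0) \<partial>count_space UNIV) \<le> ennreal (2 * vol P) * nb P" for n P
  proof -
    have "(if anc n Q = P then ennreal (vol Q * b (shift e Q)) else 0) \<le>
      (\<Sum>e'\<in>neighbours. if anc n (shift e Q) = shift e' P then ennreal (vol (shift e Q) * b (shift e Q)) else 0)" for Q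
    proof (cases "anc n Q = P")
      case True
      then obtain e' where e': "e' \<in> neighbours" "anc n (shift e Q) = shift e' P" using anc_shift[OF e, of n Q] by auto
      then show ?thesis
        using True member_le_sum[OF e'(1) _ finite_neighbours, of "\<lambda>e'. if anc n (shift e Q) = shift e' P then ennreal (vol (shift e Q) * b (shift e Q)) else 0"]
        by (simp add: vol_shift)
    qed simp
    then have "(\<integral>\<^sup>+Q. (if anc n Q = P then ennreal (vol Q * b (shift e Q)) else 0) \<partial>count_space UNIV) \<le>
      (\<integral>\<^sup>+Q. (\<Sum>e'\<in>neighbours. if anc n (shift e Q) = shift e' P then ennreal (vol (shift e Q) * b (shift e Q)) else 0) \<partial>count_space UNIV)"
      by (intro nn_integral_mono)
    also have "\<dots> = (\<Sum>e'\<in>neighbours. \<integral>\<^sup>+Q. (if anc n (shift e Q) = shift e' P then ennreal (vol (shift e Q) * b (shift e Q)) else 0) \<partial>count_space UNIV)"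
      by (intro nn_integral_sum) simp
    also have "\<dots> = (\<Sum>e'\<in>neighbours. \<integral>\<^sup>+Q. (if anc n Q = shift e' P then ennreal (vol Q * b Q) else 0) \<partial>count_space UNIV)"
      by (intro sum.cong refl nn_integral_shift)
    also have "\<dots> \<le> (\<Sum>e'\<in>neighbours. ennreal (2 * vol (shift e' P) * b (shift e' P)))"
      unfolding b_def by (intro sum_mono K.sum_descendants_avg_le)
    also have "\<dots> = ennreal (2 * vol P) * nb P"
      unfolding nb_def sum_distrib_left
      by (intro sum.cong refl) (use vol_pos[of P] b0 in \<open>simp add: vol_shift ennreal_mult\<close>)
    finally show ?thesis .
  qed
  have inner: "(\<integral>\<^sup>+Q. (if anc n Q = P \<and> a Q \<le> 2 powr (real_of_int j + 1) then F Q else 0) \<partial>count_space UNIV)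
    \<le> ennreal (x ^ n) * (ennreal (4 * 2 powr real_of_int j * vol P powr (1 + \<epsilon>)) * nb P)" for n P j
  proof -
    define c where "c = x ^ n * vol P powr \<epsilon> * (2 * 2 powr real_of_int j)"
    have c: "c \<ge> 0" using x by (simp add: c_def)
    have "F Q \<le> ennreal c * ennreal (vol Q * b (shift e Q))" if "anc n Q = P" "a Q \<le> 2 powr (real_of_int j + 1)" for Q
    proof -
      have "vol Q powr (1 + \<epsilon>) = vol Q powr \<epsilon> * vol Q" using vol_pos[of Q] by (simp add: powr_add)
      also have "vol Q powr \<epsilon> = x ^ n * vol P powr \<epsilon>" unfolding x_def by (rule H.vol_descendant_powr[OF that(1)])
      finally have v: "vol Q powr (1 + \<epsilon>) = x ^ n * vol P powr \<epsilon> * vol Q" .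
      have "a Q \<le> 2 * 2 powr real_of_int j" using that by (simp add: powr_add)
      then have "(x ^ n * vol P powr \<epsilon> * (vol Q * b (shift e Q))) * a Q \<le> (x ^ n * vol P powr \<epsilon> * (vol Q * b (shift e Q))) * (2 * 2 powr real_of_int j)"
        using x vol_pos[of Q] b0 by (intro mult_left_mono) auto
      then have "vol Q powr (1 + \<epsilon>) * a Q * b (shift e Q) \<le> c * (vol Q * b (shift e Q))" by (simp add: v c_def mult_ac)
      then show ?thesis using c vol_pos[of Q] b0 by (simp add: F_def ennreal_mult[symmetric] ennreal_leI)
    qed
    then have "(\<integral>\<^sup>+Q. (if anc n Q = P \<and> a Q \<le> 2 powr (real_of_int j + 1) then F Q else 0) \<partial>count_space UNIV)
      \<le> (\<integral>\<^sup>+Q. ennreal c * (if anc n Q = P then ennreal (vol Q * b (shift e Q)) else 0) \<partial>count_space UNIV)"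
      by (intro nn_integral_mono) simp
    also have "\<dots> = ennreal c * (\<integral>\<^sup>+Q. (if anc n Q = P then ennreal (vol Q * b (shift e Q)) else 0) \<partial>count_space UNIV)"
      by (intro nn_integral_cmult) simp
    also have "\<dots> \<le> ennreal c * (ennreal (2 * vol P) * nb P)" by (intro mult_left_mono desc) simp
    also have "\<dots> = (ennreal c * ennreal (2 * vol P)) * nb P" by (simp only: mult.assoc)
    also have "ennreal c * ennreal (2 * vol P) = ennreal (x ^ n) * ennreal (4 * 2 powr real_of_int j * vol P powr (1 + \<epsilon>))"
      using c x vol_pos[of P] by (simp add: ennreal_mult[symmetric] c_def powr_add mult_ac)
    finally show ?thesis by (simp only: mult.assoc)
  qed
  \<comment> \<open>The power 1 + \<epsilon> equals \<open>1 / p\<^sub>1 + 1 / p\<^sub>2\<close>, so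
    |P|^(1+\<epsilon>) splits between the two factors. Young's inequality with the conjugate
    exponents \<open>s\<^sub>1\<close> and \<open>s\<^sub>2\<close> then yields the summand of the
    sum over maximal cubes of \<open>h\<close> and the summand of the sum over all cubes of
    \<open>g\<close>.\<close>
  have split: "ennreal (4 * 2 powr real_of_int j * vol P powr (1 + \<epsilon>)) * nb P \<le>
    ennreal 4 * (\<Sum>e'\<in>neighbours. ennreal ((2 powr real_of_int j) powr s\<^sub>1 * vol P powr (s\<^sub>1 / p\<^sub>1)) + ennreal (vol (shift e' P) powr (s\<^sub>2 / p\<^sub>2) * b (shift e' P) powr s\<^sub>2))" for j P
  proof -
    have "ennreal (4 * 2 powr real_of_int j * vol P powr (1 + \<epsilon>)) * ennreal (b (shift e' P)) \<le>
      ennreal 4 * (ennreal ((2 powr real_of_int j) powr s\<^sub>1 * vol P powr (s\<^sub>1 / p\<^sub>1)) + ennreal (vol (shift e' P) powr (s\<^sub>2 / p\<^sub>2) * b (shift e' P) powr s\<^sub>2))" for e'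
    proof -
      have "(2 powr real_of_int j * vol P powr (1 / p\<^sub>1)) * (vol P powr (1 / p\<^sub>2) * b (shift e' P)) \<le>
        (2 powr real_of_int j * vol P powr (1 / p\<^sub>1)) powr s\<^sub>1 + (vol P powr (1 / p\<^sub>2) * b (shift e' P)) powr s\<^sub>2"
        using p less s b0 by (intro powr_sum_ineq) auto
      also have "(2 powr real_of_int j * vol P powr (1 / p\<^sub>1)) powr s\<^sub>1 = (2 powr real_of_int j) powr s\<^sub>1 * vol P powr (s\<^sub>1 / p\<^sub>1)"
        by (simp add: powr_mult powr_powr)
      also have "(vol P powr (1 / p\<^sub>2) * b (shift e' P)) powr s\<^sub>2 = vol P powr (s\<^sub>2 / p\<^sub>2) * b (shift e' P) powr s\<^sub>2"
        using b0 by (simp add: powr_mult powr_powr)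
      also have "(2 powr real_of_int j * vol P powr (1 / p\<^sub>1)) * (vol P powr (1 / p\<^sub>2) * b (shift e' P)) =
        2 powr real_of_int j * vol P powr (1 + \<epsilon>) * b (shift e' P)"
        by (simp add: \<epsilon>_def powr_add mult_ac)
      finally have "4 * 2 powr real_of_int j * vol P powr (1 + \<epsilon>) * b (shift e' P) \<le>
        4 * ((2 powr real_of_int j) powr s\<^sub>1 * vol P powr (s\<^sub>1 / p\<^sub>1) + vol P powr (s\<^sub>2 / p\<^sub>2) * b (shift e' P) powr s\<^sub>2)" by simp
      then have "ennreal (4 * 2 powr real_of_int j * vol P powr (1 + \<epsilon>) * b (shift e' P)) \<le>
        ennreal (4 * ((2 powr real_of_int j) powr s\<^sub>1 * vol P powr (s\<^sub>1 / p\<^sub>1) + vol P powr (s\<^sub>2 / p\<^sub>2) * b (shift e' P) powr s\<^sub>2))"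
        by (rule ennreal_leI)
      then show ?thesis using b0 by (simp add: ennreal_mult vol_shift)
    qed
    then show ?thesis unfolding nb_def sum_distrib_left by (intro sum_mono)
  qed
  have "(\<integral>\<^sup>+Q. F Q \<partial>count_space UNIV) \<le>
    (\<integral>\<^sup>+j. \<integral>\<^sup>+P. (if P \<in> H.max_cubes j then
       \<integral>\<^sup>+n. \<integral>\<^sup>+Q. (if anc n Q = P \<and> a Q \<le> 2 powr (real_of_int j + 1) then F Q else 0)
         \<partial>count_space UNIV \<partial>count_space UNIV else 0) \<partial>count_space UNIV \<partial>count_space UNIV)"
    unfolding a_def by (rule H.sum_le_sum_max_cubes) (simp add: F_def a_def)
  also have "\<dots> \<le> (\<integral>\<^sup>+j. \<integral>\<^sup>+P. ennreal (1 / (1 - x)) * (if P \<in> H.max_cubes j then ennreal 4 * (\<Sum>e'\<in>neighbours. ennreal ((2 powr real_of_int j) powr s\<^sub>1 * vol P powr (s\<^sub>1 / p\<^sub>1)) + ennreal (vol (shift e' P) powr (s\<^sub>2 / p\<^sub>2) * b (shift e' P) powr s\<^sub>2)) else 0)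
      \<partial>count_space UNIV \<partial>count_space UNIV)"
  proof (intro nn_integral_mono)
    fix j P
    have "(\<integral>\<^sup>+n. \<integral>\<^sup>+Q. (if anc n Q = P \<and> a Q \<le> 2 powr (real_of_int j + 1) then F Q else 0) \<partial>count_space UNIV \<partial>count_space UNIV) \<le>
      (\<integral>\<^sup>+n. ennreal (x ^ n) * (ennreal (4 * 2 powr real_of_int j * vol P powr (1 + \<epsilon>)) * nb P) \<partial>count_space UNIV)"
      by (intro nn_integral_mono inner)
    also have "\<dots> = ennreal (1 / (1 - x)) * (ennreal (4 * 2 powr real_of_int j * vol P powr (1 + \<epsilon>)) * nb P)"
      by (subst nn_integral_multc) (simp_all add: nn_integral_count_space_geometric[OF x])
    also have "\<dots> \<le> ennreal (1 / (1 - x)) * (ennreal 4 * (\<Sum>e'\<in>neighbours. ennreal ((2 powr real_of_int j) powr s\<^sub>1 * vol P powr (s\<^sub>1 / p\<^sub>1)) + ennreal (vol (shift e' P) powr (s\<^sub>2 / p\<^sub>2) * b (shift e' P) powr s\<^sub>2)))"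
      by (intro mult_left_mono split) simp
    finally show "(if P \<in> H.max_cubes j then
       \<integral>\<^sup>+n. \<integral>\<^sup>+Q. (if anc n Q = P \<and> a Q \<le> 2 powr (real_of_int j + 1) then F Q else 0) \<partial>count_space UNIV \<partial>count_space UNIV else 0) \<le>
      ennreal (1 / (1 - x)) * (if P \<in> H.max_cubes j then ennreal 4 * (\<Sum>e'\<in>neighbours. ennreal ((2 powr real_of_int j) powr s\<^sub>1 * vol P powr (s\<^sub>1 / p\<^sub>1)) + ennreal (vol (shift e' P) powr (s\<^sub>2 / p\<^sub>2) * b (shift e' P) powr s\<^sub>2)) else 0)"
      by simp
  qed
  also have "\<dots> = (\<integral>\<^sup>+j. \<integral>\<^sup>+P. ennreal (4 / (1 - x)) * (\<Sum>e'\<in>neighbours.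
        (if P \<in> H.max_cubes j then ennreal ((2 powr real_of_int j) powr s\<^sub>1 * vol P powr (s\<^sub>1 / p\<^sub>1)) else 0) +
        (if P \<in> H.max_cubes j then ennreal (vol (shift e' P) powr (s\<^sub>2 / p\<^sub>2) * b (shift e' P) powr s\<^sub>2) else 0)) \<partial>count_space UNIV \<partial>count_space UNIV)"
  proof (intro nn_integral_cong)
    fix j P
    have "ennreal (4 / (1 - x)) = ennreal (1 / (1 - x)) * ennreal 4" using x by (subst ennreal_mult[symmetric]) auto
    then show "ennreal (1 / (1 - x)) * (if P \<in> H.max_cubes j then ennreal 4 * (\<Sum>e'\<in>neighbours. ennreal ((2 powr real_of_int j) powr s\<^sub>1 * vol P powr (s\<^sub>1 / p\<^sub>1)) + ennreal (vol (shift e' P) powr (s\<^sub>2 / p\<^sub>2) * b (shift e' P) powr s\<^sub>2)) else 0) =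
      ennreal (4 / (1 - x)) * (\<Sum>e'\<in>neighbours.
        (if P \<in> H.max_cubes j then ennreal ((2 powr real_of_int j) powr s\<^sub>1 * vol P powr (s\<^sub>1 / p\<^sub>1)) else 0) +
        (if P \<in> H.max_cubes j then ennreal (vol (shift e' P) powr (s\<^sub>2 / p\<^sub>2) * b (shift e' P) powr s\<^sub>2) else 0))"
      by (cases "P \<in> H.max_cubes j") (simp_all add: mult.assoc)
  qed
  also have "\<dots> = ennreal (4 / (1 - x)) * (\<Sum>e'\<in>neighbours.
        (\<integral>\<^sup>+j. \<integral>\<^sup>+P. (if P \<in> H.max_cubes j then ennreal ((2 powr real_of_int j) powr s\<^sub>1 * vol P powr (s\<^sub>1 / p\<^sub>1)) else 0) \<partial>count_space UNIV \<partial>count_space UNIV) +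
        (\<integral>\<^sup>+j. \<integral>\<^sup>+P. (if P \<in> H.max_cubes j then ennreal (vol (shift e' P) powr (s\<^sub>2 / p\<^sub>2) * b (shift e' P) powr s\<^sub>2) else 0) \<partial>count_space UNIV \<partial>count_space UNIV))"
    by (simp add: nn_integral_cmult nn_integral_sum nn_integral_add)
  also have "\<dots> \<le> ennreal (4 / (1 - x)) * (\<Sum>e'\<in>(neighbours :: ('d \<Rightarrow> int) set). ennreal C1 + ennreal (2 * real CARD('d)) * ennreal C2)"
  proof (intro mult_left_mono sum_mono add_mono)
    \<comment> \<open>The second summand does not depend on the level, so summing over
      \<open>j\<close> costs only the multiplicity 2d; what is left is a sum over all cubes,
      translated by \<open>e'\<close>.\<close>
    fix e' :: "'d \<Rightarrow> int"
    have "(\<integral>\<^sup>+j. \<integral>\<^sup>+P. (if P \<in> H.max_cubes j then ennreal (vol (shift e' P) powr (s\<^sub>2 / p\<^sub>2) * b (shift e' P) powr s\<^sub>2) else 0) \<partial>count_space UNIV \<partial>count_space UNIV) =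
      (\<integral>\<^sup>+P. \<integral>\<^sup>+j. (if P \<in> H.max_cubes j then ennreal (vol (shift e' P) powr (s\<^sub>2 / p\<^sub>2) * b (shift e' P) powr s\<^sub>2) else 0) \<partial>count_space UNIV \<partial>count_space UNIV)"
      by (rule nn_integral_count_space_swap)
    also have "\<dots> \<le> (\<integral>\<^sup>+P. ennreal (2 * real CARD('d)) * ennreal (vol (shift e' P) powr (s\<^sub>2 / p\<^sub>2) * b (shift e' P) powr s\<^sub>2) \<partial>count_space UNIV)"
      by (intro nn_integral_mono H.max_cubes_multiplicity)
    also have "\<dots> = ennreal (2 * real CARD('d)) * (\<integral>\<^sup>+P. ennreal (vol (shift e' P) powr (s\<^sub>2 / p\<^sub>2) * b (shift e' P) powr s\<^sub>2) \<partial>count_space UNIV)"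
      by (intro nn_integral_cmult) simp
    also have "(\<integral>\<^sup>+P. ennreal (vol (shift e' P) powr (s\<^sub>2 / p\<^sub>2) * b (shift e' P) powr s\<^sub>2) \<partial>count_space UNIV) =
      (\<integral>\<^sup>+P. ennreal (vol P powr (s\<^sub>2 / p\<^sub>2) * b P powr s\<^sub>2) \<partial>count_space UNIV)"
      by (rule nn_integral_shift[of "\<lambda>P. ennreal (vol P powr (s\<^sub>2 / p\<^sub>2) * b P powr s\<^sub>2)"])
    also have "\<dots> \<le> ennreal C2" unfolding b_def C2_def by (rule K.sum_all_cubes_le[OF less])
    finally show "(\<integral>\<^sup>+j. \<integral>\<^sup>+P. (if P \<in> H.max_cubes j then ennreal (vol (shift e' P) powr (s\<^sub>2 / p\<^sub>2) * b (shift e' P) powr s\<^sub>2) else 0) \<partial>count_space UNIV \<partial>count_space UNIV)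
      \<le> ennreal (2 * real CARD('d)) * ennreal C2" by (simp add: mult_left_mono)
  qed (use H.sum_max_cubes_le in \<open>simp_all add: C1_def\<close>)
  also have "\<dots> = ennreal (4 / (1 - x) * (real (card (neighbours :: ('d \<Rightarrow> int) set)) * (C1 + 2 * real CARD('d) * C2)))"
    using x C1 C2 by (simp add: ennreal_mult[symmetric] ennreal_plus[symmetric] ennreal_of_nat_eq_real_of_nat del: ennreal_plus)
  finally show ?thesis unfolding F_def a_def b_def x_def C1_def C2_def .
qed

section \<open>A dyadic majorant of the kernel\<close>

lemma borel_measurable_nn_integral_count_space:
  fixes f :: "'i::countable \<Rightarrow> 'a \<Rightarrow> ennreal"
  assumes f: "\<And>i. f i \<in> borel_measurable M"
  shows "(\<lambda>x. \<integral>\<^sup>+i. f i x \<partial>count_space UNIV) \<in> borel_measurable M"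
proof -
  have bij: "bij_betw from_nat (range (to_nat :: 'i \<Rightarrow> nat)) (UNIV :: 'i set)"
    by (rule bij_betw_byWitness[of _ to_nat]) auto
  have "(\<integral>\<^sup>+i. f i x \<partial>count_space UNIV) = (\<Sum>n. f (from_nat n) x * indicator (range (to_nat :: 'i \<Rightarrow> nat)) n)" for x
    using nn_integral_bij_count_space[OF bij, of "\<lambda>i. f i x", symmetric]
    by (simp add: nn_integral_count_space_indicator nn_integral_count_space_nat)
  then show ?thesis using f by (auto intro!: borel_measurable_suminf_order borel_measurable_times_ennreal)
qed

text \<open>From v \<le> exp v at v = z/(ac), raised to the power a. It trades the Gaussian for as
  many powers as are wanted.\<close>

lemma powr_mult_exp_bounded:
  fixes a c :: real
  assumes "a > 0" "c > 0" "z > 0"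
  shows "exp (- z / c) \<le> (a * c) powr a * z powr (- a)"
proof -
  have "z / (a * c) \<le> exp (z / (a * c))" using exp_ge_add_one_self[of "z / (a * c)"] by linarith
  then have "(z / (a * c)) powr a \<le> exp (z / (a * c)) powr a" using assms by (intro powr_mono2) auto
  also have "\<dots> = exp (z / c)" using assms by (simp add: powr_def)
  finally have "z powr a \<le> (a * c) powr a * exp (z / c)" using assms by (simp add: powr_divide divide_simps mult.commute)
  then show ?thesis using assms by (simp add: exp_minus powr_minus divide_simps mult_ac)
qed

text \<open>The scale 2^i is the power of two just above m = max(|x-y|, sqrt t). The resulting bound
  is constant in \<open>t\<close> on (0, 2^(2i)], and integrating it over that interval leaves
  2^(i(\<alpha>-d)), the size of the kernel of the negative power.\<close>

lemma gaussian_bounds_dyadic_scale: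
  fixes \<rho> :: "real^'d \<Rightarrow> real"
  assumes \<rho>: "critical_radius \<rho>" and k: "gaussian_bounds \<rho> k" and \<alpha>: "\<alpha> < real CARD('d)" and N: "N > 0"
  shows "\<exists>C>0. \<forall>x y. \<forall>t>0. \<exists>i::int. norm (x - y) \<le> 2 powr real_of_int i \<and> t \<le> 2 powr (2 * real_of_int i) \<and>
    norm (k t x y) * t powr (\<alpha> / 2 - 1) \<le>
      C * (2 powr (- 2 * real_of_int i) * 2 powr (real_of_int i * (\<alpha> - real CARD('d)))) *
        (1 + 2 powr real_of_int i / \<rho> x) powr (- N)"
proof -
  define d where "d = real CARD('d)"
  obtain c C where c: "c > 0" and C: "C > 0" and bd: "\<And>x y t. t > 0 \<Longrightarrow>
        norm (k t x y) \<le> C / t powr (d / 2) * exp (- (norm (x - y))\<^sup>2 / (c * t)) *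
          (1 + sqrt t / \<rho> x + sqrt t / \<rho> y) powr (- N)"
    using k N unfolding gaussian_bounds_def d_def by blast
  have \<rho>0: "\<rho> x > 0" for x using \<rho> by (simp add: critical_radius_def)
  \<comment> \<open>t^(-b) is the singularity left by t^(-d/2) t^(\<alpha>/2-1). The Gaussian
    supplies (t/m^2)^a with a = b + N/2: the part N/2 pays for replacing sqrt t by m in the
    \<rho>-factor, and the part b cancels t^(-b), leaving m^(-2b).\<close>
  define b where "b = 1 + d / 2 - \<alpha> / 2"
  have b: "b > 0" using \<alpha> by (simp add: b_def d_def)
  define a where "a = b + N / 2"
  have a: "a > 0" using b N by (simp add: a_def)
  define C1 where "C1 = max 1 ((a * c) powr a)"
  have C1: "C1 \<ge> 1" by (simp add: C1_def)
  define C' where "C' = C * C1 * 2 powr N * 2 powr (2 * b)"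
  have main: "\<exists>i::int. norm (x - y) \<le> 2 powr real_of_int i \<and> t \<le> 2 powr (2 * real_of_int i) \<and>
    norm (k t x y) * t powr (\<alpha> / 2 - 1) \<le>
      C' * (2 powr (- 2 * real_of_int i) * 2 powr (real_of_int i * (\<alpha> - real CARD('d)))) *
        (1 + 2 powr real_of_int i / \<rho> x) powr (- N)" if t: "t > 0" for x y t
  proof -
    define r where "r = norm (x - y)"
    define m where "m = max r (sqrt t)"
    define i where "i = \<lceil>log 2 m\<rceil>"
    define L where "L = 2 powr real_of_int i"
    have st: "sqrt t > 0" "(sqrt t)\<^sup>2 = t" using t by auto
    have r0: "r \<ge> 0" by (simp add: r_def)
    have m: "m > 0" "r \<le> m" "sqrt t \<le> m" using st by (auto simp: m_def less_max_iff_disj)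
    have "log 2 m \<le> real_of_int i" "real_of_int i < log 2 m + 1" unfolding i_def by linarith+
    then have mL: "m \<le> L" and Lm: "L \<le> 2 * m"
    proof -
      have "m = 2 powr log 2 m" using m by simp
      then show "m \<le> L" using \<open>log 2 m \<le> real_of_int i\<close> unfolding L_def by (metis one_le_numeral powr_mono)
      have "L \<le> 2 powr (log 2 m + 1)" using \<open>real_of_int i < log 2 m + 1\<close> unfolding L_def by (intro powr_mono) auto
      then show "L \<le> 2 * m" using m by (simp add: powr_add)
    qed
    have L0: "L > 0" by (simp add: L_def)
    have tm: "t \<le> m\<^sup>2" using m st by (metis less_imp_le power_mono)
    have LL: "2 powr (2 * real_of_int i) = L\<^sup>2" by (simp add: L_def power2_eq_square powr_add[symmetric])
    have "t \<le> L\<^sup>2" using tm mL m by (meson less_imp_le order_trans power_mono)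
    have gauss: "exp (- r\<^sup>2 / (c * t)) \<le> C1 * (t / m\<^sup>2) powr a"
    proof (cases "r \<le> sqrt t")
      case True
      then have "m\<^sup>2 = t" using st by (simp add: m_def)
      have "exp (- r\<^sup>2 / (c * t)) \<le> 1" using c t by simp
      also have "1 \<le> C1 * (t / m\<^sup>2) powr a" using C1 \<open>m\<^sup>2 = t\<close> t by simp
      finally show ?thesis .
    next
      case False
      then have mr: "m = r" by (simp add: m_def)
      define z where "z = r\<^sup>2 / t"
      have z: "z > 0" using m t by (simp add: z_def mr)
      have "exp (- r\<^sup>2 / (c * t)) = exp (- z / c)" by (simp add: z_def mult.commute)
      also have "\<dots> \<le> (a * c) powr a * z powr (- a)" by (rule powr_mult_exp_bounded[OF a c z])
      also have "\<dots> \<le> C1 * z powr (- a)" by (intro mult_right_mono) (auto simp: C1_def)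
      also have "z powr (- a) = (t / m\<^sup>2) powr a" using t m by (simp add: z_def mr powr_minus powr_divide)
      finally show ?thesis .
    qed
    \<comment> \<open>Since v = sqrt t / m is at most 1, 1 + sqrt t/\<rho>(x) dominates v(1 +
      m/\<rho>(x)); the price v^(-N) is (t/m^2)^(-N/2). The term with \<rho>(y) is
      discarded.\<close>
    have rho: "(1 + sqrt t / \<rho> x + sqrt t / \<rho> y) powr (- N) \<le> (t / m\<^sup>2) powr (- (N / 2)) * (2 powr N * (1 + L / \<rho> x) powr (- N))"
    proof -
      define v where "v = sqrt t / m"
      have v: "0 < v" "v \<le> 1" unfolding v_def using m(3) by (auto simp only: divide_pos_pos[OF st(1) m(1)] pos_divide_le_eq[OF m(1)])
      have v2: "v powr (- N) = (t / m\<^sup>2) powr (- (N / 2))"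
      proof -
        have "t / m\<^sup>2 = v powr 2" using st v by (simp add: v_def power_divide)
        then show ?thesis by (simp add: powr_powr)
      qed
      have vm: "v * (m / \<rho> x) = sqrt t / \<rho> x" using m by (simp add: v_def)
      have "L / \<rho> x \<le> 2 * (m / \<rho> x)" using Lm \<rho>0[of x] by (simp add: divide_right_mono)
      then have "v / 2 * (1 + L / \<rho> x) \<le> v / 2 * (2 * (1 + m / \<rho> x))" using v by (intro mult_left_mono) auto
      also have "\<dots> = v + sqrt t / \<rho> x" by (simp add: vm[symmetric] algebra_simps)
      also have "\<dots> \<le> 1 + sqrt t / \<rho> x + sqrt t / \<rho> y" 
      proof -
        have "0 \<le> sqrt t / \<rho> y" using t \<rho>0[of y] by simp
        then show ?thesis using v by linarith
      qed
      finally have "(1 + sqrt t / \<rho> x + sqrt t / \<rho> y) powr (- N) \<le> (v / 2 * (1 + L / \<rho> x)) powr (- N)"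
        using N v L0 \<rho>0[of x] by (intro powr_mono2') (auto intro!: mult_pos_pos add_pos_pos)
      also have "\<dots> = v powr (- N) * (2 powr N * (1 + L / \<rho> x) powr (- N))"
        using v L0 \<rho>0[of x] by (simp add: powr_mult powr_divide powr_minus divide_simps)
      finally show ?thesis by (simp add: v2)
    qed
    have "norm (k t x y) * t powr (\<alpha> / 2 - 1) \<le>
      (C / t powr (d / 2) * (C1 * (t / m\<^sup>2) powr a) * ((t / m\<^sup>2) powr (- (N / 2)) * (2 powr N * (1 + L / \<rho> x) powr (- N)))) * t powr (\<alpha> / 2 - 1)"
    proof (intro mult_right_mono)
      have g: "C / t powr (d / 2) * exp (- (norm (x - y))\<^sup>2 / (c * t)) \<le> C / t powr (d / 2) * (C1 * (t / m\<^sup>2) powr a)"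
        using C by (intro mult_left_mono gauss[unfolded r_def]) auto
      have "norm (k t x y) \<le> C / t powr (d / 2) * exp (- (norm (x - y))\<^sup>2 / (c * t)) * (1 + sqrt t / \<rho> x + sqrt t / \<rho> y) powr (- N)"
        by (rule bd[OF t])
      also have "\<dots> \<le> (C / t powr (d / 2) * (C1 * (t / m\<^sup>2) powr a)) * ((t / m\<^sup>2) powr (- (N / 2)) * (2 powr N * (1 + L / \<rho> x) powr (- N)))"
        using C C1 by (intro mult_mono[OF g rho] mult_nonneg_nonneg) auto
      finally show "norm (k t x y) \<le> C / t powr (d / 2) * (C1 * (t / m\<^sup>2) powr a) * ((t / m\<^sup>2) powr (- (N / 2)) * (2 powr N * (1 + L / \<rho> x) powr (- N)))" .
    qed simp
    also have "\<dots> = C * C1 * 2 powr N * (1 + L / \<rho> x) powr (- N) * ((t / m\<^sup>2) powr (a - N / 2) * (t powr (\<alpha> / 2 - 1) / t powr (d / 2)))"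
    proof -
      have "(t / m\<^sup>2) powr (a - N / 2) = (t / m\<^sup>2) powr a * (t / m\<^sup>2) powr (- (N / 2))"
        by (simp add: powr_add[symmetric])
      then show ?thesis by (simp only: divide_inverse mult_ac)
    qed
    also have "(t / m\<^sup>2) powr (a - N / 2) * (t powr (\<alpha> / 2 - 1) / t powr (d / 2)) = m powr (- 2 * b)"
    proof -
      have e1: "t powr (\<alpha> / 2 - 1) / t powr (d / 2) = t powr (- b)"
        by (simp add: powr_diff[symmetric] b_def algebra_simps)
      have "m\<^sup>2 = m powr 2" using m by simp
      then have e2: "(m\<^sup>2) powr (- b) = m powr (- 2 * b)" by (simp only: powr_powr) simp
      have "a - N / 2 = b" by (simp add: a_def)
      then have "(t / m\<^sup>2) powr (a - N / 2) = t powr b * (m\<^sup>2) powr (- b)"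
        by (simp only: powr_divide) (simp only: powr_minus divide_inverse)
      then have "(t / m\<^sup>2) powr (a - N / 2) * (t powr (\<alpha> / 2 - 1) / t powr (d / 2)) =
          (t powr b * t powr (- b)) * m powr (- 2 * b)"
        unfolding e1 e2 by (simp only: mult_ac)
      also have "t powr b * t powr (- b) = 1" using t by (simp add: powr_add[symmetric])
      finally show ?thesis by (simp only: mult_1_left)
    qed
    also have "C * C1 * 2 powr N * (1 + L / \<rho> x) powr (- N) * m powr (- 2 * b) \<le>
      C * C1 * 2 powr N * (1 + L / \<rho> x) powr (- N) * (2 powr (2 * b) * L powr (- 2 * b))"
    proof (intro mult_left_mono)
      have "m powr (- 2 * b) \<le> (L / 2) powr (- 2 * b)" using Lm L0 b by (intro powr_mono2') auto
      also have "\<dots> = 2 powr (2 * b) * L powr (- 2 * b)" using L0 by (simp add: powr_divide powr_minus divide_simps)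
      finally show "m powr (- 2 * b) \<le> 2 powr (2 * b) * L powr (- 2 * b)" .
    qed (use C C1 in auto)
    also have "L powr (- 2 * b) = 2 powr (- 2 * real_of_int i) * 2 powr (real_of_int i * (\<alpha> - real CARD('d)))"
      by (simp add: L_def powr_powr powr_add[symmetric] b_def d_def algebra_simps)
    finally have "norm (k t x y) * t powr (\<alpha> / 2 - 1) \<le>
      C' * (2 powr (- 2 * real_of_int i) * 2 powr (real_of_int i * (\<alpha> - real CARD('d)))) *
        (1 + 2 powr real_of_int i / \<rho> x) powr (- N)"
      by (simp add: C'_def L_def[symmetric] mult_ac)
    moreover have "norm (x - y) \<le> 2 powr real_of_int i" using m mL by (simp add: r_def L_def)
    ultimately show ?thesis using \<open>t \<le> L\<^sup>2\<close> LL by metis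
  qed
  moreover have "C' > 0" using C C1 by (simp add: C'_def)
  ultimately show ?thesis by blast
qed

text \<open>Put u = l/\<rho>(z). The upper bound for \<rho>(x) by \<rho>(z) has exponent \<gamma> =
  N0/(N0+1), which yields 1 + l/\<rho>(x) \<ge> (1+u)^(1-\<gamma>)/C1. As 1-\<gamma> = 1/(N0+1) is
  positive, a large power \<open>N\<close> of this produces any desired power of 1+u.\<close>

lemma critical_radius_psi_le:
  fixes \<rho> :: "real^'d \<Rightarrow> real"
  assumes \<rho>: "critical_radius \<rho>" and \<theta>: "\<theta> \<ge> 0" and D: "D \<ge> 1"
  shows "\<exists>N>0. \<exists>C>0. \<forall>x z l. l > 0 \<longrightarrow> norm (x - z) \<le> D * l \<longrightarrow>
    (1 + l / \<rho> x) powr (- N) \<le> C / psi \<rho> \<theta> z (3 * l)"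
proof -
  have \<rho>0: "\<rho> x > 0" for x using \<rho> by (simp add: critical_radius_def)
  obtain C0 N0 where C0: "C0 > 0" and N0: "N0 > 0"
    and up: "\<And>x y. \<rho> y \<le> C0 * \<rho> x * (1 + norm (x - y) / \<rho> x) powr (N0 / (N0 + 1))"
    using \<rho> unfolding critical_radius_def by blast
  define \<gamma> where "\<gamma> = N0 / (N0 + 1)"
  have \<gamma>: "0 < \<gamma>" "1 - \<gamma> = 1 / (N0 + 1)" using N0 by (auto simp: \<gamma>_def divide_simps)
  define C1 where "C1 = max 1 (C0 * D powr \<gamma>)"
  \<comment> \<open>Chosen so that (1-\<gamma>) N = \<theta> + 1. The extra 1 keeps \<open>N\<close>
    positive when \<theta> = 0 and is given away at the end.\<close>
  define N where "N = (\<theta> + 1) * (N0 + 1)"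
  have N: "N > 0" using \<theta> N0 by (simp add: N_def)
  have C1: "C1 \<ge> 1" by (simp add: C1_def)
  have "(1 + l / \<rho> x) powr (- N) \<le> (C1 powr N * 3 powr \<theta>) / psi \<rho> \<theta> z (3 * l)" if l: "l > 0" and xz: "norm (x - z) \<le> D * l" for x z l
  proof -
    define u where "u = l / \<rho> z"
    have u: "u > 0" using l \<rho>0 by (simp add: u_def)
    have "norm (z - x) / \<rho> z \<le> D * u" using xz \<rho>0[of z] by (simp add: u_def norm_minus_commute divide_right_mono)
    then have "1 + norm (z - x) / \<rho> z \<le> D * (1 + u)" using D by (simp add: distrib_left)
    then have "(1 + norm (z - x) / \<rho> z) powr \<gamma> \<le> (D * (1 + u)) powr \<gamma>"
      using \<gamma> \<rho>0[of z] by (intro powr_mono2) (auto intro!: add_nonneg_nonneg divide_nonneg_nonneg less_imp_le)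
    also have "\<dots> = D powr \<gamma> * (1 + u) powr \<gamma>" using D u by (simp add: powr_mult)
    finally have "C0 * \<rho> z * (1 + norm (z - x) / \<rho> z) powr \<gamma> \<le> C0 * \<rho> z * (D powr \<gamma> * (1 + u) powr \<gamma>)"
      using C0 \<rho>0[of z] by (intro mult_left_mono) auto
    then have "\<rho> x \<le> \<rho> z * (C0 * D powr \<gamma>) * (1 + u) powr \<gamma>" using up[of x z] by (simp add: \<gamma>_def mult_ac)
    also have "\<dots> \<le> \<rho> z * C1 * (1 + u) powr \<gamma>"
      using \<rho>0[of z] by (intro mult_right_mono mult_left_mono) (auto simp: C1_def)
    finally have "l / (\<rho> z * C1 * (1 + u) powr \<gamma>) \<le> l / \<rho> x"
      using l \<rho>0[of x] \<rho>0[of z] C1 u by (intro divide_left_mono) auto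
    then have lx: "u / (C1 * (1 + u) powr \<gamma>) \<le> l / \<rho> x" by (simp add: u_def mult.assoc)
    have ug: "(1 + u) powr \<gamma> \<ge> 1" using u \<gamma> by (intro ge_one_powr_ge_zero) auto
    have "1 + u \<le> C1 * (1 + u) powr \<gamma> + u" using ug C1 mult_mono[of 1 C1 1 "(1 + u) powr \<gamma>"] by simp
    then have "(1 + u) / (C1 * (1 + u) powr \<gamma>) \<le> 1 + u / (C1 * (1 + u) powr \<gamma>)"
      using C1 u by (simp add: divide_simps)
    then have "(1 + u) powr (1 - \<gamma>) / C1 \<le> 1 + l / \<rho> x" using lx u by (simp add: powr_diff mult.commute)
    then have "(1 + l / \<rho> x) powr (- N) \<le> ((1 + u) powr (1 - \<gamma>) / C1) powr (- N)"
      using N C1 u by (intro powr_mono2') auto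
    also have "\<dots> = C1 powr N * (1 + u) powr (- (\<theta> + 1))"
    proof -
      have "(1 - \<gamma>) * N = \<theta> + 1" using N0 by (simp add: \<gamma> N_def)
      then have "((1 + u) powr (1 - \<gamma>)) powr (- N) = (1 + u) powr (- (\<theta> + 1))" by (simp only: powr_powr mult_minus_right)
      moreover have "((1 + u) powr (1 - \<gamma>) / C1) powr (- N) = C1 powr N * ((1 + u) powr (1 - \<gamma>)) powr (- N)"
        using C1 u by (subst powr_divide) (auto simp: powr_minus[of C1] divide_inverse)
      ultimately show ?thesis by simp
    qed
    also have "\<dots> \<le> C1 powr N * (1 + u) powr (- \<theta>)" using u by (intro mult_left_mono powr_mono) auto
    \<comment> \<open>From 1 + u \<ge> (1 + 3u)/3: \<open>psi\<close> is taken on the cube of side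
      3l.\<close>
    also have "\<dots> \<le> C1 powr N * (3 powr \<theta> * (1 + 3 * u) powr (- \<theta>))"
    proof (intro mult_left_mono)
      have "(1 + u) powr (- \<theta>) \<le> ((1 + 3 * u) / 3) powr (- \<theta>)" using u \<theta> by (intro powr_mono2') auto
      also have "\<dots> = 3 powr \<theta> * (1 + 3 * u) powr (- \<theta>)" using u by (simp add: powr_divide powr_minus divide_simps)
      finally show "(1 + u) powr (- \<theta>) \<le> 3 powr \<theta> * (1 + 3 * u) powr (- \<theta>)" .
    qed simp
    finally show ?thesis by (simp add: psi_def u_def powr_minus divide_inverse mult.assoc)
  qed
  moreover have "C1 powr N * 3 powr \<theta> > 0" using C1 by simp
  ultimately show ?thesis using N by blast
qed

section \<open>Dyadic cubes, their neighbours and the threefold cubes\<close>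

definition centre :: "int \<times> ('d::finite \<Rightarrow> int) \<Rightarrow> real^'d" where
  "centre Q = (\<chi> i. (real_of_int (snd Q i) + 1 / 2) * 2 powr real_of_int (fst Q))"

text \<open>The numerator is |Q|^(\<alpha>/d-1); the denominator is the \<open>psi\<close> of the
  bump condition on the threefold cube 3Q.\<close>

definition dyadic_coeff :: "(real^'d \<Rightarrow> real) \<Rightarrow> real \<Rightarrow> real \<Rightarrow> int \<times> ('d::finite \<Rightarrow> int) \<Rightarrow> real" where
  "dyadic_coeff \<rho> \<theta> \<alpha> Q = 2 powr (real_of_int (fst Q) * (\<alpha> - real CARD('d))) /
     psi \<rho> (\<theta> / 3) (centre Q) (3 * 2 powr real_of_int (fst Q))"

lemma norm_centre_le:
  fixes x :: "real^'d"
  assumes "x \<in> dyadic Q"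
  shows "norm (x - centre Q) \<le> real CARD('d) * 2 powr real_of_int (fst Q)"
proof -
  have "\<bar>(x - centre Q) $ i\<bar> \<le> 2 powr real_of_int (fst Q)" for i
  proof -
    define L where "L = 2 powr real_of_int (fst Q)"
    have "real_of_int (snd Q i) * L \<le> x $ i" "x $ i < (real_of_int (snd Q i) + 1) * L" "L > 0"
      using assms by (auto simp: dyadic_iff L_def)
    then show ?thesis unfolding centre_def L_def[symmetric] by (simp add: algebra_simps abs_le_iff)
  qed
  then have "(\<Sum>i\<in>UNIV. \<bar>(x - centre Q) $ i\<bar>) \<le> (\<Sum>i\<in>(UNIV::'d set). 2 powr real_of_int (fst Q))" by (intro sum_mono)
  then show ?thesis using norm_le_l1_cart[of "x - centre Q"] by simp
qed

lemma dyadic_shift_subset_cube: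
  fixes Q :: "int \<times> ('d::finite \<Rightarrow> int)"
  assumes e: "e \<in> neighbours"
  shows "dyadic (shift e Q) \<subseteq> cube (centre Q) (3 * 2 powr real_of_int (fst Q))"
proof
  fix x assume x: "x \<in> dyadic (shift e Q)"
  define L where "L = 2 powr real_of_int (fst Q)"
  have L: "L > 0" by (simp add: L_def)
  have "(centre Q - vec (3 * L / 2)) $ i \<le> x $ i \<and> x $ i \<le> (centre Q + vec (3 * L / 2)) $ i" for i
  proof -
    have "real_of_int (snd Q i + e i) * L \<le> x $ i" "x $ i < (real_of_int (snd Q i + e i) + 1) * L"
      using x by (auto simp: dyadic_iff shift_def L_def)
    moreover have "e i \<in> {-1, 0, 1}" using e by (simp add: neighbours_def)
    ultimately show ?thesis using L unfolding centre_def L_def[symmetric] by (auto simp: algebra_simps)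
  qed
  then show "x \<in> cube (centre Q) (3 * 2 powr real_of_int (fst Q))"
    unfolding cube_def L_def[symmetric] mem_box_cart by blast
qed

lemma zero_in_neighbours: "(\<lambda>_. 0) \<in> neighbours"
  by (simp add: neighbours_def)

lemma shift_zero: "shift (\<lambda>_. 0) Q = Q"
  by (simp add: shift_def)

text \<open>Coordinates at distance at most one side length have cube indices that differ by at most
  1.\<close>

lemma exists_neighbour_cube:
  fixes x y :: "real^'d"
  assumes "norm (x - y) \<le> 2 powr real_of_int i" and x: "x \<in> dyadic Q" "fst Q = i"
  shows "\<exists>e\<in>neighbours. y \<in> dyadic (shift e Q)"
proof -
  define L where "L = 2 powr real_of_int i"
  have L: "L > 0" by (simp add: L_def)
  define e where "e j = \<lfloor>y $ j / L\<rfloor> - snd Q j" for j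
  have "e j \<in> {-1, 0, 1}" for j
  proof -
    have "\<bar>(x - y) $ j\<bar> \<le> L" using component_le_norm_cart[of "x - y" j] assms(1) by (simp add: L_def)
    then have "\<bar>x $ j / L - y $ j / L\<bar> \<le> 1" using L by (simp add: diff_divide_distrib[symmetric] abs_divide)
    moreover have "\<lfloor>x $ j / L\<rfloor> = snd Q j" using x by (simp add: dyadic_def L_def)
    ultimately have "\<bar>e j\<bar> \<le> 1" unfolding e_def by linarith
    then show ?thesis by auto
  qed
  moreover have "y \<in> dyadic (shift e Q)" using x by (simp add: dyadic_def shift_def e_def L_def)
  ultimately show ?thesis by (intro bexI[of _ e]) (auto simp: neighbours_def)
qed

text \<open>A single term dominates: the cube of side 2^i that contains \<open>x\<close>, with the
  neighbour that contains \<open>y\<close>. Time is kept as 2^(-2i) times the indicator of (0,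
  2^(2i)], a function of integral 1.\<close>

lemma kernel_le_dyadic_sum:
  fixes \<rho> :: "real^'d \<Rightarrow> real"
  assumes \<rho>: "critical_radius \<rho>" and k: "gaussian_bounds \<rho> k" and \<alpha>: "\<alpha> < real CARD('d)" and \<theta>: "\<theta> \<ge> 0"
  shows "\<exists>C>0. \<forall>x y. \<forall>t>0. ennreal (norm (k t x y) * t powr (\<alpha> / 2 - 1)) \<le>
    ennreal C * (\<integral>\<^sup>+Q. (\<Sum>e\<in>neighbours. indicator (dyadic Q) x * indicator (dyadic (shift e Q)) y *
      (ennreal (2 powr (- 2 * real_of_int (fst Q)) * dyadic_coeff \<rho> \<theta> \<alpha> Q) * indicator {0<..2 powr (2 * real_of_int (fst Q))} t)) \<partial>count_space UNIV)"
proof -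
  obtain N C2 where N: "N > 0" and C2: "C2 > 0" and c2: "\<And>x z l. l > 0 \<Longrightarrow> norm (x - z) \<le> real CARD('d) * l \<Longrightarrow>
    (1 + l / \<rho> x) powr (- N) \<le> C2 / psi \<rho> (\<theta> / 3) z (3 * l)"
    using critical_radius_psi_le[OF \<rho>, of "\<theta> / 3" "real CARD('d)"] \<theta> by (auto simp: Suc_le_eq)
  obtain C1 where C1: "C1 > 0" and c1: "\<And>x y t. t > 0 \<Longrightarrow> \<exists>i::int. norm (x - y) \<le> 2 powr real_of_int i \<and> t \<le> 2 powr (2 * real_of_int i) \<and>
    norm (k t x y) * t powr (\<alpha> / 2 - 1) \<le>
      C1 * (2 powr (- 2 * real_of_int i) * 2 powr (real_of_int i * (\<alpha> - real CARD('d)))) *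
        (1 + 2 powr real_of_int i / \<rho> x) powr (- N)"
    using gaussian_bounds_dyadic_scale[OF \<rho> k \<alpha> N] by blast
  have "ennreal (norm (k t x y) * t powr (\<alpha> / 2 - 1)) \<le>
    ennreal (C1 * C2) * (\<integral>\<^sup>+Q. (\<Sum>e\<in>neighbours. indicator (dyadic Q) x * indicator (dyadic (shift e Q)) y *
      (ennreal (2 powr (- 2 * real_of_int (fst Q)) * dyadic_coeff \<rho> \<theta> \<alpha> Q) * indicator {0<..2 powr (2 * real_of_int (fst Q))} t)) \<partial>count_space UNIV)"
    if t: "t > 0" for x y t
  proof -
    obtain i :: int where i: "norm (x - y) \<le> 2 powr real_of_int i" "t \<le> 2 powr (2 * real_of_int i)"
      "norm (k t x y) * t powr (\<alpha> / 2 - 1) \<le>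
      C1 * (2 powr (- 2 * real_of_int i) * 2 powr (real_of_int i * (\<alpha> - real CARD('d)))) *
        (1 + 2 powr real_of_int i / \<rho> x) powr (- N)" using c1[OF t] by blast
    define Q where "Q = (i, \<lambda>j. \<lfloor>x $ j / 2 powr real_of_int i\<rfloor>)"
    have Q: "x \<in> dyadic Q" "fst Q = i" by (auto simp: Q_def dyadic_def)
    obtain e where e: "e \<in> neighbours" "y \<in> dyadic (shift e Q)" using exists_neighbour_cube[OF i(1) Q] by blast
    define w where "w Q e = indicator (dyadic Q) x * indicator (dyadic (shift e Q)) y *
      (ennreal (2 powr (- 2 * real_of_int (fst Q)) * dyadic_coeff \<rho> \<theta> \<alpha> Q) * indicator {0<..2 powr (2 * real_of_int (fst Q))} t)"
      for Q :: "int \<times> ('d \<Rightarrow> int)" and e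
    have "(1 + 2 powr real_of_int i / \<rho> x) powr (- N) \<le> C2 / psi \<rho> (\<theta> / 3) (centre Q) (3 * 2 powr real_of_int i)"
      using norm_centre_le[OF Q(1)] Q(2) by (intro c2) auto
    then have "C1 * (2 powr (- 2 * real_of_int i) * 2 powr (real_of_int i * (\<alpha> - real CARD('d)))) *
        (1 + 2 powr real_of_int i / \<rho> x) powr (- N) \<le> C1 * (2 powr (- 2 * real_of_int i) * 2 powr (real_of_int i * (\<alpha> - real CARD('d)))) *
        (C2 / psi \<rho> (\<theta> / 3) (centre Q) (3 * 2 powr real_of_int i))"
      using C1 by (intro mult_left_mono) auto
    also have "\<dots> = (C1 * C2) * (2 powr (- 2 * real_of_int (fst Q)) * dyadic_coeff \<rho> \<theta> \<alpha> Q)"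
      by (simp add: dyadic_coeff_def Q(2))
    finally have "ennreal (norm (k t x y) * t powr (\<alpha> / 2 - 1)) \<le> ennreal ((C1 * C2) * (2 powr (- 2 * real_of_int (fst Q)) * dyadic_coeff \<rho> \<theta> \<alpha> Q))"
      using i(3) by (intro ennreal_leI) linarith
    also have "\<dots> = ennreal (C1 * C2) * w Q e"
      using e Q i(2) t C1 C2 by (simp add: w_def ennreal_mult' )
    also have "w Q e \<le> (\<Sum>e\<in>neighbours. w Q e)" using e(1) finite_neighbours by (intro member_le_sum) auto
    also have "\<dots> \<le> (\<integral>\<^sup>+Q. (\<Sum>e\<in>neighbours. w Q e) \<partial>count_space UNIV)" by (rule nn_integral_ge_point) simp
    finally show ?thesis unfolding w_def by (simp add: mult_left_mono)
  qed
  then show ?thesis using C1 C2 by (intro exI[of _ "C1 * C2"]) auto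
qed

text \<open>The pointwise majorant is a sum of products of functions of x, y and t, so the integrals
  in y and t can be computed term by term. The kernel itself enters through monotonicity of the
  integral alone.\<close>

lemma kernel_integral_le_dyadic_sum:
  fixes \<rho> :: "real^'d \<Rightarrow> real"
  assumes \<rho>: "critical_radius \<rho>" and k: "gaussian_bounds \<rho> k" and \<alpha>: "\<alpha> < real CARD('d)" and \<theta>: "\<theta> \<ge> 0"
  shows "\<exists>C>0. \<forall>x F. F \<in> borel_measurable lebesgue \<longrightarrow>
    (\<integral>\<^sup>+t\<in>{0<..}. (\<integral>\<^sup>+y. ennreal (norm (k t x y) * t powr (\<alpha> / 2 - 1)) * F y \<partial>lebesgue) \<partial>lebesgue) \<le>
    ennreal C * (\<integral>\<^sup>+Q. (\<Sum>e\<in>neighbours. indicator (dyadic Q) x *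
      (ennreal (dyadic_coeff \<rho> \<theta> \<alpha> Q) * (\<integral>\<^sup>+y\<in>dyadic (shift e Q). F y \<partial>lebesgue))) \<partial>count_space UNIV)"
proof -
  define w where "w Q t = ennreal (2 powr (- 2 * real_of_int (fst Q)) * dyadic_coeff \<rho> \<theta> \<alpha> Q) * indicator {0<..2 powr (2 * real_of_int (fst Q))} t"
    for Q :: "int \<times> ('d \<Rightarrow> int)" and t
  from kernel_le_dyadic_sum[OF assms] obtain C where C: "C > 0"
    and c0: "\<forall>x y. \<forall>t>0. ennreal (norm (k t x y) * t powr (\<alpha> / 2 - 1)) \<le>
      ennreal C * (\<integral>\<^sup>+Q. (\<Sum>e\<in>neighbours. indicator (dyadic Q) x * indicator (dyadic (shift e Q)) y *
        (ennreal (2 powr (- 2 * real_of_int (fst Q)) * dyadic_coeff \<rho> \<theta> \<alpha> Q) * indicator {0<..2 powr (2 * real_of_int (fst Q))} t)) \<partial>count_space UNIV)"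
    by (elim exE conjE) (rule that)
  have c: "ennreal (norm (k t x y) * t powr (\<alpha> / 2 - 1)) \<le>
    ennreal C * (\<integral>\<^sup>+Q. (\<Sum>e\<in>neighbours. indicator (dyadic Q) x * indicator (dyadic (shift e Q)) y * w Q t) \<partial>count_space UNIV)"
    if "t > 0" for x y t
    unfolding w_def by (rule c0[rule_format, OF that])
  have wm: "w Q \<in> borel_measurable lebesgue" for Q :: "int \<times> ('d \<Rightarrow> int)" unfolding w_def by (intro borel_measurable_times_ennreal borel_measurable_const borel_measurable_indicator) simp
  have w_int: "(\<integral>\<^sup>+t. w Q t \<partial>lebesgue) = ennreal (dyadic_coeff \<rho> \<theta> \<alpha> Q)" for Q :: "int \<times> ('d \<Rightarrow> int)"
  proof -
    have "{0<..2 powr (2 * real_of_int (fst Q))} \<in> sets lebesgue" by simp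
    moreover have "emeasure lebesgue {0<..2 powr (2 * real_of_int (fst Q))} = ennreal (2 powr (2 * real_of_int (fst Q)))"
      by simp
    ultimately have "(\<integral>\<^sup>+t. w Q t \<partial>lebesgue) = ennreal (2 powr (- 2 * real_of_int (fst Q)) * dyadic_coeff \<rho> \<theta> \<alpha> Q) * ennreal (2 powr (2 * real_of_int (fst Q)))"
      unfolding w_def by (simp only: nn_integral_cmult_indicator)
    also have "\<dots> = ennreal (2 powr (- 2 * real_of_int (fst Q)) * dyadic_coeff \<rho> \<theta> \<alpha> Q * 2 powr (2 * real_of_int (fst Q)))"
      by (rule ennreal_mult''[symmetric]) simp
    also have "2 powr (- 2 * real_of_int (fst Q)) * dyadic_coeff \<rho> \<theta> \<alpha> Q * 2 powr (2 * real_of_int (fst Q)) = dyadic_coeff \<rho> \<theta> \<alpha> Q"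
      by (simp add: powr_minus divide_simps)
    finally show ?thesis .
  qed
  have "(\<integral>\<^sup>+t\<in>{0<..}. (\<integral>\<^sup>+y. ennreal (norm (k t x y) * t powr (\<alpha> / 2 - 1)) * F y \<partial>lebesgue) \<partial>lebesgue) \<le>
    ennreal C * (\<integral>\<^sup>+Q. (\<Sum>e\<in>neighbours. indicator (dyadic Q) x *
      (ennreal (dyadic_coeff \<rho> \<theta> \<alpha> Q) * (\<integral>\<^sup>+y\<in>dyadic (shift e Q). F y \<partial>lebesgue))) \<partial>count_space UNIV)"
    if F: "F \<in> borel_measurable lebesgue" for x F
  proof -
    define I where "I Q = (\<integral>\<^sup>+y\<in>dyadic Q. F y \<partial>lebesgue)" for Q
    have Fm: "(\<lambda>y. F y * indicator (dyadic Q) y) \<in> borel_measurable lebesgue" for Q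
      using F dyadic_sets[of Q] by (intro borel_measurable_times_ennreal borel_measurable_indicator)
    have y_int: "(\<integral>\<^sup>+y. ennreal (norm (k t x y) * t powr (\<alpha> / 2 - 1)) * F y \<partial>lebesgue) \<le>
      ennreal C * (\<integral>\<^sup>+Q. (\<Sum>e\<in>neighbours. indicator (dyadic Q) x * (w Q t * I (shift e Q))) \<partial>count_space UNIV)" if t: "t > 0" for t
    proof -
      have "(\<integral>\<^sup>+y. ennreal (norm (k t x y) * t powr (\<alpha> / 2 - 1)) * F y \<partial>lebesgue) \<le>
        (\<integral>\<^sup>+y. ennreal C * (\<integral>\<^sup>+Q. (\<Sum>e\<in>neighbours. (indicator (dyadic Q) x * w Q t) * (F y * indicator (dyadic (shift e Q)) y)) \<partial>count_space UNIV) \<partial>lebesgue)"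
      proof (intro nn_integral_mono)
        fix y
        have "ennreal (norm (k t x y) * t powr (\<alpha> / 2 - 1)) * F y \<le>
          (ennreal C * (\<integral>\<^sup>+Q. (\<Sum>e\<in>neighbours. indicator (dyadic Q) x * indicator (dyadic (shift e Q)) y * w Q t) \<partial>count_space UNIV)) * F y"
          by (intro mult_right_mono c t) simp
        also have "\<dots> = ennreal C * (\<integral>\<^sup>+Q. (\<Sum>e\<in>neighbours. indicator (dyadic Q) x * indicator (dyadic (shift e Q)) y * w Q t) * F y \<partial>count_space UNIV)"
          by (subst nn_integral_multc) (simp_all add: mult.assoc)
        finally have le: "ennreal (norm (k t x y) * t powr (\<alpha> / 2 - 1)) * F y \<le> ennreal C * (\<integral>\<^sup>+Q. (\<Sum>e\<in>neighbours. indicator (dyadic Q) x * indicator (dyadic (shift e Q)) y * w Q t) * F y \<partial>count_space UNIV)" .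
        show "ennreal (norm (k t x y) * t powr (\<alpha> / 2 - 1)) * F y \<le> ennreal C * (\<integral>\<^sup>+Q. (\<Sum>e\<in>neighbours. (indicator (dyadic Q) x * w Q t) * (F y * indicator (dyadic (shift e Q)) y)) \<partial>count_space UNIV)"
        proof -
          have "(\<Sum>e\<in>neighbours. indicator (dyadic Q) x * indicator (dyadic (shift e Q)) y * w Q t) * F y =
              (\<Sum>e\<in>neighbours. (indicator (dyadic Q) x * w Q t) * (F y * indicator (dyadic (shift e Q)) y))" for Q
            by (subst sum_distrib_right) (intro sum.cong refl, simp only: mult_ac)
          then show ?thesis using le by simp
        qed
      qed
      also have "\<dots> = ennreal C * (\<integral>\<^sup>+y. (\<integral>\<^sup>+Q. (\<Sum>e\<in>neighbours. (indicator (dyadic Q) x * w Q t) * (F y * indicator (dyadic (shift e Q)) y)) \<partial>count_space UNIV) \<partial>lebesgue)"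
        by (intro nn_integral_cmult borel_measurable_nn_integral_count_space borel_measurable_sum borel_measurable_times_ennreal borel_measurable_const Fm)
      also have "(\<integral>\<^sup>+y. (\<integral>\<^sup>+Q. (\<Sum>e\<in>neighbours. (indicator (dyadic Q) x * w Q t) * (F y * indicator (dyadic (shift e Q)) y)) \<partial>count_space UNIV) \<partial>lebesgue) =
        (\<integral>\<^sup>+Q. (\<integral>\<^sup>+y. (\<Sum>e\<in>neighbours. (indicator (dyadic Q) x * w Q t) * (F y * indicator (dyadic (shift e Q)) y)) \<partial>lebesgue) \<partial>count_space UNIV)"
        by (intro nn_integral_count_space_nn_integral countableI_type borel_measurable_sum borel_measurable_times_ennreal borel_measurable_const Fm)
      also have "\<dots> = (\<integral>\<^sup>+Q. (\<Sum>e\<in>neighbours. indicator (dyadic Q) x * (w Q t * I (shift e Q))) \<partial>count_space UNIV)"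
      proof (intro nn_integral_cong)
        fix Q
        have "(\<integral>\<^sup>+y. (\<Sum>e\<in>neighbours. (indicator (dyadic Q) x * w Q t) * (F y * indicator (dyadic (shift e Q)) y)) \<partial>lebesgue) =
            (\<Sum>e\<in>neighbours. \<integral>\<^sup>+y. (indicator (dyadic Q) x * w Q t) * (F y * indicator (dyadic (shift e Q)) y) \<partial>lebesgue)"
          by (intro nn_integral_sum borel_measurable_sum borel_measurable_times_ennreal borel_measurable_const Fm)
        also have "\<dots> = (\<Sum>e\<in>neighbours. (indicator (dyadic Q) x * w Q t) * I (shift e Q))"
          unfolding I_def by (intro sum.cong refl nn_integral_cmult Fm)
        finally show "(\<integral>\<^sup>+y. (\<Sum>e\<in>neighbours. (indicator (dyadic Q) x * w Q t) * (F y * indicator (dyadic (shift e Q)) y)) \<partial>lebesgue) =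
            (\<Sum>e\<in>neighbours. indicator (dyadic Q) x * (w Q t * I (shift e Q)))" by (simp only: mult.assoc)
      qed
      finally show ?thesis .
    qed
    have "(\<integral>\<^sup>+t\<in>{0<..}. (\<integral>\<^sup>+y. ennreal (norm (k t x y) * t powr (\<alpha> / 2 - 1)) * F y \<partial>lebesgue) \<partial>lebesgue) \<le>
      (\<integral>\<^sup>+t. ennreal C * (\<integral>\<^sup>+Q. (\<Sum>e\<in>neighbours. indicator (dyadic Q) x * I (shift e Q) * w Q t) \<partial>count_space UNIV) \<partial>lebesgue)"
    proof (intro nn_integral_mono)
      fix t :: real
      have "indicator (dyadic Q) x * (w Q t * I (shift e Q)) = indicator (dyadic Q) x * I (shift e Q) * w Q t" for Q e
        by (simp only: mult_ac)
      then show "(\<integral>\<^sup>+y. ennreal (norm (k t x y) * t powr (\<alpha> / 2 - 1)) * F y \<partial>lebesgue) * indicator {0<..} t \<le>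
          ennreal C * (\<integral>\<^sup>+Q. (\<Sum>e\<in>neighbours. indicator (dyadic Q) x * I (shift e Q) * w Q t) \<partial>count_space UNIV)"
        using y_int[of t] by (cases "t > 0") simp_all
    qed
    also have "\<dots> = ennreal C * (\<integral>\<^sup>+t. (\<integral>\<^sup>+Q. (\<Sum>e\<in>neighbours. indicator (dyadic Q) x * I (shift e Q) * w Q t) \<partial>count_space UNIV) \<partial>lebesgue)"
      by (intro nn_integral_cmult borel_measurable_nn_integral_count_space borel_measurable_sum borel_measurable_times_ennreal borel_measurable_const wm)
    also have "(\<integral>\<^sup>+t. (\<integral>\<^sup>+Q. (\<Sum>e\<in>neighbours. indicator (dyadic Q) x * I (shift e Q) * w Q t) \<partial>count_space UNIV) \<partial>lebesgue) =
      (\<integral>\<^sup>+Q. (\<integral>\<^sup>+t. (\<Sum>e\<in>neighbours. indicator (dyadic Q) x * I (shift e Q) * w Q t) \<partial>lebesgue) \<partial>count_space UNIV)"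
      by (intro nn_integral_count_space_nn_integral countableI_type borel_measurable_sum borel_measurable_times_ennreal borel_measurable_const wm)
    also have "\<dots> = (\<integral>\<^sup>+Q. (\<Sum>e\<in>neighbours. indicator (dyadic Q) x * (ennreal (dyadic_coeff \<rho> \<theta> \<alpha> Q) * I (shift e Q))) \<partial>count_space UNIV)"
    proof (intro nn_integral_cong)
      fix Q
      have "(\<integral>\<^sup>+t. (\<Sum>e\<in>neighbours. indicator (dyadic Q) x * I (shift e Q) * w Q t) \<partial>lebesgue) =
          (\<Sum>e\<in>neighbours. \<integral>\<^sup>+t. indicator (dyadic Q) x * I (shift e Q) * w Q t \<partial>lebesgue)"
        by (intro nn_integral_sum borel_measurable_sum borel_measurable_times_ennreal borel_measurable_const wm)
      also have "\<dots> = (\<Sum>e\<in>neighbours. indicator (dyadic Q) x * I (shift e Q) * ennreal (dyadic_coeff \<rho> \<theta> \<alpha> Q))"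
        unfolding w_int[symmetric] by (intro sum.cong refl nn_integral_cmult wm)
      finally show "(\<integral>\<^sup>+t. (\<Sum>e\<in>neighbours. indicator (dyadic Q) x * I (shift e Q) * w Q t) \<partial>lebesgue) =
          (\<Sum>e\<in>neighbours. indicator (dyadic Q) x * (ennreal (dyadic_coeff \<rho> \<theta> \<alpha> Q) * I (shift e Q)))" by (simp only: mult_ac)
    qed
    finally show ?thesis by (simp add: I_def)
  qed
  then show ?thesis using C by blast
qed

section \<open>The dyadic operator\<close>

text \<open>The majorant and its constant are fixed before \<open>h\<close>, which makes the later
  constants uniform in \<open>h\<close>.\<close>

lemma dyadic_averages_B_class:
  assumes AB: "A \<in> B_class p s" and p: "1 < p" "p \<le> s"
  shows "\<exists>\<phi> M. \<forall>h :: real^'d \<Rightarrow> real. h \<in> borel_measurable lebesgue \<longrightarrow> (\<forall>x. 0 \<le> h x) \<longrightarrow>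
    (\<integral>\<^sup>+x. ennreal (h x powr p) \<partial>lebesgue) \<le> 1 \<longrightarrow> dyadic_averages A \<phi> M p s h"
proof -
  obtain \<phi> M where *: "M > 0" "\<forall>t. 0 \<le> \<phi> t \<and> \<phi> t \<le> M" "\<phi> \<in> borel_measurable borel"
    "\<forall>t\<ge>0. A t \<le> 1 / 2 + \<phi> t * t powr p"
    "\<forall>t\<ge>0. (\<integral>\<^sup>+j. ennreal (\<phi> (t / 2 powr real_of_int j) powr (s / p)) \<partial>count_space UNIV) \<le> ennreal M"
    using B_class_dyadic_majorant[OF assms] by (elim exE conjE) (rule that)
  have A: "young_function A" using AB by (simp add: B_class_def)
  show ?thesis
    by (intro exI[of _ \<phi>] exI[of _ M] allI impI, unfold_locales) (use * A p in auto)
qed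

lemma dyadic_bilinear_bounded:
  assumes "1 / s\<^sub>1 + 1 / s\<^sub>2 = 1" "p\<^sub>2 < s\<^sub>2"
  shows "\<exists>C. \<forall>(h :: real^'d \<Rightarrow> real) g e. dyadic_averages A \<phi> M p\<^sub>1 s\<^sub>1 h \<longrightarrow> dyadic_averages B \<psi> N p\<^sub>2 s\<^sub>2 g \<longrightarrow> e \<in> neighbours \<longrightarrow>
    (\<integral>\<^sup>+Q. ennreal (vol Q powr (1 + (1 / p\<^sub>1 + 1 / p\<^sub>2 - 1)) * dyadic_averages.avg A h Q * dyadic_averages.avg B g (shift e Q)) \<partial>count_space UNIV) \<le> ennreal C"
  by (rule exI, intro allI impI, rule dyadic_bilinear_estimate[OF _ _ assms])

text \<open>Conjugation turns s \<le> q into q' \<le> s'. If s < q, then q' < s' and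
  \<open>g\<close> is the factor summed over all cubes; otherwise s = q > p and \<open>h\<close> is.
  In the first case the bilinear estimate puts the shift on the other factor, which reindexing by
  the opposite shift repairs.\<close>

lemma two_weight_dyadic_sum:
  assumes A: "A \<in> B_class p s" and B: "B \<in> B_class (q / (q - 1)) (s / (s - 1))"
    and p: "1 < p" "p \<le> s" "s \<le> q" "p < q"
  shows "\<exists>C>0. \<forall>(h :: real^'d \<Rightarrow> real) g e. h \<in> borel_measurable lebesgue \<longrightarrow> (\<forall>x. 0 \<le> h x) \<longrightarrow>
      (\<integral>\<^sup>+x. ennreal (h x powr p) \<partial>lebesgue) \<le> 1 \<longrightarrow>
      g \<in> borel_measurable lebesgue \<longrightarrow> (\<forall>x. 0 \<le> g x) \<longrightarrow>
      (\<integral>\<^sup>+x. ennreal (g x powr (q / (q - 1))) \<partial>lebesgue) \<le> 1 \<longrightarrow> e \<in> neighbours \<longrightarrow>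
      (\<forall>Q. orlicz_norm A (dyadic Q) (\<lambda>x. ennreal (h x)) < \<infinity> \<and> orlicz_norm B (dyadic Q) (\<lambda>x. ennreal (g x)) < \<infinity>) \<and>
      (\<integral>\<^sup>+Q. ennreal (vol Q powr (1 + (1 / p - 1 / q))) * (orlicz_norm A (dyadic (shift e Q)) (\<lambda>x. ennreal (h x)) *
         orlicz_norm B (dyadic Q) (\<lambda>x. ennreal (g x))) \<partial>count_space UNIV) \<le> ennreal C"
proof -
  define q' s' where "q' = q / (q - 1)" and "s' = s / (s - 1)"
  have s1: "1 < s" and q1: "1 < q" using p by auto
  have q': "1 < q'" "q' \<le> s'" using p s1 q1 by (auto simp: q'_def s'_def divide_simps algebra_simps)
  have conj_s: "1 / s + 1 / s' = 1" "1 / s' + 1 / s = 1" and conj_q: "1 / q' = 1 - 1 / q"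
    using s1 q1 by (auto simp: q'_def s'_def divide_simps)
  obtain \<phi> M where H: "\<And>h :: real^'d \<Rightarrow> real. h \<in> borel_measurable lebesgue \<Longrightarrow> (\<forall>x. 0 \<le> h x) \<Longrightarrow>
    (\<integral>\<^sup>+x. ennreal (h x powr p) \<partial>lebesgue) \<le> 1 \<Longrightarrow> dyadic_averages A \<phi> M p s h"
    using dyadic_averages_B_class[OF A p(1,2)] by blast
  obtain \<psi> N where K: "\<And>g :: real^'d \<Rightarrow> real. g \<in> borel_measurable lebesgue \<Longrightarrow> (\<forall>x. 0 \<le> g x) \<Longrightarrow>
    (\<integral>\<^sup>+x. ennreal (g x powr q') \<partial>lebesgue) \<le> 1 \<Longrightarrow> dyadic_averages B \<psi> N q' s' g"
    using dyadic_averages_B_class[OF B[folded q'_def s'_def] q'] by blast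
  have e1: "1 + (1 / p + 1 / q' - 1) = 1 + (1 / p - 1 / q)" "1 + (1 / q' + 1 / p - 1) = 1 + (1 / p - 1 / q)"
    using conj_q by auto
  have "\<exists>C0. \<forall>(h :: real^'d \<Rightarrow> real) g e. dyadic_averages A \<phi> M p s h \<longrightarrow> dyadic_averages B \<psi> N q' s' g \<longrightarrow> e \<in> neighbours \<longrightarrow>
      (\<integral>\<^sup>+Q. ennreal (vol Q powr (1 + (1 / p - 1 / q)) * dyadic_averages.avg A h (shift e Q) * dyadic_averages.avg B g Q) \<partial>count_space UNIV) \<le> ennreal C0"
  proof (cases "s < q")
    case True
    then have less: "q' < s'" using s1 q1 by (auto simp: q'_def s'_def divide_simps algebra_simps)
    obtain C1 where C1: "\<forall>(h :: real^'d \<Rightarrow> real) g e. dyadic_averages A \<phi> M p s h \<longrightarrow> dyadic_averages B \<psi> N q' s' g \<longrightarrow> e \<in> neighbours \<longrightarrow>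
      (\<integral>\<^sup>+Q. ennreal (vol Q powr (1 + (1 / p - 1 / q)) * dyadic_averages.avg A h Q * dyadic_averages.avg B g (shift e Q)) \<partial>count_space UNIV) \<le> ennreal C1"
      using dyadic_bilinear_bounded[OF conj_s(1) less, where p\<^sub>1=p and A=A and B=B and \<phi>=\<phi> and \<psi>=\<psi> and M=M and N=N, unfolded e1] by (elim exE) (rule that)
    show ?thesis
    proof (intro exI[of _ C1] allI impI)
      fix h g :: "real^'d \<Rightarrow> real" and e :: "'d \<Rightarrow> int"
      assume hg: "dyadic_averages A \<phi> M p s h" "dyadic_averages B \<psi> N q' s' g" "e \<in> neighbours"
      define e' where "e' i = - e i" for i
      have "e i \<in> {-1, 0, 1}" for i using hg(3) by (simp add: neighbours_def)
      then have "- e i \<in> {-1, 0, 1}" for i by (metis add.inverse_inverse add.inverse_neutral insert_iff singletonD)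
      then have "e' i \<in> {-1, 0, 1}" for i by (simp only: e'_def)
      then have e': "e' \<in> neighbours" by (simp add: neighbours_def)
      have inv: "shift e (shift e' Q) = Q" for Q by (simp add: shift_def e'_def)
      have "(\<integral>\<^sup>+Q. ennreal (vol Q powr (1 + (1 / p - 1 / q)) * dyadic_averages.avg A h (shift e Q) * dyadic_averages.avg B g Q) \<partial>count_space UNIV) =
        (\<integral>\<^sup>+Q. ennreal (vol (shift e' Q) powr (1 + (1 / p - 1 / q)) * dyadic_averages.avg A h (shift e (shift e' Q)) * dyadic_averages.avg B g (shift e' Q)) \<partial>count_space UNIV)"
        by (rule nn_integral_shift[symmetric])
      also have "\<dots> = (\<integral>\<^sup>+Q. ennreal (vol Q powr (1 + (1 / p - 1 / q)) * dyadic_averages.avg A h Q * dyadic_averages.avg B g (shift e' Q)) \<partial>count_space UNIV)"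
        by (simp only: inv vol_shift)
      also note C1[rule_format, OF hg(1,2) e']
      finally show "(\<integral>\<^sup>+Q. ennreal (vol Q powr (1 + (1 / p - 1 / q)) * dyadic_averages.avg A h (shift e Q) * dyadic_averages.avg B g Q) \<partial>count_space UNIV) \<le> ennreal C1" .
    qed
  next
    case False
    then have less: "p < s" using p by auto
    obtain C1 where C1: "\<forall>(g :: real^'d \<Rightarrow> real) h e. dyadic_averages B \<psi> N q' s' g \<longrightarrow> dyadic_averages A \<phi> M p s h \<longrightarrow> e \<in> neighbours \<longrightarrow>
      (\<integral>\<^sup>+Q. ennreal (vol Q powr (1 + (1 / p - 1 / q)) * dyadic_averages.avg B g Q * dyadic_averages.avg A h (shift e Q)) \<partial>count_space UNIV) \<le> ennreal C1"
      using dyadic_bilinear_bounded[OF conj_s(2) less, where p\<^sub>1=q' and A=B and B=A and \<phi>=\<psi> and \<psi>=\<phi> and M=N and N=M, unfolded e1] by (elim exE) (rule that)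
    show ?thesis
    proof (intro exI[of _ C1] allI impI)
      fix h g :: "real^'d \<Rightarrow> real" and e :: "'d \<Rightarrow> int"
      assume hg: "dyadic_averages A \<phi> M p s h" "dyadic_averages B \<psi> N q' s' g" "e \<in> neighbours"
      have "(\<integral>\<^sup>+Q. ennreal (vol Q powr (1 + (1 / p - 1 / q)) * dyadic_averages.avg A h (shift e Q) * dyadic_averages.avg B g Q) \<partial>count_space UNIV) =
        (\<integral>\<^sup>+Q. ennreal (vol Q powr (1 + (1 / p - 1 / q)) * dyadic_averages.avg B g Q * dyadic_averages.avg A h (shift e Q)) \<partial>count_space UNIV)"
        by (simp only: mult_ac)
      also note C1[rule_format, OF hg(2,1,3)]
      finally show "(\<integral>\<^sup>+Q. ennreal (vol Q powr (1 + (1 / p - 1 / q)) * dyadic_averages.avg A h (shift e Q) * dyadic_averages.avg B g Q) \<partial>count_space UNIV) \<le> ennreal C1" .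
    qed
  qed
  then obtain C0 where C0: "\<forall>(h :: real^'d \<Rightarrow> real) g e. dyadic_averages A \<phi> M p s h \<longrightarrow> dyadic_averages B \<psi> N q' s' g \<longrightarrow> e \<in> neighbours \<longrightarrow>
      (\<integral>\<^sup>+Q. ennreal (vol Q powr (1 + (1 / p - 1 / q)) * dyadic_averages.avg A h (shift e Q) * dyadic_averages.avg B g Q) \<partial>count_space UNIV) \<le> ennreal C0"
    by (elim exE) (rule that)
  show ?thesis
  proof (intro exI[of _ "max C0 1"] conjI allI impI)
    fix h g :: "real^'d \<Rightarrow> real" and e :: "'d \<Rightarrow> int" and Q :: "int \<times> ('d \<Rightarrow> int)"
    assume h: "h \<in> borel_measurable lebesgue" "\<forall>x. 0 \<le> h x" "(\<integral>\<^sup>+x. ennreal (h x powr p) \<partial>lebesgue) \<le> 1"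
      and g: "g \<in> borel_measurable lebesgue" "\<forall>x. 0 \<le> g x" "(\<integral>\<^sup>+x. ennreal (g x powr (q / (q - 1))) \<partial>lebesgue) \<le> 1"
      and e: "e \<in> neighbours"
    interpret H: dyadic_averages A \<phi> M p s h by (rule H[OF h])
    interpret K: dyadic_averages B \<psi> N q' s' g by (rule K[OF g[folded q'_def]])
    show "orlicz_norm A (dyadic Q) (\<lambda>x. ennreal (h x)) < \<infinity>" using H.avg_norm_finite[of Q] by (simp add: H.avg_norm_def)
    show "orlicz_norm B (dyadic Q) (\<lambda>x. ennreal (g x)) < \<infinity>" using K.avg_norm_finite[of Q] by (simp add: K.avg_norm_def)
    have "(\<integral>\<^sup>+Q. ennreal (vol Q powr (1 + (1 / p - 1 / q))) * (orlicz_norm A (dyadic (shift e Q)) (\<lambda>x. ennreal (h x)) *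
         orlicz_norm B (dyadic Q) (\<lambda>x. ennreal (g x))) \<partial>count_space UNIV) =
      (\<integral>\<^sup>+Q. ennreal (vol Q powr (1 + (1 / p - 1 / q)) * H.avg (shift e Q) * K.avg Q) \<partial>count_space UNIV)"
      unfolding H.avg_norm_def[symmetric] K.avg_norm_def[symmetric] H.avg_norm_eq K.avg_norm_eq
      by (simp add: ennreal_mult H.avg_nonneg K.avg_nonneg mult.assoc)
    also have "\<dots> \<le> ennreal C0" by (rule C0[rule_format, OF H.dyadic_averages_axioms K.dyadic_averages_axioms e])
    also have "\<dots> \<le> ennreal (max C0 1)" by (intro ennreal_leI) simp
    finally show "(\<integral>\<^sup>+Q. ennreal (vol Q powr (1 + (1 / p - 1 / q))) * (orlicz_norm A (dyadic (shift e Q)) (\<lambda>x. ennreal (h x)) *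
         orlicz_norm B (dyadic Q) (\<lambda>x. ennreal (g x))) \<partial>count_space UNIV) \<le> ennreal (max C0 1)" .
  qed simp
qed

text \<open>The functions are extended by zero from \<open>P\<close> and \<open>Q\<close> to
  \<open>R\<close>, the cube of the bump condition. Since |P| and |Q| are at most |R|, constants
  admissible on the small cubes stay admissible on \<open>R\<close>. Each Hoelder step contributes
  2r.\<close>

lemma double_orlicz_hoelder:
  assumes \<Phi>: "young_function \<Phi>" "young_function (complementary \<Phi>)" and \<Psi>: "young_function \<Psi>" "young_function (complementary \<Psi>)"
    and R: "R \<in> sets lebesgue" "emeasure lebesgue R = ennreal r" "r > 0"
    and P: "P \<in> sets lebesgue" "P \<subseteq> R" "emeasure lebesgue P \<le> ennreal r"
    and Q: "Q \<in> sets lebesgue" "Q \<subseteq> R" "emeasure lebesgue Q \<le> ennreal r"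
    and h: "h \<in> borel_measurable lebesgue" "\<And>x. 0 \<le> h x" and g: "g \<in> borel_measurable lebesgue" "\<And>x. 0 \<le> g x"
    and a: "orlicz_norm (complementary \<Phi>) P (\<lambda>x. ennreal (h x)) < ennreal a" "0 < emeasure lebesgue P"
    and b: "orlicz_norm (complementary \<Psi>) Q (\<lambda>x. ennreal (g x)) < ennreal b" "0 < emeasure lebesgue Q"
  shows "(\<integral>\<^sup>+x\<in>Q. (\<integral>\<^sup>+y\<in>P. w x y * ennreal (h y) \<partial>lebesgue) * ennreal (g x) \<partial>lebesgue) \<le>
    ennreal (4 * r\<^sup>2 * a * b) * orlicz_norm \<Psi> R (\<lambda>x. orlicz_norm \<Phi> R (w x))"
proof -
  \<comment> \<open>Used in y with \<Phi> and \<open>w x\<close> for fixed x, then in x with \<Psi>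
    and the inner Orlicz norm, for which no measurability is available.\<close>
  have single: "(\<integral>\<^sup>+y\<in>S. u y * ennreal (f y) \<partial>lebesgue) \<le> ennreal (2 * r * t) * orlicz_norm \<Theta> R u"
    if \<Theta>: "young_function \<Theta>" "young_function (complementary \<Theta>)"
      and S: "S \<in> sets lebesgue" "S \<subseteq> R" "emeasure lebesgue S \<le> ennreal r" "0 < emeasure lebesgue S"
      and f: "f \<in> borel_measurable lebesgue" "\<And>x. 0 \<le> f x"
      and t: "orlicz_norm (complementary \<Theta>) S (\<lambda>x. ennreal (f x)) < ennreal t" for S f t \<Theta> u
  proof -
    have t0: "t > 0" using t by (cases "t > 0") (auto simp: ennreal_neg)
    have z: "complementary \<Theta> 0 = 0" using \<Theta>(2) by (simp add: young_function_def)
    have "emeasure lebesgue S < \<infinity>" using S(3) by (simp add: le_less_trans)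
    note le = orlicz_norm_less_imp[OF \<Theta>(2) S(4) this t]
    have "(\<integral>\<^sup>+x\<in>R. ennreal (complementary \<Theta> (f x * indicator S x / t)) \<partial>lebesgue) \<le>
        (\<integral>\<^sup>+x\<in>S. young_ext (complementary \<Theta>) (ennreal (f x) / ennreal t) \<partial>lebesgue)"
      using f(2) t0 z by (intro nn_integral_mono) (auto simp: young_ext_ennreal split: split_indicator)
    also have "\<dots> \<le> emeasure lebesgue R" using le S(3) R(2) by simp
    finally have le': "(\<integral>\<^sup>+x\<in>R. ennreal (complementary \<Theta> (f x * indicator S x / t)) \<partial>lebesgue) \<le> emeasure lebesgue R" .
    have "(\<integral>\<^sup>+y\<in>S. u y * ennreal (f y) \<partial>lebesgue) \<le> (\<integral>\<^sup>+y\<in>R. u y * ennreal (f y * indicator S y) \<partial>lebesgue)"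
      using S(2) by (intro nn_integral_mono) (auto split: split_indicator)
    also have "\<dots> \<le> 2 * emeasure lebesgue R * ennreal t * orlicz_norm \<Theta> R u"
      using f S(1) R t0 by (intro orlicz_hoelder[OF \<Theta>] le') auto
    also have "2 * emeasure lebesgue R * ennreal t = ennreal (2 * r * t)"
      using R t0 by (simp add: ennreal_mult)
    finally show ?thesis .
  qed
  have "a > 0" using a(1) by (cases "a > 0") (auto simp: ennreal_neg)
  moreover have "b > 0" using b(1) by (cases "b > 0") (auto simp: ennreal_neg)
  ultimately have pos: "a > 0" "b > 0" .
  have "(\<integral>\<^sup>+x\<in>Q. (\<integral>\<^sup>+y\<in>P. w x y * ennreal (h y) \<partial>lebesgue) * ennreal (g x) \<partial>lebesgue) \<le>
    (\<integral>\<^sup>+x. ennreal (2 * r * a) * (orlicz_norm \<Phi> R (w x) * ennreal (g x) * indicator Q x) \<partial>lebesgue)"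
  proof (intro nn_integral_mono)
    fix x
    have "(\<integral>\<^sup>+y\<in>P. w x y * ennreal (h y) \<partial>lebesgue) * (ennreal (g x) * indicator Q x) \<le>
      (ennreal (2 * r * a) * orlicz_norm \<Phi> R (w x)) * (ennreal (g x) * indicator Q x)"
      by (intro mult_right_mono single[OF \<Phi> P a(2) h a(1)]) simp
    then show "(\<integral>\<^sup>+y\<in>P. w x y * ennreal (h y) \<partial>lebesgue) * ennreal (g x) * indicator Q x \<le>
      ennreal (2 * r * a) * (orlicz_norm \<Phi> R (w x) * ennreal (g x) * indicator Q x)" by (simp only: mult.assoc)
  qed
  also have "\<dots> \<le> ennreal (2 * r * a) * (\<integral>\<^sup>+x\<in>Q. orlicz_norm \<Phi> R (w x) * ennreal (g x) \<partial>lebesgue)"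
    using R pos by (intro nn_integral_cmult_le) simp
  also have "\<dots> \<le> ennreal (2 * r * a) * (ennreal (2 * r * b) * orlicz_norm \<Psi> R (\<lambda>x. orlicz_norm \<Phi> R (w x)))"
    by (intro mult_left_mono single[OF \<Psi> Q b(2) g b(1)]) simp
  also have "\<dots> = ennreal (4 * r\<^sup>2 * a * b) * orlicz_norm \<Psi> R (\<lambda>x. orlicz_norm \<Phi> R (w x))"
  proof -
    have "ennreal (2 * r * a) * ennreal (2 * r * b) = ennreal (4 * r\<^sup>2 * a * b)"
      using R pos by (subst ennreal_mult[symmetric]) (auto simp: power2_eq_square mult_ac)
    then show ?thesis by (simp only: mult.assoc[symmetric])
  qed
  finally show ?thesis .
qed

section \<open>Inserting the bump condition\<close>

lemma emeasure_cube:
  fixes z :: "real^'d"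
  assumes "l > 0"
  shows "emeasure lebesgue (cube z l) = ennreal (l ^ CARD('d))"
proof -
  have ba: "((z + vec (l / 2)) - (z - vec (l / 2))) \<bullet> v = l" if "v \<in> Basis" for v
    using that by (auto simp: Basis_vec_def inner_axis)
  then have "(z - vec (l / 2)) \<bullet> v \<le> (z + vec (l / 2)) \<bullet> v" if "v \<in> Basis" for v
    using ba[OF that] assms inner_diff_left[of "z + vec (l / 2)" "z - vec (l / 2)" v] by linarith
  then have "emeasure lborel (cube z l) = ennreal (\<Prod>v\<in>Basis. ((z + vec (l / 2)) - (z - vec (l / 2))) \<bullet> v)"
    unfolding cube_def by (rule emeasure_lborel_cbox)
  also have "\<dots> = ennreal (l ^ CARD('d))" using ba by simp
  finally show ?thesis by (simp add: cube_def)
qed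

lemma psi_pos: "psi \<rho> \<theta> x l > 0" if "\<rho> x > 0" "l > 0"
  using that by (simp add: psi_def add_pos_pos less_imp_neq[symmetric])

text \<open>For each pair of neighbouring cubes the bump condition on 3Q bounds the double norm, and
  its \<open>psi\<close> cancels the one in \<open>dyadic_coeff\<close>. What remains is the power
  of |Q| in the dyadic sum for \<open>h\<close> and \<open>g\<close>. The weight \<open>w\<close> is
  an arbitrary scalar function of x and y, so the matrices are out of sight.\<close>

lemma dyadic_form_bound:
  fixes \<rho> :: "real^'d \<Rightarrow> real"
  assumes \<rho>: "critical_radius \<rho>" and p: "1 < p" "p \<le> s" "s \<le> q" "p < q"
    and \<Phi>: "young_function \<Phi>" and \<Psi>: "young_function \<Psi>"
    and \<Phi>': "complementary \<Phi> \<in> B_class p s" and \<Psi>': "complementary \<Psi> \<in> B_class (q / (q - 1)) (s / (s - 1))"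
  shows "\<exists>C>0. \<forall>w (h :: real^'d \<Rightarrow> real) g B. 0 \<le> B \<longrightarrow>
      (\<forall>z l. l > 0 \<longrightarrow> ennreal (measure lebesgue (cube z l) powr (\<alpha> / real CARD('d) + 1 / q - 1 / p) / psi \<rho> (\<theta> / 3) z l) *
        orlicz_norm \<Psi> (cube z l) (\<lambda>x. orlicz_norm \<Phi> (cube z l) (w x)) \<le> ennreal B) \<longrightarrow>
      h \<in> borel_measurable lebesgue \<longrightarrow> (\<forall>x. 0 \<le> h x) \<longrightarrow> (\<integral>\<^sup>+x. ennreal (h x powr p) \<partial>lebesgue) \<le> 1 \<longrightarrow>
      g \<in> borel_measurable lebesgue \<longrightarrow> (\<forall>x. 0 \<le> g x) \<longrightarrow> (\<integral>\<^sup>+x. ennreal (g x powr (q / (q - 1))) \<partial>lebesgue) \<le> 1 \<longrightarrow>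
      (\<integral>\<^sup>+Q. (\<Sum>e\<in>neighbours. ennreal (dyadic_coeff \<rho> \<theta> \<alpha> Q) *
        (\<integral>\<^sup>+x\<in>dyadic Q. (\<integral>\<^sup>+y\<in>dyadic (shift e Q). w x y * ennreal (h y) \<partial>lebesgue) * ennreal (g x) \<partial>lebesgue)) \<partial>count_space UNIV)
      \<le> ennreal (C * B)"
proof -
  define d where "d = real CARD('d)"
  define e0 where "e0 = \<alpha> / d + 1 / q - 1 / p"
  \<comment> \<open>The 4 comes from two Hoelder steps, the power of 3^d from |3Q| = 3^d |Q|, which
    enters with exponent 2 - e0.\<close>
  define D where "D = 4 * (3 ^ CARD('d)) powr (2 - e0)"
  have d: "d > 0" by (simp add: d_def)
  have D: "D > 0" by (simp add: D_def)
  have \<rho>0: "\<rho> x > 0" for x using \<rho> by (simp add: critical_radius_def)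
  have yA: "young_function (complementary \<Phi>)" and yB: "young_function (complementary \<Psi>)"
    using \<Phi>' \<Psi>' by (auto simp: B_class_def)
  obtain C0 where C0: "C0 > 0" and bil: "\<forall>(h :: real^'d \<Rightarrow> real) g e. h \<in> borel_measurable lebesgue \<longrightarrow> (\<forall>x. 0 \<le> h x) \<longrightarrow>
      (\<integral>\<^sup>+x. ennreal (h x powr p) \<partial>lebesgue) \<le> 1 \<longrightarrow>
      g \<in> borel_measurable lebesgue \<longrightarrow> (\<forall>x. 0 \<le> g x) \<longrightarrow>
      (\<integral>\<^sup>+x. ennreal (g x powr (q / (q - 1))) \<partial>lebesgue) \<le> 1 \<longrightarrow> e \<in> neighbours \<longrightarrow>
      (\<forall>Q. orlicz_norm (complementary \<Phi>) (dyadic Q) (\<lambda>x. ennreal (h x)) < \<infinity> \<and> orlicz_norm (complementary \<Psi>) (dyadic Q) (\<lambda>x. ennreal (g x)) < \<infinity>) \<and>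
      (\<integral>\<^sup>+Q. ennreal (vol Q powr (1 + (1 / p - 1 / q))) * (orlicz_norm (complementary \<Phi>) (dyadic (shift e Q)) (\<lambda>x. ennreal (h x)) *
         orlicz_norm (complementary \<Psi>) (dyadic Q) (\<lambda>x. ennreal (g x))) \<partial>count_space UNIV) \<le> ennreal C0"
    using two_weight_dyadic_sum[OF \<Phi>' \<Psi>' p] by (elim exE conjE) (rule that)
  define n where "n = real (card (neighbours :: ('d \<Rightarrow> int) set))"
  have main: "(\<integral>\<^sup>+Q. (\<Sum>e\<in>neighbours. ennreal (dyadic_coeff \<rho> \<theta> \<alpha> Q) *
        (\<integral>\<^sup>+x\<in>dyadic Q. (\<integral>\<^sup>+y\<in>dyadic (shift e Q). w x y * ennreal (h y) \<partial>lebesgue) * ennreal (g x) \<partial>lebesgue)) \<partial>count_space UNIV)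
      \<le> ennreal ((n * D * C0 + 1) * B)"
    if B: "0 \<le> B"
      and bump: "\<forall>z l. l > 0 \<longrightarrow> ennreal (measure lebesgue (cube z l) powr (\<alpha> / real CARD('d) + 1 / q - 1 / p) / psi \<rho> (\<theta> / 3) z l) *
        orlicz_norm \<Psi> (cube z l) (\<lambda>x. orlicz_norm \<Phi> (cube z l) (w x)) \<le> ennreal B"
      and h: "h \<in> borel_measurable lebesgue" "\<forall>x. 0 \<le> h x" "(\<integral>\<^sup>+x. ennreal (h x powr p) \<partial>lebesgue) \<le> 1"
      and g: "g \<in> borel_measurable lebesgue" "\<forall>x. 0 \<le> g x" "(\<integral>\<^sup>+x. ennreal (g x powr (q / (q - 1))) \<partial>lebesgue) \<le> 1"
    for w and h g :: "real^'d \<Rightarrow> real" and B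
  proof -
    define a where "a Q = orlicz_norm (complementary \<Phi>) (dyadic Q) (\<lambda>x. ennreal (h x))" for Q
    define b where "b Q = orlicz_norm (complementary \<Psi>) (dyadic Q) (\<lambda>x. ennreal (g x))" for Q
    have fin: "a Q < \<infinity>" "b Q < \<infinity>" for Q
      using bil[rule_format, OF h(1) _ h(3) g(1) _ g(3) zero_in_neighbours] h(2) g(2) unfolding a_def b_def by blast+
    have sum: "(\<integral>\<^sup>+Q. ennreal (vol Q powr (1 + (1 / p - 1 / q))) * (a (shift e Q) * b Q) \<partial>count_space UNIV) \<le> ennreal C0" if "e \<in> neighbours" for e
      using bil[rule_format, OF h(1) _ h(3) g(1) _ g(3) that] h(2) g(2) unfolding a_def b_def by blast
    have loc: "ennreal (dyadic_coeff \<rho> \<theta> \<alpha> Q) *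
        (\<integral>\<^sup>+x\<in>dyadic Q. (\<integral>\<^sup>+y\<in>dyadic (shift e Q). w x y * ennreal (h y) \<partial>lebesgue) * ennreal (g x) \<partial>lebesgue) \<le>
        ennreal (D * B) * (ennreal (vol Q powr (1 + (1 / p - 1 / q))) * (a (shift e Q) * b Q))" if e: "e \<in> neighbours" for Q e
    proof -
      define X where "X = (\<integral>\<^sup>+x\<in>dyadic Q. (\<integral>\<^sup>+y\<in>dyadic (shift e Q). w x y * ennreal (h y) \<partial>lebesgue) * ennreal (g x) \<partial>lebesgue)"
      define L where "L = 2 powr real_of_int (fst Q)"
      define R where "R = cube (centre Q) (3 * L)"
      define r where "r = 3 ^ CARD('d) * vol Q"
      define J where "J = orlicz_norm \<Psi> R (\<lambda>x. orlicz_norm \<Phi> R (w x))"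
      define \<beta> where "\<beta> = r powr e0 / psi \<rho> (\<theta> / 3) (centre Q) (3 * L)"
      have L: "L > 0" by (simp add: L_def)
      have v: "vol Q > 0" "vol Q = L powr d" by (simp_all add: vol_pos) (simp add: vol_def L_def powr_powr d_def)
      have r: "r > 0" using v by (simp add: r_def)
      have "(3 * L) ^ CARD('d) = r" using L by (simp add: r_def v(2) d_def powr_realpow power_mult_distrib)
      then have R: "R \<in> sets lebesgue" "emeasure lebesgue R = ennreal r"
        using emeasure_cube[of "3 * L" "centre Q"] L by (simp_all add: R_def) (simp add: cube_def)
      have psi: "psi \<rho> (\<theta> / 3) (centre Q) (3 * L) > 0" using L \<rho>0 by (intro psi_pos) auto
      have \<beta>: "\<beta> > 0" using r psi by (simp add: \<beta>_def)
      have "measure lebesgue R = r" using R r by (simp add: measure_def)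
      then have "ennreal \<beta> * J \<le> ennreal B"
        using bump[rule_format, of "3 * L" "centre Q"] L by (simp add: \<beta>_def J_def R_def e0_def d_def)
      then have J: "J \<le> ennreal (B / \<beta>)"
      proof -
        assume le: "ennreal \<beta> * J \<le> ennreal B"
        have "J = ennreal (1 / \<beta>) * (ennreal \<beta> * J)"
          using \<beta> by (simp add: mult.assoc[symmetric] ennreal_mult[symmetric])
        also have "\<dots> \<le> ennreal (1 / \<beta>) * ennreal B" by (intro mult_left_mono le) simp
        also have "\<dots> = ennreal (B / \<beta>)" using \<beta> B by (simp add: ennreal_mult[symmetric])
        finally show ?thesis .
      qed
      have Jfin: "J < \<infinity>" using J by (simp add: le_less_trans)
      have "vol Q \<le> r" using v by (simp add: r_def)
      then have two: "X \<le> ennreal (4 * r\<^sup>2 * t * u) * J" if "a (shift e Q) < ennreal t" "b Q < ennreal u" for t u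
        unfolding X_def J_def
        using that e h g R r vol_pos[of Q] dyadic_sets[of Q] dyadic_sets[of "shift e Q"] dyadic_shift_subset_cube[OF e, of Q]
          dyadic_shift_subset_cube[OF zero_in_neighbours, of Q]
        unfolding a_def b_def R_def L_def
        by (intro double_orlicz_hoelder[OF \<Phi> yA \<Psi> yB]) (auto simp: emeasure_dyadic vol_shift shift_zero ennreal_leI)
      \<comment> \<open>The two Orlicz averages are approached from above one after the other; each
        limit is taken with the remaining factor finite.\<close>
      have "X \<le> (ennreal (4 * r\<^sup>2) * J * a (shift e Q)) * b Q"
      proof (rule ennreal_le_mult_of_forall_gt)
        show "ennreal (4 * r\<^sup>2) * J * a (shift e Q) < \<infinity>" using Jfin fin(1)[of "shift e Q"] by (simp add: ennreal_mult_less_top)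
        show "b Q < \<infinity>" by (rule fin)
        fix u assume u: "b Q < ennreal u"
        then have u0: "u > 0" by (cases "u > 0") (auto simp: ennreal_neg)
        have "X \<le> (ennreal (4 * r\<^sup>2) * J * ennreal u) * a (shift e Q)"
        proof (rule ennreal_le_mult_of_forall_gt)
          show "ennreal (4 * r\<^sup>2) * J * ennreal u < \<infinity>" using Jfin by (simp add: ennreal_mult_less_top)
          show "a (shift e Q) < \<infinity>" by (rule fin)
          fix t assume t: "a (shift e Q) < ennreal t"
          then have t0: "t > 0" by (cases "t > 0") (auto simp: ennreal_neg)
          have "ennreal (4 * r\<^sup>2 * t * u) = ennreal (4 * r\<^sup>2) * ennreal t * ennreal u"
            using t0 u0 by (simp only: ennreal_mult' less_imp_le mult_nonneg_nonneg zero_le_power2 zero_le_numeral ennreal_mult'')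
          then show "X \<le> ennreal (4 * r\<^sup>2) * J * ennreal u * ennreal t" using two[OF t u] by (simp only: mult_ac)
        qed
        then show "X \<le> ennreal (4 * r\<^sup>2) * J * a (shift e Q) * ennreal u" by (simp only: mult_ac)
      qed
      also have "\<dots> \<le> (ennreal (4 * r\<^sup>2) * ennreal (B / \<beta>) * a (shift e Q)) * b Q"
        by (intro mult_right_mono mult_left_mono J) auto
      finally have "ennreal (dyadic_coeff \<rho> \<theta> \<alpha> Q) * X \<le> ennreal (dyadic_coeff \<rho> \<theta> \<alpha> Q) * ((ennreal (4 * r\<^sup>2) * ennreal (B / \<beta>) * a (shift e Q)) * b Q)"
        by (intro mult_left_mono) auto
      also have "\<dots> = (ennreal (dyadic_coeff \<rho> \<theta> \<alpha> Q) * (ennreal (4 * r\<^sup>2) * ennreal (B / \<beta>))) * (a (shift e Q) * b Q)"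
        by (simp only: mult_ac)
      also have "ennreal (dyadic_coeff \<rho> \<theta> \<alpha> Q) * (ennreal (4 * r\<^sup>2) * ennreal (B / \<beta>)) = ennreal (dyadic_coeff \<rho> \<theta> \<alpha> Q * (4 * r\<^sup>2 * (B / \<beta>)))"
      proof -
        have "dyadic_coeff \<rho> \<theta> \<alpha> Q \<ge> 0" using psi by (simp add: dyadic_coeff_def L_def[symmetric])
        moreover have B\<beta>: "0 \<le> B / \<beta>" using B \<beta> by simp
        ultimately have "ennreal (dyadic_coeff \<rho> \<theta> \<alpha> Q * (4 * r\<^sup>2 * (B / \<beta>))) = ennreal (dyadic_coeff \<rho> \<theta> \<alpha> Q) * ennreal (4 * r\<^sup>2 * (B / \<beta>))"
          by (intro ennreal_mult mult_nonneg_nonneg[OF _ B\<beta>]) auto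
        also have "ennreal (4 * r\<^sup>2 * (B / \<beta>)) = ennreal (4 * r\<^sup>2) * ennreal (B / \<beta>)"
          by (rule ennreal_mult[OF _ B\<beta>]) simp
        finally show ?thesis ..
      qed
      also have "dyadic_coeff \<rho> \<theta> \<alpha> Q * (4 * r\<^sup>2 * (B / \<beta>)) = (D * B) * vol Q powr (1 + (1 / p - 1 / q))"
      proof -
        have "dyadic_coeff \<rho> \<theta> \<alpha> Q = vol Q powr (\<alpha> / d - 1) / psi \<rho> (\<theta> / 3) (centre Q) (3 * L)"
          using d by (simp add: dyadic_coeff_def v(2) L_def powr_powr d_def diff_divide_distrib[symmetric] right_diff_distrib)
        then have "dyadic_coeff \<rho> \<theta> \<alpha> Q * (4 * r\<^sup>2 * (B / \<beta>)) = 4 * B * vol Q powr (\<alpha> / d - 1) * (r\<^sup>2 / r powr e0)"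
          using psi by (simp add: \<beta>_def)
        also have "r\<^sup>2 / r powr e0 = r powr (2 - e0)" using r by (simp add: powr_diff)
        also have "r powr (2 - e0) = (3 ^ CARD('d)) powr (2 - e0) * vol Q powr (2 - e0)"
          unfolding r_def using v by (intro powr_mult) 
        also have "4 * B * vol Q powr (\<alpha> / d - 1) * ((3 ^ CARD('d)) powr (2 - e0) * vol Q powr (2 - e0)) =
            (D * B) * (vol Q powr (\<alpha> / d - 1) * vol Q powr (2 - e0))"
          by (simp only: D_def mult_ac)
        also have "vol Q powr (\<alpha> / d - 1) * vol Q powr (2 - e0) = vol Q powr (1 + (1 / p - 1 / q))"
          by (simp add: powr_add[symmetric] e0_def)
        finally show ?thesis .
      qed
      also have "ennreal ((D * B) * vol Q powr (1 + (1 / p - 1 / q))) = ennreal (D * B) * ennreal (vol Q powr (1 + (1 / p - 1 / q)))"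
        using D B by (intro ennreal_mult) auto
      finally show ?thesis by (simp only: X_def mult.assoc)
    qed
    have "(\<integral>\<^sup>+Q. (\<Sum>e\<in>neighbours. ennreal (dyadic_coeff \<rho> \<theta> \<alpha> Q) *
        (\<integral>\<^sup>+x\<in>dyadic Q. (\<integral>\<^sup>+y\<in>dyadic (shift e Q). w x y * ennreal (h y) \<partial>lebesgue) * ennreal (g x) \<partial>lebesgue)) \<partial>count_space UNIV) \<le>
      (\<integral>\<^sup>+Q. (\<Sum>e\<in>neighbours. ennreal (D * B) * (ennreal (vol Q powr (1 + (1 / p - 1 / q))) * (a (shift e Q) * b Q))) \<partial>count_space UNIV)"
      by (intro nn_integral_mono sum_mono loc)
    also have "\<dots> = (\<Sum>e\<in>neighbours. \<integral>\<^sup>+Q. ennreal (D * B) * (ennreal (vol Q powr (1 + (1 / p - 1 / q))) * (a (shift e Q) * b Q)) \<partial>count_space UNIV)"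
      by (intro nn_integral_sum) simp
    also have "\<dots> = (\<Sum>e\<in>neighbours. ennreal (D * B) * (\<integral>\<^sup>+Q. ennreal (vol Q powr (1 + (1 / p - 1 / q))) * (a (shift e Q) * b Q) \<partial>count_space UNIV))"
      by (intro sum.cong refl nn_integral_cmult) simp
    also have "\<dots> \<le> (\<Sum>e\<in>(neighbours :: ('d \<Rightarrow> int) set). ennreal (D * B) * ennreal C0)"
      by (intro sum_mono mult_left_mono sum) auto
    also have "\<dots> = ennreal (n * D * C0 * B)"
      using D C0 B by (simp add: n_def ennreal_mult[symmetric] ennreal_of_nat_eq_real_of_nat mult_ac)
    also have "\<dots> \<le> ennreal ((n * D * C0 + 1) * B)" using B by (intro ennreal_leI) (simp add: distrib_right)
    finally show ?thesis .
  qed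
  have "n * D * C0 + 1 > 0" using D C0 by (simp add: n_def add_nonneg_pos)
  then show ?thesis using main by (intro exI[of _ "n * D * C0 + 1"] conjI allI impI)
qed

subsection \<open>From the bilinear form to the strong type bound\<close>

lemma borel_measurable_ennreal_powr: "(\<lambda>z. ennreal_powr z a) \<in> borel_measurable borel"
  unfolding ennreal_powr_def by measurable

text \<open>The converse of Hoelder's inequality. Since \<open>G\<close> is not known to lie in L^q,
  it is applied to bounded truncations supported in balls, and Fatou's lemma gives the
  limit.\<close>

lemma duality_bound:
  fixes G :: "'a::euclidean_space \<Rightarrow> ennreal"
  assumes G: "G \<in> borel_measurable lebesgue" and q: "1 < q" and K: "0 \<le> K"
    and test: "\<And>g. g \<in> borel_measurable lebesgue \<Longrightarrow> (\<forall>x. 0 \<le> g x) \<Longrightarrow>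
      (\<integral>\<^sup>+x. ennreal (g x powr (q / (q - 1))) \<partial>lebesgue) \<le> 1 \<Longrightarrow> (\<integral>\<^sup>+x. G x * ennreal (g x) \<partial>lebesgue) \<le> ennreal K"
  shows "(\<integral>\<^sup>+x. ennreal_powr (G x) q \<partial>lebesgue) \<le> ennreal (K powr q)"
proof -
  define u where "u n x = enn2real (min (G x) (ennreal (real n))) * indicator (cball 0 (real n)) x" for n :: nat and x
  have um: "u n \<in> borel_measurable lebesgue" for n
    unfolding u_def using G by (intro borel_measurable_times borel_measurable_indicator measurable_compose[OF _ borel_measurable_enn2real]) auto
  have u0: "u n x \<ge> 0" for n x by (simp add: u_def)
  have uG: "ennreal (u n x) \<le> G x" for n x
  proof (cases "x \<in> cball 0 (real n)")
    case True
    have "ennreal (enn2real (min (G x) (ennreal (real n)))) = min (G x) (ennreal (real n))"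
      by (intro ennreal_enn2real) (simp add: min_less_iff_disj)
    then show ?thesis using True by (simp add: u_def)
  qed (simp add: u_def)
  have un: "u n x \<le> real n" for n x
  proof -
    have "enn2real (min (G x) (ennreal (real n))) \<le> enn2real (ennreal (real n))" by (intro enn2real_mono) auto
    then show ?thesis by (auto simp: u_def split: split_indicator)
  qed
  have bound: "(\<integral>\<^sup>+x. ennreal (u n x powr q) \<partial>lebesgue) \<le> ennreal (K powr q)" for n
  proof -
    have "(\<integral>\<^sup>+x. ennreal (u n x powr q) \<partial>lebesgue) \<le> (\<integral>\<^sup>+(x::'a). ennreal (real n powr q) * indicator (cball 0 (real n)) x \<partial>lebesgue)"
    proof (intro nn_integral_mono)
      fix x :: 'a
      show "ennreal (u n x powr q) \<le> ennreal (real n powr q) * indicator (cball 0 (real n)) x"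
      proof (cases "x \<in> cball 0 (real n)")
        case True
        then show ?thesis using un[of n x] u0[of n x] q by (simp add: ennreal_leI powr_mono2)
      qed (use q in \<open>simp add: u_def\<close>)
    qed
    also have "\<dots> < \<infinity>"
      using emeasure_bounded_finite[of "cball 0 (real n) :: 'a set"] by (simp add: nn_integral_cmult_indicator ennreal_mult_less_top)
    finally obtain I where I: "(\<integral>\<^sup>+x. ennreal (u n x powr q) \<partial>lebesgue) = ennreal I" "I \<ge> 0"
      by (cases "\<integral>\<^sup>+x. ennreal (u n x powr q) \<partial>lebesgue") auto
    show ?thesis
    proof (cases "I = 0")
      case False
      then have I0: "I > 0" using I by simp
      \<comment> \<open>With q' = q/(q-1), c = I^(-1/q') gives g = c u^(q-1) unit norm in L^q',
        while the integral of u g is c I = I^(1/q).\<close>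
      define c where "c = I powr (- (1 - 1 / q))"
      have c: "c > 0" using I0 by (simp add: c_def)
      define g where "g x = c * u n x powr (q - 1)" for x
      have gm: "g \<in> borel_measurable lebesgue" unfolding g_def using um[of n] by measurable
      have cq: "c powr (q / (q - 1)) = 1 / I"
      proof -
        have e: "(1 - 1 / q) * (q / (q - 1)) = 1" using q by (simp add: field_simps)
        have "c powr (q / (q - 1)) = I powr (- ((1 - 1 / q) * (q / (q - 1))))"
          by (simp only: c_def powr_powr mult_minus_left)
        then have "c powr (q / (q - 1)) = I powr (- 1)" by (simp only: e)
        then show ?thesis using I0 by (simp add: powr_minus_divide)
      qed
      have gq: "g x powr (q / (q - 1)) = (1 / I) * u n x powr q" for x
        using q c by (simp add: g_def powr_mult powr_powr cq)
      have "(\<integral>\<^sup>+x. ennreal (g x powr (q / (q - 1))) \<partial>lebesgue) = (\<integral>\<^sup>+x. ennreal (1 / I) * ennreal (u n x powr q) \<partial>lebesgue)"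
        unfolding gq using I0 by (intro nn_integral_cong ennreal_mult) auto
      also have "\<dots> = ennreal (1 / I) * ennreal I"
        using um[of n] unfolding I(1)[symmetric] by (intro nn_integral_cmult) measurable
      also have "\<dots> = 1" using I0 by (simp add: ennreal_mult[symmetric])
      finally have g1: "(\<integral>\<^sup>+x. ennreal (g x powr (q / (q - 1))) \<partial>lebesgue) \<le> 1" by simp
      have le: "(\<integral>\<^sup>+x. G x * ennreal (g x) \<partial>lebesgue) \<le> ennreal K"
      proof (rule test[OF gm _ g1])
        show "\<forall>x. 0 \<le> g x" using c by (simp add: g_def)
      qed
      have "ennreal (c * I) = ennreal c * (\<integral>\<^sup>+x. ennreal (u n x powr q) \<partial>lebesgue)" using I c by (simp add: ennreal_mult)
      also have "\<dots> = (\<integral>\<^sup>+x. ennreal c * ennreal (u n x powr q) \<partial>lebesgue)"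
        using um[of n] by (intro nn_integral_cmult[symmetric]) measurable
      also have "\<dots> = (\<integral>\<^sup>+x. ennreal (u n x) * ennreal (g x) \<partial>lebesgue)"
      proof (intro nn_integral_cong)
        fix x
        have "u n x * u n x powr (q - 1) = u n x powr q"
          using u0[of n x] by (cases "u n x = 0") (auto simp: powr_diff)
        then have "c * u n x powr q = u n x * g x" by (simp add: g_def mult_ac)
        then show "ennreal c * ennreal (u n x powr q) = ennreal (u n x) * ennreal (g x)"
          using c u0[of n x] by (simp add: ennreal_mult[symmetric] g_def)
      qed
      also have "\<dots> \<le> (\<integral>\<^sup>+x. G x * ennreal (g x) \<partial>lebesgue)" by (intro nn_integral_mono mult_right_mono uG) simp
      also note le
      finally have "c * I \<le> K" using K by simp
      moreover have "c * I powr 1 = I powr (1 / q)" by (simp only: c_def powr_add[symmetric]) simp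
      ultimately have "I powr (1 / q) \<le> K" using I0 by simp
      then have "(I powr (1 / q)) powr q \<le> K powr q" using q by (intro powr_mono2) auto
      then show ?thesis using I I0 q by (simp add: powr_powr ennreal_leI)
    qed (use I in simp)
  qed
  have lim: "(\<lambda>n. ennreal (u n x powr q)) \<longlonglongrightarrow> ennreal_powr (G x) q" for x
  proof (cases "G x = \<infinity>")
    case False
    then obtain r where r: "G x = ennreal r" "r \<ge> 0" by (cases "G x") auto
    have "\<forall>\<^sub>F n in sequentially. ennreal (u n x powr q) = ennreal_powr (G x) q"
      using eventually_ge_at_top[of "nat \<lceil>max r (norm x)\<rceil>"]
    proof eventually_elim
      case (elim n)
      then have "r \<le> real n" "norm x \<le> real n" by linarith+
      then show ?case using r by (simp add: u_def ennreal_powr_def min_def)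
    qed
    then show ?thesis by (rule tendsto_eventually)
  next
    case True
    have "\<forall>\<^sub>F n in sequentially. ennreal l < ennreal (u n x powr q)" if "l \<ge> 0" for l
      using eventually_ge_at_top[of "nat \<lceil>max (l + 1) (norm x)\<rceil>"]
    proof eventually_elim
      case (elim n)
      then have n: "l + 1 \<le> real n" "norm x \<le> real n" by linarith+
      then have "real n powr 1 \<le> real n powr q" using that q by (intro powr_mono) auto
      then have "l < real n powr q" using n that by simp
      then show ?case using n True that by (simp add: u_def min_def ennreal_less_iff top_unique)
    qed
    then show ?thesis using True by (simp add: ennreal_powr_def tendsto_top_iff_ennreal)
  qed
  have "(\<integral>\<^sup>+x. ennreal_powr (G x) q \<partial>lebesgue) = (\<integral>\<^sup>+x. liminf (\<lambda>n. ennreal (u n x powr q)) \<partial>lebesgue)"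
    using lim_imp_Liminf[OF _ lim] by (intro nn_integral_cong) simp
  also have "\<dots> \<le> liminf (\<lambda>n. \<integral>\<^sup>+x. ennreal (u n x powr q) \<partial>lebesgue)"
    using um by (intro nn_integral_liminf) measurable
  also have "\<dots> \<le> liminf (\<lambda>n::nat. ennreal (K powr q))"
    by (intro Liminf_mono always_eventually allI bound)
  also have "\<dots> = ennreal (K powr q)" by (simp add: Liminf_const)
  finally show ?thesis .
qed

text \<open>The positive scalar operator that controls |U^(1/q) L^(-\<alpha>/2) f| when w(x,y) =
  |U(x)^(1/q) V(y)^(-1/q)| and h = |V^(1/q) f|.\<close>

definition dyadic_operator ::
  "(real^'d \<Rightarrow> real) \<Rightarrow> real \<Rightarrow> real \<Rightarrow> (real^'d \<Rightarrow> real^'d \<Rightarrow> ennreal) \<Rightarrow> (real^'d \<Rightarrow> real) \<Rightarrow> real^'d \<Rightarrow> ennreal" where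
  "dyadic_operator \<rho> \<theta> \<alpha> w h x = (\<integral>\<^sup>+Q. (\<Sum>e\<in>neighbours. indicator (dyadic Q) x *
     (ennreal (dyadic_coeff \<rho> \<theta> \<alpha> Q) * (\<integral>\<^sup>+y\<in>dyadic (shift e Q). w x y * ennreal (h y) \<partial>lebesgue))) \<partial>count_space UNIV)"

text \<open>Duality for the form bound, after dividing \<open>h\<close> by \<open>c\<close>. A
  positive number \<open>c\<close> takes the place of the norm of \<open>h\<close>, so that norm
  zero is no special case. Joint Borel measurability of \<open>w\<close> makes the operator
  measurable in x, as duality and Tonelli require.\<close>

lemma dyadic_operator_strong_type:
  fixes \<rho> :: "real^'d \<Rightarrow> real"
  assumes \<rho>: "critical_radius \<rho>" and p: "1 < p" "p \<le> s" "s \<le> q" "p < q"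
    and \<Phi>: "young_function \<Phi>" and \<Psi>: "young_function \<Psi>"
    and \<Phi>': "complementary \<Phi> \<in> B_class p s" and \<Psi>': "complementary \<Psi> \<in> B_class (q / (q - 1)) (s / (s - 1))"
  shows "\<exists>C>0. \<forall>w (h :: real^'d \<Rightarrow> real) B c. 0 \<le> B \<longrightarrow> 0 < c \<longrightarrow>
      (\<forall>z l. l > 0 \<longrightarrow> ennreal (measure lebesgue (cube z l) powr (\<alpha> / real CARD('d) + 1 / q - 1 / p) / psi \<rho> (\<theta> / 3) z l) *
        orlicz_norm \<Psi> (cube z l) (\<lambda>x. orlicz_norm \<Phi> (cube z l) (w x)) \<le> ennreal B) \<longrightarrow>
      (\<lambda>(x, y). w x y) \<in> borel_measurable (lborel \<Otimes>\<^sub>M lborel) \<longrightarrow>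
      h \<in> borel_measurable borel \<longrightarrow> (\<forall>x. 0 \<le> h x) \<longrightarrow> (\<integral>\<^sup>+x. ennreal (h x powr p) \<partial>lebesgue) \<le> ennreal (c powr p) \<longrightarrow>
      dyadic_operator \<rho> \<theta> \<alpha> w h \<in> borel_measurable lebesgue \<and>
      (\<integral>\<^sup>+x. ennreal_powr (dyadic_operator \<rho> \<theta> \<alpha> w h x) q \<partial>lebesgue) \<le> ennreal ((C * B * c) powr q)"
proof -
  from dyadic_form_bound[OF assms, where \<alpha>=\<alpha> and \<theta>=\<theta>] obtain C where C: "C > 0" and form: "\<forall>w (h :: real^'d \<Rightarrow> real) g B. 0 \<le> B \<longrightarrow>
      (\<forall>z l. l > 0 \<longrightarrow> ennreal (measure lebesgue (cube z l) powr (\<alpha> / real CARD('d) + 1 / q - 1 / p) / psi \<rho> (\<theta> / 3) z l) *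
        orlicz_norm \<Psi> (cube z l) (\<lambda>x. orlicz_norm \<Phi> (cube z l) (w x)) \<le> ennreal B) \<longrightarrow>
      h \<in> borel_measurable lebesgue \<longrightarrow> (\<forall>x. 0 \<le> h x) \<longrightarrow> (\<integral>\<^sup>+x. ennreal (h x powr p) \<partial>lebesgue) \<le> 1 \<longrightarrow>
      g \<in> borel_measurable lebesgue \<longrightarrow> (\<forall>x. 0 \<le> g x) \<longrightarrow> (\<integral>\<^sup>+x. ennreal (g x powr (q / (q - 1))) \<partial>lebesgue) \<le> 1 \<longrightarrow>
      (\<integral>\<^sup>+Q. (\<Sum>e\<in>neighbours. ennreal (dyadic_coeff \<rho> \<theta> \<alpha> Q) *
        (\<integral>\<^sup>+x\<in>dyadic Q. (\<integral>\<^sup>+y\<in>dyadic (shift e Q). w x y * ennreal (h y) \<partial>lebesgue) * ennreal (g x) \<partial>lebesgue)) \<partial>count_space UNIV)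
      \<le> ennreal (C * B)"
    by (elim exE conjE) (rule that)
  have main: "dyadic_operator \<rho> \<theta> \<alpha> w h \<in> borel_measurable lebesgue \<and>
      (\<integral>\<^sup>+x. ennreal_powr (dyadic_operator \<rho> \<theta> \<alpha> w h x) q \<partial>lebesgue) \<le> ennreal ((C * B * c) powr q)"
    if B: "0 \<le> B" and c: "0 < c"
      and bump: "\<forall>z l. l > 0 \<longrightarrow> ennreal (measure lebesgue (cube z l) powr (\<alpha> / real CARD('d) + 1 / q - 1 / p) / psi \<rho> (\<theta> / 3) z l) *
        orlicz_norm \<Psi> (cube z l) (\<lambda>x. orlicz_norm \<Phi> (cube z l) (w x)) \<le> ennreal B"
      and w: "(\<lambda>(x, y). w x y) \<in> borel_measurable (lborel \<Otimes>\<^sub>M lborel)"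
      and h: "h \<in> borel_measurable borel" "\<forall>x. 0 \<le> h x" "(\<integral>\<^sup>+x. ennreal (h x powr p) \<partial>lebesgue) \<le> ennreal (c powr p)"
    for w and h :: "real^'d \<Rightarrow> real" and B c
  proof -
    define J where "J P x = (\<integral>\<^sup>+y\<in>dyadic P. w x y * ennreal (h y) \<partial>lebesgue)" for P x
    have Jm: "J P \<in> borel_measurable lebesgue" for P
    proof -
      have "(\<lambda>(x, y). w x y * ennreal (h y) * indicator (dyadic P) y) \<in> borel_measurable (lborel \<Otimes>\<^sub>M lborel)"
        using w h(1) dyadic_borel[of P] by measurable
      then have "(\<lambda>x. \<integral>\<^sup>+y. w x y * ennreal (h y) * indicator (dyadic P) y \<partial>lborel) \<in> borel_measurable lborel"
        by (rule lborel.borel_measurable_nn_integral)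
      then have "J P \<in> borel_measurable borel" unfolding J_def nn_integral_completion by simp
      then show ?thesis by (intro measurable_completion) simp
    qed
    have op: "dyadic_operator \<rho> \<theta> \<alpha> w h x = (\<integral>\<^sup>+Q. (\<Sum>e\<in>neighbours. indicator (dyadic Q) x * (ennreal (dyadic_coeff \<rho> \<theta> \<alpha> Q) * J (shift e Q) x)) \<partial>count_space UNIV)" for x
      by (simp add: dyadic_operator_def J_def)
    have Gm: "dyadic_operator \<rho> \<theta> \<alpha> w h \<in> borel_measurable lebesgue"
      unfolding op by (intro borel_measurable_nn_integral_count_space borel_measurable_sum borel_measurable_times_ennreal
          borel_measurable_indicator dyadic_sets borel_measurable_const Jm)
    have hm: "h \<in> borel_measurable lebesgue" using h(1) by (intro measurable_completion) simp
    define h1 where "h1 x = h x / c" for x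
    have h1: "h1 \<in> borel_measurable lebesgue" "\<forall>x. 0 \<le> h1 x" unfolding h1_def using hm h(2) c by auto
    have h1_int: "(\<integral>\<^sup>+x. ennreal (h1 x powr p) \<partial>lebesgue) \<le> 1"
    proof -
      have "(\<integral>\<^sup>+x. ennreal (h1 x powr p) \<partial>lebesgue) = (\<integral>\<^sup>+x. ennreal (1 / c powr p) * ennreal (h x powr p) \<partial>lebesgue)"
        using c h(2) by (intro nn_integral_cong) (simp add: h1_def powr_divide ennreal_mult[symmetric])
      also have "\<dots> = ennreal (1 / c powr p) * (\<integral>\<^sup>+x. ennreal (h x powr p) \<partial>lebesgue)"
        using hm by (intro nn_integral_cmult) simp
      also have "\<dots> \<le> ennreal (1 / c powr p) * ennreal (c powr p)" by (intro mult_left_mono h(3)) simp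
      also have "\<dots> = 1" using c by (simp add: ennreal_mult[symmetric])
      finally show ?thesis .
    qed
    have "(\<integral>\<^sup>+x. ennreal_powr (dyadic_operator \<rho> \<theta> \<alpha> w h x) q \<partial>lebesgue) \<le> ennreal ((C * B * c) powr q)"
    proof (rule duality_bound[OF Gm])
      show "1 < q" "0 \<le> C * B * c" using p C B c by auto
      fix g :: "real^'d \<Rightarrow> real"
      assume g: "g \<in> borel_measurable lebesgue" "\<forall>x. 0 \<le> g x" "(\<integral>\<^sup>+x. ennreal (g x powr (q / (q - 1))) \<partial>lebesgue) \<le> 1"
      have hJ: "J P x \<le> ennreal c * (\<integral>\<^sup>+y\<in>dyadic P. w x y * ennreal (h1 y) \<partial>lebesgue)" for P x
      proof -
        have "J P x = (\<integral>\<^sup>+y. ennreal c * (w x y * ennreal (h1 y) * indicator (dyadic P) y) \<partial>lebesgue)"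
          unfolding J_def
        proof (intro nn_integral_cong)
          fix y
          have "ennreal (h y) = ennreal c * ennreal (h1 y)" using c h(2) by (simp add: h1_def ennreal_mult[symmetric])
          then show "w x y * ennreal (h y) * indicator (dyadic P) y = ennreal c * (w x y * ennreal (h1 y) * indicator (dyadic P) y)"
            by (simp only: mult_ac)
        qed
        also have "\<dots> \<le> ennreal c * (\<integral>\<^sup>+y\<in>dyadic P. w x y * ennreal (h1 y) \<partial>lebesgue)"
          by (rule nn_integral_cmult_le[OF c])
        finally show ?thesis .
      qed
      define Z where "Z e Q = (\<integral>\<^sup>+x\<in>dyadic Q. (\<integral>\<^sup>+y\<in>dyadic (shift e Q). w x y * ennreal (h1 y) \<partial>lebesgue) * ennreal (g x) \<partial>lebesgue)" for e Q
      have Jgm: "(\<lambda>x. J (shift e Q) x * (ennreal (g x) * indicator (dyadic Q) x)) \<in> borel_measurable lebesgue" for e Q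
        using g(1) by (intro borel_measurable_times_ennreal Jm borel_measurable_indicator dyadic_sets) simp
      have int: "(\<integral>\<^sup>+x. J (shift e Q) x * (ennreal (g x) * indicator (dyadic Q) x) \<partial>lebesgue) \<le> ennreal c * Z e Q" for e Q
      proof -
        have "(\<integral>\<^sup>+x. J (shift e Q) x * (ennreal (g x) * indicator (dyadic Q) x) \<partial>lebesgue) \<le>
          (\<integral>\<^sup>+x. ennreal c * ((\<integral>\<^sup>+y\<in>dyadic (shift e Q). w x y * ennreal (h1 y) \<partial>lebesgue) * ennreal (g x) * indicator (dyadic Q) x) \<partial>lebesgue)"
        proof (intro nn_integral_mono)
          fix x
          show "J (shift e Q) x * (ennreal (g x) * indicator (dyadic Q) x) \<le>
            ennreal c * ((\<integral>\<^sup>+y\<in>dyadic (shift e Q). w x y * ennreal (h1 y) \<partial>lebesgue) * ennreal (g x) * indicator (dyadic Q) x)"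
            using mult_right_mono[OF hJ[of "shift e Q" x], of "ennreal (g x) * indicator (dyadic Q) x"] by (simp add: mult.assoc)
        qed
        also have "\<dots> \<le> ennreal c * Z e Q" unfolding Z_def by (rule nn_integral_cmult_le[OF c])
        finally show ?thesis .
      qed
      have "(\<integral>\<^sup>+x. dyadic_operator \<rho> \<theta> \<alpha> w h x * ennreal (g x) \<partial>lebesgue) =
        (\<integral>\<^sup>+x. \<integral>\<^sup>+Q. (\<Sum>e\<in>neighbours. ennreal (dyadic_coeff \<rho> \<theta> \<alpha> Q) * (J (shift e Q) x * (ennreal (g x) * indicator (dyadic Q) x))) \<partial>count_space UNIV \<partial>lebesgue)"
      proof (intro nn_integral_cong)
        fix x
        have "dyadic_operator \<rho> \<theta> \<alpha> w h x * ennreal (g x) =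
          (\<integral>\<^sup>+Q. (\<Sum>e\<in>neighbours. indicator (dyadic Q) x * (ennreal (dyadic_coeff \<rho> \<theta> \<alpha> Q) * J (shift e Q) x)) * ennreal (g x) \<partial>count_space UNIV)"
          unfolding op by (rule nn_integral_multc[symmetric]) simp
        also have "\<dots> = (\<integral>\<^sup>+Q. (\<Sum>e\<in>neighbours. ennreal (dyadic_coeff \<rho> \<theta> \<alpha> Q) * (J (shift e Q) x * (ennreal (g x) * indicator (dyadic Q) x))) \<partial>count_space UNIV)"
          by (intro nn_integral_cong, subst sum_distrib_right, intro sum.cong refl, simp only: mult_ac)
        finally show "dyadic_operator \<rho> \<theta> \<alpha> w h x * ennreal (g x) =
          (\<integral>\<^sup>+Q. (\<Sum>e\<in>neighbours. ennreal (dyadic_coeff \<rho> \<theta> \<alpha> Q) * (J (shift e Q) x * (ennreal (g x) * indicator (dyadic Q) x))) \<partial>count_space UNIV)" .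
      qed
      also have "\<dots> = (\<integral>\<^sup>+Q. \<integral>\<^sup>+x. (\<Sum>e\<in>neighbours. ennreal (dyadic_coeff \<rho> \<theta> \<alpha> Q) * (J (shift e Q) x * (ennreal (g x) * indicator (dyadic Q) x))) \<partial>lebesgue \<partial>count_space UNIV)"
        by (intro nn_integral_count_space_nn_integral countableI_type borel_measurable_sum borel_measurable_times_ennreal[OF borel_measurable_const] Jgm)
      also have "\<dots> \<le> (\<integral>\<^sup>+Q. ennreal c * (\<Sum>e\<in>neighbours. ennreal (dyadic_coeff \<rho> \<theta> \<alpha> Q) * Z e Q) \<partial>count_space UNIV)"
      proof (intro nn_integral_mono)
        fix Q
        have "(\<integral>\<^sup>+x. (\<Sum>e\<in>neighbours. ennreal (dyadic_coeff \<rho> \<theta> \<alpha> Q) * (J (shift e Q) x * (ennreal (g x) * indicator (dyadic Q) x))) \<partial>lebesgue) =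
          (\<Sum>e\<in>neighbours. \<integral>\<^sup>+x. ennreal (dyadic_coeff \<rho> \<theta> \<alpha> Q) * (J (shift e Q) x * (ennreal (g x) * indicator (dyadic Q) x)) \<partial>lebesgue)"
          by (intro nn_integral_sum borel_measurable_times_ennreal[OF borel_measurable_const] Jgm)
        also have "\<dots> = (\<Sum>e\<in>neighbours. ennreal (dyadic_coeff \<rho> \<theta> \<alpha> Q) * (\<integral>\<^sup>+x. J (shift e Q) x * (ennreal (g x) * indicator (dyadic Q) x) \<partial>lebesgue))"
          by (intro sum.cong refl nn_integral_cmult Jgm)
        also have "\<dots> \<le> (\<Sum>e\<in>neighbours. ennreal (dyadic_coeff \<rho> \<theta> \<alpha> Q) * (ennreal c * Z e Q))"
          by (intro sum_mono mult_left_mono int) simp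
        also have "\<dots> = ennreal c * (\<Sum>e\<in>neighbours. ennreal (dyadic_coeff \<rho> \<theta> \<alpha> Q) * Z e Q)"
          by (subst sum_distrib_left, intro sum.cong refl, simp only: mult_ac)
        finally show "(\<integral>\<^sup>+x. (\<Sum>e\<in>neighbours. ennreal (dyadic_coeff \<rho> \<theta> \<alpha> Q) * (J (shift e Q) x * (ennreal (g x) * indicator (dyadic Q) x))) \<partial>lebesgue) \<le>
          ennreal c * (\<Sum>e\<in>neighbours. ennreal (dyadic_coeff \<rho> \<theta> \<alpha> Q) * Z e Q)" .
      qed
      also have "\<dots> = ennreal c * (\<integral>\<^sup>+Q. (\<Sum>e\<in>neighbours. ennreal (dyadic_coeff \<rho> \<theta> \<alpha> Q) * Z e Q) \<partial>count_space UNIV)"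
        by (intro nn_integral_cmult) simp
      also have "\<dots> \<le> ennreal c * ennreal (C * B)"
        unfolding Z_def
        by (intro mult_left_mono form[rule_format, OF B bump[rule_format] h1(1) h1(2)[rule_format] h1_int g(1) g(2)[rule_format] g(3)]) simp_all
      also have "\<dots> = ennreal (C * B * c)" using C B c by (simp add: ennreal_mult[symmetric] mult_ac)
      finally show "(\<integral>\<^sup>+x. dyadic_operator \<rho> \<theta> \<alpha> w h x * ennreal (g x) \<partial>lebesgue) \<le> ennreal (C * B * c)" .
    qed
    then show ?thesis using Gm by blast
  qed
  show ?thesis by (rule exI[of _ C], rule conjI, rule C, intro allI impI, rule main)
qed

section \<open>Borel representatives and iterated integrals\<close>

lemma lebesgue_integral_representative:
  fixes f g :: "'a::euclidean_space \<Rightarrow> 'b::euclidean_space"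
  assumes g: "g \<in> borel_measurable borel" and eq: "AE x in lborel. f x = g x"
  shows "f \<in> borel_measurable lebesgue"
    and "integrable lebesgue f \<longleftrightarrow> integrable lborel g"
    and "integral\<^sup>L lebesgue f = integral\<^sup>L lborel g"
proof -
  have gl: "g \<in> borel_measurable lborel" using g by simp
  then have gm: "g \<in> borel_measurable lebesgue" by (rule measurable_completion)
  have ae: "AE x in lebesgue. f x = g x" by (rule AE_completion[OF eq])
  show fm: "f \<in> borel_measurable lebesgue"
    by (rule borel_measurable_AE[OF gm]) (use ae in \<open>auto elim: eventually_mono\<close>)
  have "integrable lebesgue f \<longleftrightarrow> integrable lebesgue g" by (rule integrable_cong_AE[OF fm gm ae])
  then show "integrable lebesgue f \<longleftrightarrow> integrable lborel g" using integrable_completion[OF gl] by simp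
  have "integral\<^sup>L lebesgue f = integral\<^sup>L lebesgue g" by (rule integral_cong_AE[OF fm gm ae])
  then show "integral\<^sup>L lebesgue f = integral\<^sup>L lborel g" using integral_completion[OF gl] by simp
qed

lemma norm_vector_smult: "norm (c *s v) = norm c * norm v" for v :: "complex^'n"
  by (simp add: norm_vec_def norm_mult L2_set_right_distrib)

lemma matrix_vector_smult: "A *v (c *s v) = c *s (A *v v)" for A :: "complex^'n^'n"
  by (simp add: vec_eq_iff matrix_vector_mult_def sum_distrib_left mult_ac)

lemma borel_measurable_matrix_vector:
  fixes A :: "'a \<Rightarrow> complex^'n^'n" and v :: "'a \<Rightarrow> complex^'n"
  assumes "A \<in> borel_measurable M" "v \<in> borel_measurable M"
  shows "(\<lambda>x. A x *v v x) \<in> borel_measurable M"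
  unfolding matrix_vector_mult_def
  by (intro borel_measurable_vecI, simp)
     (intro borel_measurable_sum borel_measurable_times borel_measurable_vec_nth assms)

text \<open>Here \<kappa> is the kernel at a fixed x and the primed functions are Borel
  representatives. Absolute convergence for |f| yields vector-valued Bochner integrals in y and then
  in t; a matrix \<open>A\<close> may be moved through both, which gives the third claim for every
  \<open>A\<close>.\<close>

lemma iterated_integral_bounds:
  fixes \<kappa> \<kappa>' :: "real \<Rightarrow> 'a::euclidean_space \<Rightarrow> complex" and f f' :: "'a \<Rightarrow> complex^'n"
    and A :: "complex^'n^'n" and \<beta> :: real
  assumes \<kappa>': "(\<lambda>(t, y). \<kappa>' t y) \<in> borel_measurable (lborel \<Otimes>\<^sub>M lborel)"
    and \<kappa>: "AE t in lborel. t > 0 \<longrightarrow> (AE y in lborel. \<kappa> t y = \<kappa>' t y)"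
    and f': "f' \<in> borel_measurable borel" and f: "AE y in lborel. f y = f' y"
    and fin: "(\<integral>\<^sup>+t\<in>{0<..}. (\<integral>\<^sup>+y. ennreal (norm (\<kappa> t y) * t powr \<beta>) * ennreal (norm (f y)) \<partial>lebesgue) \<partial>lebesgue) < \<infinity>"
  shows "AE t in lebesgue. t > 0 \<longrightarrow> integrable lebesgue (\<lambda>y. \<kappa> t y * f y $ i)"
    and "set_integrable lebesgue {0<..} (\<lambda>t. (LINT y|lebesgue. \<kappa> t y * f y $ i) * complex_of_real (t powr \<beta>))"
    and "ennreal (norm (A *v (\<chi> i. LINT t:{0<..}|lebesgue. (LINT y|lebesgue. \<kappa> t y * f y $ i) * complex_of_real (t powr \<beta>)))) \<le>
      (\<integral>\<^sup>+t\<in>{0<..}. (\<integral>\<^sup>+y. ennreal (norm (\<kappa> t y) * t powr \<beta>) * ennreal (norm (A *v f y)) \<partial>lebesgue) \<partial>lebesgue)"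
proof -
  define g where "g t y = \<kappa>' t y *s f' y" for t y
  define H where "H t = (LINT y|lborel. g t y)" for t
  define E where "E A t = (\<integral>\<^sup>+y. ennreal (norm (A *v g t y)) \<partial>lborel)" for A :: "complex^'n^'n" and t
  have g_joint: "(\<lambda>(t, y). g t y) \<in> borel_measurable (lborel \<Otimes>\<^sub>M lborel)"
  proof (rule borel_measurable_vecI)
    fix j
    have "(\<lambda>z. f' (snd z) $ j) \<in> borel_measurable (lborel \<Otimes>\<^sub>M lborel :: (real \<times> 'a) measure)"
      using f' by (intro borel_measurable_vec_nth measurable_compose[OF measurable_snd]) simp
    then have "(\<lambda>z. (case z of (t, y) \<Rightarrow> \<kappa>' t y) * f' (snd z) $ j) \<in> borel_measurable (lborel \<Otimes>\<^sub>M lborel)"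
      using \<kappa>' by (intro borel_measurable_times)
    then show "(\<lambda>z. (case z of (t, y) \<Rightarrow> g t y) $ j) \<in> borel_measurable (lborel \<Otimes>\<^sub>M lborel)"
      by (simp add: g_def case_prod_unfold)
  qed
  have g_t: "g t \<in> borel_measurable lborel" for t
    using measurable_compose[OF measurable_Pair1'[of t lborel lborel] g_joint] by simp
  have H_meas: "H \<in> borel_measurable lborel"
    unfolding H_def using g_joint by (intro lborel.borel_measurable_lebesgue_integral) simp
  have E_meas: "E A \<in> borel_measurable lborel" for A
  proof -
    have "(\<lambda>z. A *v (case z of (t, y) \<Rightarrow> g t y)) \<in> borel_measurable (lborel \<Otimes>\<^sub>M lborel)"
      by (rule borel_measurable_matrix_vector[OF borel_measurable_const g_joint])
    then have "(\<lambda>z. ennreal (norm (A *v (case z of (t, y) \<Rightarrow> g t y)))) \<in> borel_measurable (lborel \<Otimes>\<^sub>M lborel)"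
      by measurable
    then have "(\<lambda>(t, y). ennreal (norm (A *v g t y))) \<in> borel_measurable (lborel \<Otimes>\<^sub>M lborel)"
      by (simp add: case_prod_unfold)
    then show ?thesis unfolding E_def by (intro lborel.borel_measurable_nn_integral)
  qed
  have inner: "(\<integral>\<^sup>+y. ennreal (norm (\<kappa> t y) * t powr \<beta>) * ennreal (norm (A *v f y)) \<partial>lebesgue) = ennreal (t powr \<beta>) * E A t"
    if t: "AE y in lborel. \<kappa> t y = \<kappa>' t y" for A t
  proof -
    have "(\<integral>\<^sup>+y. ennreal (norm (\<kappa> t y) * t powr \<beta>) * ennreal (norm (A *v f y)) \<partial>lebesgue) =
      (\<integral>\<^sup>+y. ennreal (norm (\<kappa> t y) * t powr \<beta>) * ennreal (norm (A *v f y)) \<partial>lborel)" by (rule nn_integral_completion)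
    also have "\<dots> = (\<integral>\<^sup>+y. ennreal (t powr \<beta>) * ennreal (norm (A *v g t y)) \<partial>lborel)"
      using t f
    proof (intro nn_integral_cong_AE, eventually_elim)
      case (elim y)
      then show ?case by (simp add: g_def matrix_vector_smult norm_vector_smult ennreal_mult[symmetric] mult_ac)
    qed
    also have "\<dots> = ennreal (t powr \<beta>) * E A t"
    proof -
      have "(\<lambda>y. A *v g t y) \<in> borel_measurable lborel"
        by (rule borel_measurable_matrix_vector[OF borel_measurable_const g_t])
      then have "(\<lambda>y. ennreal (norm (A *v g t y))) \<in> borel_measurable lborel" by measurable
      then show ?thesis unfolding E_def by (rule nn_integral_cmult)
    qed
    finally show ?thesis .
  qed
  have outer: "(\<integral>\<^sup>+t\<in>{0<..}. (\<integral>\<^sup>+y. ennreal (norm (\<kappa> t y) * t powr \<beta>) * ennreal (norm (A *v f y)) \<partial>lebesgue) \<partial>lebesgue) =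
    (\<integral>\<^sup>+t. indicator {0<..} t * (ennreal (t powr \<beta>) * E A t) \<partial>lborel)" for A
  proof -
    have "(\<integral>\<^sup>+t\<in>{0<..}. (\<integral>\<^sup>+y. ennreal (norm (\<kappa> t y) * t powr \<beta>) * ennreal (norm (A *v f y)) \<partial>lebesgue) \<partial>lebesgue) =
      (\<integral>\<^sup>+t\<in>{0<..}. (\<integral>\<^sup>+y. ennreal (norm (\<kappa> t y) * t powr \<beta>) * ennreal (norm (A *v f y)) \<partial>lebesgue) \<partial>lborel)"
      by (rule nn_integral_completion)
    also have "\<dots> = (\<integral>\<^sup>+t. indicator {0<..} t * (ennreal (t powr \<beta>) * E A t) \<partial>lborel)"
      using \<kappa>
    proof (intro nn_integral_cong_AE, eventually_elim)
      case (elim t)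
      then show ?case using inner[of t A] by (cases "t > 0") (simp_all add: mult.commute)
    qed
    finally show ?thesis .
  qed
  \<comment> \<open>The hypothesis is the case of the identity matrix.\<close>
  have fin1: "(\<integral>\<^sup>+t. indicator {0<..} t * (ennreal (t powr \<beta>) * E (mat 1) t) \<partial>lborel) < \<infinity>"
    using fin outer[of "mat 1"] by simp
  have "AE t in lborel. indicator {0<..} t * (ennreal (t powr \<beta>) * E (mat 1) t) \<noteq> \<infinity>"
    using fin1 E_meas[of "mat 1"] by (intro nn_integral_PInf_AE) auto
  then have g_int: "AE t in lborel. t > 0 \<longrightarrow> integrable lborel (g t)"
  proof eventually_elim
    case (elim t)
    show ?case
    proof
      assume t: "t > 0"
      then have "ennreal (t powr \<beta>) * E (mat 1) t \<noteq> \<infinity>" using elim by simp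
      then have "E (mat 1) t < \<infinity>" using t by (auto simp: ennreal_mult_eq_top_iff less_top)
      then show "integrable lborel (g t)" unfolding E_def using g_t[of t] by (intro integrableI_bounded) auto
    qed
  qed
  have comp: "integrable lebesgue (\<lambda>y. \<kappa> t y * f y $ i) \<and> (LINT y|lebesgue. \<kappa> t y * f y $ i) = H t $ i"
    if t: "AE y in lborel. \<kappa> t y = \<kappa>' t y" and int: "integrable lborel (g t)" for t i
  proof -
    have m: "(\<lambda>y. g t y $ i) \<in> borel_measurable borel" using g_t[of t] by (intro borel_measurable_vec_nth) simp
    have ae: "AE y in lborel. \<kappa> t y * f y $ i = g t y $ i" using t f by eventually_elim (simp add: g_def)
    have "integrable lborel (\<lambda>y. g t y $ i)" by (rule integrable_bounded_linear[OF bounded_linear_vec_nth int])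
    moreover have "(LINT y|lborel. g t y $ i) = H t $ i"
      unfolding H_def by (rule integral_bounded_linear[OF bounded_linear_vec_nth int])
    ultimately show ?thesis using lebesgue_integral_representative(2,3)[OF m ae] by simp
  qed
  have "AE t in lborel. t > 0 \<longrightarrow> integrable lebesgue (\<lambda>y. \<kappa> t y * f y $ i)" for i
    using \<kappa> g_int by eventually_elim (use comp in auto)
  then show "AE t in lebesgue. t > 0 \<longrightarrow> integrable lebesgue (\<lambda>y. \<kappa> t y * f y $ i)"
    by (rule AE_completion)
  define F where "F t = (indicator {0<..} t * t powr \<beta>) *\<^sub>R H t" for t :: real
  have F_meas: "F \<in> borel_measurable lborel" unfolding F_def using H_meas by measurable
  have AF_le: "AE t in lborel. ennreal (norm (A *v F t)) \<le> indicator {0<..} t * (ennreal (t powr \<beta>) * E A t)" for A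
    using g_int
  proof eventually_elim
    case (elim t)
    show ?case
    proof (cases "t > 0")
      case True
      have bl: "bounded_linear ((*v) A)" by (rule bounded_linear_matrix_vector)
      have int: "integrable lborel (\<lambda>y. A *v g t y)" using integrable_bounded_linear[OF bl] elim True by blast
      have "A *v H t = (LINT y|lborel. A *v g t y)" unfolding H_def using integral_bounded_linear[OF bl] elim True by metis
      then have "ennreal (norm (A *v H t)) \<le> E A t" unfolding E_def using integral_norm_bound_ennreal[OF int] by simp
      then have "ennreal (t powr \<beta>) * ennreal (norm (A *v H t)) \<le> ennreal (t powr \<beta>) * E A t" by (rule mult_left_mono) simp
      moreover have "A *v F t = (t powr \<beta>) *\<^sub>R (A *v H t)"
        using True linear_cmul[OF bounded_linear.linear[OF bl]] by (simp add: F_def)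
      ultimately show ?thesis using True by (simp add: ennreal_mult[symmetric])
    qed (simp add: F_def)
  qed
  have F_int: "integrable lborel F"
  proof (rule integrableI_bounded[OF F_meas])
    have "(\<integral>\<^sup>+t. ennreal (norm (F t)) \<partial>lborel) \<le> (\<integral>\<^sup>+t. indicator {0<..} t * (ennreal (t powr \<beta>) * E (mat 1) t) \<partial>lborel)"
      using AF_le[of "mat 1"] by (intro nn_integral_mono_AE) simp
    then show "(\<integral>\<^sup>+t. ennreal (norm (F t)) \<partial>lborel) < \<infinity>" using fin1 by (rule le_less_trans)
  qed
  have F_comp: "integrable lebesgue (\<lambda>t. indicator {0<..} t *\<^sub>R ((LINT y|lebesgue. \<kappa> t y * f y $ i) * complex_of_real (t powr \<beta>))) \<and>
    (LINT t|lebesgue. indicator {0<..} t *\<^sub>R ((LINT y|lebesgue. \<kappa> t y * f y $ i) * complex_of_real (t powr \<beta>))) = (LINT t|lborel. F t) $ i" for i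
  proof -
    have m: "(\<lambda>t. F t $ i) \<in> borel_measurable borel" using F_meas by (intro borel_measurable_vec_nth) simp
    have ae: "AE t in lborel. indicator {0<..} t *\<^sub>R ((LINT y|lebesgue. \<kappa> t y * f y $ i) * complex_of_real (t powr \<beta>)) = F t $ i"
      using \<kappa> g_int
    proof eventually_elim
      case (elim t)
      show ?case
      proof (cases "t > 0")
        case True
        then have "(LINT y|lebesgue. \<kappa> t y * f y $ i) = H t $ i" using comp elim by blast
        then show ?thesis using True by (simp add: F_def scaleR_conv_of_real[where 'a=complex] mult.commute)
      qed (simp add: F_def)
    qed
    show ?thesis
      using lebesgue_integral_representative(2,3)[OF m ae] integrable_bounded_linear[OF bounded_linear_vec_nth F_int, of i]
        integral_bounded_linear[OF bounded_linear_vec_nth F_int, of i] by simp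
  qed
  then show "set_integrable lebesgue {0<..} (\<lambda>t. (LINT y|lebesgue. \<kappa> t y * f y $ i) * complex_of_real (t powr \<beta>))"
    by (simp add: set_integrable_def)
  have "(\<chi> i. LINT t:{0<..}|lebesgue. (LINT y|lebesgue. \<kappa> t y * f y $ i) * complex_of_real (t powr \<beta>)) = (LINT t|lborel. F t)"
    unfolding vec_eq_iff set_lebesgue_integral_def using F_comp by simp
  then have "A *v (\<chi> i. LINT t:{0<..}|lebesgue. (LINT y|lebesgue. \<kappa> t y * f y $ i) * complex_of_real (t powr \<beta>)) = (LINT t|lborel. A *v F t)"
    using integral_bounded_linear[OF bounded_linear_matrix_vector F_int, of A] by simp
  moreover have "integrable lborel (\<lambda>t. A *v F t)" by (rule integrable_bounded_linear[OF bounded_linear_matrix_vector F_int])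
  ultimately have "ennreal (norm (A *v (\<chi> i. LINT t:{0<..}|lebesgue. (LINT y|lebesgue. \<kappa> t y * f y $ i) * complex_of_real (t powr \<beta>)))) \<le>
      (\<integral>\<^sup>+t. ennreal (norm (A *v F t)) \<partial>lborel)"
    using integral_norm_bound_ennreal by simp
  also have "\<dots> \<le> (\<integral>\<^sup>+t. indicator {0<..} t * (ennreal (t powr \<beta>) * E A t) \<partial>lborel)"
    by (intro nn_integral_mono_AE AF_le)
  also note outer[symmetric]
  finally show "ennreal (norm (A *v (\<chi> i. LINT t:{0<..}|lebesgue. (LINT y|lebesgue. \<kappa> t y * f y $ i) * complex_of_real (t powr \<beta>)))) \<le>
      (\<integral>\<^sup>+t\<in>{0<..}. (\<integral>\<^sup>+y. ennreal (norm (\<kappa> t y) * t powr \<beta>) * ennreal (norm (A *v f y)) \<partial>lebesgue) \<partial>lebesgue)" .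
qed

text \<open>The null set where the two kernels differ is sliced by Tonelli, with x moved to the
  outermost place, because the iterated integrals are formed at a fixed x. Before a representative
  is chosen the kernel is extended by 0 to t \<le> 0.\<close>

lemma kernel_borel_representative:
  fixes k :: "real \<Rightarrow> 'a::euclidean_space \<Rightarrow> 'a \<Rightarrow> complex"
  assumes "(\<lambda>(t, x, y). k t x y) \<in> borel_measurable (lebesgue_on ({0<..} \<times> UNIV))"
  shows "\<exists>k'. (\<lambda>(t, x, y). k' t x y) \<in> borel_measurable borel \<and>
    (AE x in lborel. AE t in lborel. t > 0 \<longrightarrow> (AE y in lborel. k t x y = k' t x y))"
proof -
  define S :: "(real \<times> 'a \<times> 'a) set" where "S = {0<..} \<times> UNIV"
  have "open S" unfolding S_def by (intro open_Times) auto
  then have "S \<in> sets lebesgue" by (intro sets_completionI_sets) simp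
  then have "(\<lambda>z. if z \<in> S then (case z of (t, x, y) \<Rightarrow> k t x y) else 0) \<in> borel_measurable lebesgue"
    using assms unfolding S_def[symmetric] by (intro borel_measurable_if_I)
  then obtain k0 where k0: "k0 \<in> borel_measurable borel"
    "AE z in lborel. (if z \<in> S then (case z of (t, x, y) \<Rightarrow> k t x y) else 0) = k0 z"
    using lebesgue_measurable_borel_representative by blast
  obtain N where N: "{z \<in> space lborel. \<not> (if z \<in> S then (case z of (t, x, y) \<Rightarrow> k t x y) else 0) = k0 z} \<subseteq> N"
    "emeasure lborel N = 0" "N \<in> sets lborel"
    using AE_E[OF k0(2)] by blast
  have pair3: "(lborel :: (real \<times> 'a \<times> 'a) measure) = lborel \<Otimes>\<^sub>M (lborel \<Otimes>\<^sub>M lborel)"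
    by (simp add: lborel_prod)
  have Nm: "(\<lambda>z. indicator N z :: ennreal) \<in> borel_measurable (lborel \<Otimes>\<^sub>M (lborel \<Otimes>\<^sub>M lborel))"
    using N(3) unfolding pair3[symmetric] by (rule borel_measurable_indicator)
  define I where "I t x = (\<integral>\<^sup>+y. indicator N (t, x, y) \<partial>lborel :: ennreal)" for t x
  have N_txy: "(\<lambda>z. indicator N (fst (fst z), snd (fst z), snd z) :: ennreal) \<in> borel_measurable ((lborel \<Otimes>\<^sub>M lborel) \<Otimes>\<^sub>M lborel)"
    by (rule measurable_compose[OF _ Nm]) measurable
  have I_meas: "(\<lambda>(t, x). I t x) \<in> borel_measurable (lborel \<Otimes>\<^sub>M lborel)"
    using lborel.borel_measurable_nn_integral[of "\<lambda>p y. indicator N (fst p, snd p, y)" "lborel \<Otimes>\<^sub>M lborel"] N_txy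
    unfolding I_def by (simp add: case_prod_unfold)
  have "0 = (\<integral>\<^sup>+z. indicator N z \<partial>lborel)" using N by simp
  also have "\<dots> = (\<integral>\<^sup>+z. indicator N z \<partial>(lborel \<Otimes>\<^sub>M (lborel \<Otimes>\<^sub>M lborel)))" unfolding pair3 ..
  also have "\<dots> = (\<integral>\<^sup>+t. \<integral>\<^sup>+w. indicator N (t, w) \<partial>(lborel \<Otimes>\<^sub>M lborel) \<partial>lborel)"
    by (rule sigma_finite_measure.nn_integral_fst[symmetric, OF _ Nm]) (simp add: lborel_prod lborel.sigma_finite_measure_axioms)
  also have "\<dots> = (\<integral>\<^sup>+t. \<integral>\<^sup>+x. I t x \<partial>lborel \<partial>lborel)"
  proof (intro nn_integral_cong)
    fix t
    have "(\<lambda>w. indicator N (t, w) :: ennreal) \<in> borel_measurable (lborel \<Otimes>\<^sub>M lborel)"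
      using measurable_compose[OF measurable_Pair1' Nm, of t] by simp
    from lborel.nn_integral_fst[OF this, symmetric]
    show "(\<integral>\<^sup>+w. indicator N (t, w) \<partial>(lborel \<Otimes>\<^sub>M lborel)) = (\<integral>\<^sup>+x. I t x \<partial>lborel)" by (simp add: I_def)
  qed
  also have "\<dots> = (\<integral>\<^sup>+x. \<integral>\<^sup>+t. I t x \<partial>lborel \<partial>lborel)"
    using lborel_pair.Fubini'[OF I_meas] by simp
  finally have zero: "(\<integral>\<^sup>+x. \<integral>\<^sup>+t. I t x \<partial>lborel \<partial>lborel) = 0" by simp
  have I_swap: "(\<lambda>(x, t). I t x) \<in> borel_measurable (lborel \<Otimes>\<^sub>M lborel)"
    using measurable_compose[OF measurable_pair_swap' I_meas] by (simp add: case_prod_unfold)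
  have "AE x in lborel. (\<integral>\<^sup>+t. I t x \<partial>lborel) = 0"
    using zero lborel.borel_measurable_nn_integral[OF I_swap] by (subst (asm) nn_integral_0_iff_AE) auto
  then have "AE x in lborel. AE t in lborel. t > 0 \<longrightarrow> (AE y in lborel. k t x y = k0 (t, x, y))"
  proof eventually_elim
    case (elim x)
    have "(\<lambda>t. I t x) \<in> borel_measurable lborel"
      using measurable_compose[OF measurable_Pair2' I_meas, of x] by simp
    then have "AE t in lborel. I t x = 0" using elim by (simp add: nn_integral_0_iff_AE)
    then show ?case
    proof eventually_elim
      case (elim t)
      have "(\<lambda>y. indicator N (t, x, y) :: ennreal) \<in> borel_measurable lborel"
        using measurable_compose[OF measurable_Pair1' N_txy, of "(t, x)"] by (simp add: space_pair_measure)
      then have "AE y in lborel. indicator N (t, x, y) = (0 :: ennreal)" using elim by (simp add: I_def nn_integral_0_iff_AE)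
      then have "AE y in lborel. t > 0 \<longrightarrow> k t x y = k0 (t, x, y)"
      proof eventually_elim
        case (elim y)
        then have "(t, x, y) \<notin> N" by (simp add: indicator_def split: if_splits)
        moreover have "(if z \<in> S then (case z of (t, x, y) \<Rightarrow> k t x y) else 0) = k0 z" if "z \<notin> N" for z
          using N(1) that unfolding space_lborel space_borel by blast
        ultimately have "(if (t, x, y) \<in> S then k t x y else 0) = k0 (t, x, y)" by fastforce
        then show ?case by (auto simp: S_def)
      qed
      then show ?case by (auto elim: eventually_mono)
    qed
  qed
  then show ?thesis using k0(1) by (intro exI[of _ "\<lambda>t x y. k0 (t, x, y)"]) (simp add: case_prod_unfold)
qed

text \<open>Parameter integrals of Borel functions are Borel, and for almost every x the two
  iterated integrals agree. Where an integral diverges, both versions take the default value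
  0.\<close>

lemma iterated_integral_measurable:
  fixes k k' :: "real \<Rightarrow> 'a::euclidean_space \<Rightarrow> 'a \<Rightarrow> complex" and f f' :: "'a \<Rightarrow> complex"
  assumes k': "(\<lambda>(t, x, y). k' t x y) \<in> borel_measurable borel"
    and k: "AE x in lborel. AE t in lborel. t > 0 \<longrightarrow> (AE y in lborel. k t x y = k' t x y)"
    and f': "f' \<in> borel_measurable borel" and f: "AE y in lborel. f y = f' y"
  shows "(\<lambda>x. LINT t:{0<..}|lebesgue. (LINT y|lebesgue. k t x y * f y) * complex_of_real (t powr \<beta>)) \<in> borel_measurable lebesgue"
proof -
  define h where "h x t = indicator {0<..} t *\<^sub>R ((LINT y|lborel. k' t x y * f' y) * complex_of_real (t powr \<beta>))" for x t
  have k3: "(\<lambda>z. k' (fst z) (fst (snd z)) (snd (snd z))) \<in> borel_measurable borel"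
    using k' by (simp add: case_prod_unfold)
  have perm: "(\<lambda>((x, t), y). k' t x y) \<in> borel_measurable ((lborel \<Otimes>\<^sub>M lborel) \<Otimes>\<^sub>M lborel)"
  proof -
    have "(\<lambda>z. (snd (fst z), fst (fst z), snd z)) \<in> ((lborel \<Otimes>\<^sub>M lborel) \<Otimes>\<^sub>M lborel) \<rightarrow>\<^sub>M (borel :: (real \<times> 'a \<times> 'a) measure)"
      unfolding borel_prod[symmetric] by measurable
    from measurable_compose[OF this k3] show ?thesis by (simp add: case_prod_unfold)
  qed
  have inner: "(\<lambda>(x, t). LINT y|lborel. k' t x y * f' y) \<in> borel_measurable (lborel \<Otimes>\<^sub>M lborel)"
  proof -
    have "(\<lambda>(z, y). (case z of (x, t) \<Rightarrow> k' t x y) * f' y) \<in> borel_measurable ((lborel \<Otimes>\<^sub>M lborel) \<Otimes>\<^sub>M lborel)"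
      using perm f' by (simp add: case_prod_unfold)
    from lborel.borel_measurable_lebesgue_integral[OF this] show ?thesis by (simp add: case_prod_unfold)
  qed
  have h_joint: "(\<lambda>(x, t). h x t) \<in> borel_measurable (lborel \<Otimes>\<^sub>M lborel)"
    unfolding h_def using inner by (simp add: case_prod_unfold)
  have h_x: "h x \<in> borel_measurable borel" for x
    using measurable_compose[OF measurable_Pair1' h_joint, of x] by simp
  have "(\<lambda>x. LINT t|lborel. h x t) \<in> borel_measurable borel"
    using lborel.borel_measurable_lebesgue_integral[OF h_joint] by simp
  moreover have "AE x in lborel. (LINT t:{0<..}|lebesgue. (LINT y|lebesgue. k t x y * f y) * complex_of_real (t powr \<beta>)) = (LINT t|lborel. h x t)"
    using k
  proof eventually_elim
    case (elim x)
    have "AE t in lborel. indicator {0<..} t *\<^sub>R ((LINT y|lebesgue. k t x y * f y) * complex_of_real (t powr \<beta>)) = h x t"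
      using elim
    proof eventually_elim
      case (elim t)
      show ?case
      proof (cases "t > 0")
        case True
        have "(\<lambda>y. k' t x y) \<in> borel_measurable borel"
          using measurable_compose[OF measurable_Pair1' perm, of "(x, t)"] by (simp add: space_pair_measure)
        then have m: "(\<lambda>y. k' t x y * f' y) \<in> borel_measurable borel" using f' by simp
        have "AE y in lborel. k t x y * f y = k' t x y * f' y" using elim True f by (auto elim: eventually_elim2)
        from lebesgue_integral_representative(3)[OF m this] show ?thesis by (simp add: h_def)
      qed (simp add: h_def)
    qed
    from lebesgue_integral_representative(3)[OF h_x this] show ?case by (simp add: set_lebesgue_integral_def)
  qed
  ultimately show ?thesis by (rule lebesgue_integral_representative(1))
qed

section \<open>The two weight inequality\<close>

lemma ennreal_powr_le:
  assumes "z \<le> ennreal (K powr q)" "0 \<le> K" "0 < q"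
  shows "ennreal_powr z (1 / q) \<le> ennreal K"
proof -
  have "z \<noteq> \<infinity>" using assms(1) by (auto simp: top_unique)
  then obtain r where r: "z = ennreal r" "r \<ge> 0" by (cases z) auto
  then have "r powr (1 / q) \<le> (K powr q) powr (1 / q)" using assms by (intro powr_mono2) auto
  also have "\<dots> = K" using assms by (simp add: powr_powr)
  finally show ?thesis using r by (simp add: ennreal_powr_def ennreal_leI)
qed

lemma ennreal_powr_less_imp_le:
  assumes "ennreal_powr z (1 / q) < ennreal c" "0 < q"
  shows "z \<le> ennreal (c powr q)"
proof -
  have "z \<noteq> \<infinity>" using assms by (auto simp: ennreal_powr_def)
  then obtain r where r: "z = ennreal r" "r \<ge> 0" by (cases z) auto
  then have "r powr (1 / q) < c" using assms by (simp add: ennreal_powr_def ennreal_less_iff)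
  then have "(r powr (1 / q)) powr q \<le> c powr q" using assms by (intro powr_mono2) auto
  then show ?thesis using r assms by (simp add: powr_powr ennreal_leI)
qed

lemma ennreal_powr_cmult:
  assumes "0 < K" "0 < q"
  shows "ennreal_powr (ennreal K * z) q = ennreal (K powr q) * ennreal_powr z q"
proof (cases z)
  case (real r)
  then show ?thesis using assms by (simp add: ennreal_powr_def ennreal_mult[symmetric] powr_mult)
next
  case top
  then show ?thesis using assms by (simp add: ennreal_powr_def ennreal_mult_top)
qed

lemma ennreal_powr_mono:
  assumes "ennreal a \<le> z" "0 \<le> a" "0 < q"
  shows "ennreal (a powr q) \<le> ennreal_powr z q"
proof (cases z)
  case (real r)
  then show ?thesis using assms by (simp add: ennreal_powr_def powr_mono2)
qed (simp add: ennreal_powr_def)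

text \<open>Orlicz norms ignore null sets. The change from V to its representative is made for an
  arbitrary left factor \<open>B\<close>, so the inner norms agree at every x before
  \<open>u\<close> is replaced almost everywhere.\<close>

lemma bump_const_representative:
  fixes U V u v :: "real^'d \<Rightarrow> complex^'n^'n"
  assumes u: "AE x in lborel. u x = mpow (U x) (1 / q)" and v: "AE y in lborel. v y = mpow (V y) (- 1 / q)" and l: "l > 0"
  shows "ennreal (measure lebesgue (cube z l) powr (\<alpha> / real CARD('d) + 1 / q - 1 / p) / psi \<rho> (\<theta> / 3) z l) *
        orlicz_norm \<Psi> (cube z l) (\<lambda>x. orlicz_norm \<Phi> (cube z l) (\<lambda>y. ennreal (op_norm (u x ** v y)))) \<le>
      bump_const \<rho> p q \<alpha> \<theta> \<Phi> \<Psi> U V"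
proof -
  have inner: "orlicz_norm \<Phi> (cube z l) (\<lambda>y. ennreal (op_norm (B ** v y))) =
      orlicz_norm \<Phi> (cube z l) (\<lambda>y. ennreal (op_norm (B ** mpow (V y) (- 1 / q))))" for B
    using AE_completion[OF v] by (intro orlicz_norm_cong_AE) (auto elim: eventually_mono)
  have "orlicz_norm \<Psi> (cube z l) (\<lambda>x. orlicz_norm \<Phi> (cube z l) (\<lambda>y. ennreal (op_norm (u x ** v y)))) =
    orlicz_norm \<Psi> (cube z l) (\<lambda>x. orlicz_norm \<Phi> (cube z l) (\<lambda>y. ennreal (op_norm (mpow (U x) (1 / q) ** mpow (V y) (- 1 / q)))))"
    unfolding inner using AE_completion[OF u] by (intro orlicz_norm_cong_AE) (auto elim: eventually_mono)
  then show ?thesis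
    unfolding bump_const_def using l by (intro SUP_upper2[of "(z, l)"]) auto
qed

text \<open>Convergence and membership in the target space belong to the conclusion: a divergent
  integral has the value 0, for which a norm bound alone would say nothing.\<close>

theorem theorem1p9:
  fixes \<rho> :: "real^'d \<Rightarrow> real"
    and L :: "(real^'d) L2op"
    and T :: "real \<Rightarrow> (real^'d \<Rightarrow> complex) \<Rightarrow> (real^'d \<Rightarrow> complex)"
    and k :: "real \<Rightarrow> real^'d \<Rightarrow> real^'d \<Rightarrow> complex"
    and \<Phi> \<Psi> :: "real \<Rightarrow> real"
    and \<theta> \<alpha> p q s :: real
  assumes "critical_radius \<rho>"
    and "selfadjoint_op L" and "nonneg_op L"
    and "exp_semigroup L T" and "semigroup_kernel T k"
    and "gaussian_bounds \<rho> k"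
    and "0 \<le> \<theta>" and "0 < \<alpha>" and "\<alpha> < real CARD('d)"
    and "p < q" and "1 < p" and "p \<le> s" and "s \<le> q"
    and "young_function \<Phi>" and "young_function \<Psi>"
    and "complementary \<Phi> \<in> B_class p s"
    and "complementary \<Psi> \<in> B_class (q / (q - 1)) (s / (s - 1))"
  shows "\<exists>C::real. C > 0 \<and>
    (\<forall>U V :: real^'d \<Rightarrow> complex^'n^'n.
       matrix_weight U \<and> matrix_weight V \<and> bump_const \<rho> p q \<alpha> \<theta> \<Phi> \<Psi> U V < \<infinity> \<longrightarrow>
       (\<forall>f \<in> weighted_space p (\<lambda>x. mpow (V x) (p / q)).
          frac_power_converges k \<alpha> f \<and>
          frac_power k \<alpha> f \<in> weighted_space q U \<and>
          weighted_norm q U (frac_power k \<alpha> f)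
            \<le> ennreal C * bump_const \<rho> p q \<alpha> \<theta> \<Phi> \<Psi> U V *
               weighted_norm p (\<lambda>x. mpow (V x) (p / q)) f))"
proof -
  have q: "1 < q" "0 < p" "0 < q" "s \<le> q" using assms by auto
  define \<beta> where "\<beta> = \<alpha> / 2 - 1"
  obtain Ck where Ck: "Ck > 0" and kernel: "\<forall>x F. F \<in> borel_measurable lebesgue \<longrightarrow>
    (\<integral>\<^sup>+t\<in>{0<..}. (\<integral>\<^sup>+y. ennreal (norm (k t x y) * t powr \<beta>) * F y \<partial>lebesgue) \<partial>lebesgue) \<le>
    ennreal Ck * (\<integral>\<^sup>+Q. (\<Sum>e\<in>neighbours. indicator (dyadic Q) x *
      (ennreal (dyadic_coeff \<rho> \<theta> \<alpha> Q) * (\<integral>\<^sup>+y\<in>dyadic (shift e Q). F y \<partial>lebesgue))) \<partial>count_space UNIV)"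
    using kernel_integral_le_dyadic_sum[OF assms(1,6,9,7), folded \<beta>_def] by (elim exE conjE) (rule that)
  from dyadic_operator_strong_type[OF assms(1,11-13,10,14-17), where \<alpha>=\<alpha> and \<theta>=\<theta>]
  obtain C where C: "C > 0" and strong: "\<forall>w (h :: real^'d \<Rightarrow> real) B c. 0 \<le> B \<longrightarrow> 0 < c \<longrightarrow>
      (\<forall>z l. l > 0 \<longrightarrow> ennreal (measure lebesgue (cube z l) powr (\<alpha> / real CARD('d) + 1 / q - 1 / p) / psi \<rho> (\<theta> / 3) z l) *
        orlicz_norm \<Psi> (cube z l) (\<lambda>x. orlicz_norm \<Phi> (cube z l) (w x)) \<le> ennreal B) \<longrightarrow>
      (\<lambda>(x, y). w x y) \<in> borel_measurable (lborel \<Otimes>\<^sub>M lborel) \<longrightarrow>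
      h \<in> borel_measurable borel \<longrightarrow> (\<forall>x. 0 \<le> h x) \<longrightarrow> (\<integral>\<^sup>+x. ennreal (h x powr p) \<partial>lebesgue) \<le> ennreal (c powr p) \<longrightarrow>
      dyadic_operator \<rho> \<theta> \<alpha> w h \<in> borel_measurable lebesgue \<and>
      (\<integral>\<^sup>+x. ennreal_powr (dyadic_operator \<rho> \<theta> \<alpha> w h x) q \<partial>lebesgue) \<le> ennreal ((C * B * c) powr q)"
    by (elim exE conjE) (rule that)
  have "(\<lambda>(t, x, y). k t x y) \<in> borel_measurable (lebesgue_on ({0<..} \<times> UNIV))"
    using assms(5) by (simp add: semigroup_kernel_def)
  from kernel_borel_representative[OF this] obtain k' where k': "(\<lambda>(t, x, y). k' t x y) \<in> borel_measurable borel"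
    and kk': "AE x in lborel. AE t in lborel. t > 0 \<longrightarrow> (AE y in lborel. k t x y = k' t x y)"
    by (elim exE conjE) (rule that)
  have k'_x: "(\<lambda>(t, y). k' t x y) \<in> borel_measurable (lborel \<Otimes>\<^sub>M lborel)" for x
  proof -
    have "(\<lambda>z. (fst z, x, snd z)) \<in> (lborel \<Otimes>\<^sub>M lborel) \<rightarrow>\<^sub>M (borel :: (real \<times> (real^'d) \<times> (real^'d)) measure)"
      unfolding borel_prod[symmetric] by measurable
    from measurable_compose[OF this k'] show ?thesis by (simp add: case_prod_unfold)
  qed
  have "frac_power_converges k \<alpha> f \<and> frac_power k \<alpha> f \<in> weighted_space q U \<and>
      weighted_norm q U (frac_power k \<alpha> f) \<le> ennreal (Ck * C) * bump_const \<rho> p q \<alpha> \<theta> \<Phi> \<Psi> U V * weighted_norm p (\<lambda>x. mpow (V x) (p / q)) f"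
    if U: "matrix_weight U" and V: "matrix_weight V" and bump: "bump_const \<rho> p q \<alpha> \<theta> \<Phi> \<Psi> U V < \<infinity>"
      and f: "f \<in> weighted_space p (\<lambda>x. mpow (V x) (p / q))"
    for U V :: "real^'d \<Rightarrow> complex^'n^'n" and f
  proof -
    obtain b where b: "bump_const \<rho> p q \<alpha> \<theta> \<Phi> \<Psi> U V = ennreal b" "b \<ge> 0"
      using bump by (cases "bump_const \<rho> p q \<alpha> \<theta> \<Phi> \<Psi> U V") auto
    define N where "N = weighted_norm p (\<lambda>x. mpow (V x) (p / q)) f"
    have N: "N < \<infinity>" and f_meas: "f \<in> borel_measurable lebesgue" using f by (auto simp: weighted_space_def N_def)
    obtain u where u: "u \<in> borel_measurable borel" "AE x in lborel. u x = mpow (U x) (1 / q)"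
      using matrix_weight_mpow_borel_representative[OF U] by blast
    obtain v where v: "v \<in> borel_measurable borel" "AE x in lborel. v x = mpow (V x) (- 1 / q)"
      using matrix_weight_mpow_borel_representative[OF V] by blast
    obtain v1 where v1: "v1 \<in> borel_measurable borel" "AE x in lborel. v1 x = mpow (V x) (1 / q)"
      using matrix_weight_mpow_borel_representative[OF V] by blast
    obtain f' where f': "f' \<in> borel_measurable borel" "AE x in lborel. f x = f' x"
      using lebesgue_measurable_borel_representative[OF f_meas] by blast
    have "AE x in lebesgue. pos_def (U x)" "AE x in lebesgue. pos_def (V x)"
      using U V by (simp_all add: matrix_weight_def)
    then have Upos: "AE x in lborel. pos_def (U x)" and Vpos: "AE x in lborel. pos_def (V x)"
      by (simp_all add: AE_completion_iff)
    define w where "w x y = ennreal (op_norm (u x ** v y))" for x y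
    define h where "h y = norm (v1 y *v f' y)" for y
    define G where "G = dyadic_operator \<rho> \<theta> \<alpha> w h"
    have w_meas: "(\<lambda>(x, y). w x y) \<in> borel_measurable (lborel \<Otimes>\<^sub>M lborel)"
    proof -
      have "(\<lambda>z. u (fst z)) \<in> borel_measurable (lborel \<Otimes>\<^sub>M lborel :: ((real^'d) \<times> (real^'d)) measure)"
        using u(1) by measurable
      moreover have "(\<lambda>z. v (snd z)) \<in> borel_measurable (lborel \<Otimes>\<^sub>M lborel :: ((real^'d) \<times> (real^'d)) measure)"
        using v(1) by measurable
      ultimately have "(\<lambda>z. op_norm (u (fst z) ** v (snd z))) \<in> borel_measurable (lborel \<Otimes>\<^sub>M lborel)"
        by (rule borel_measurable_op_norm_mult)
      then show ?thesis by (simp add: w_def case_prod_unfold)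
    qed
    have h_meas: "h \<in> borel_measurable borel"
      unfolding h_def using borel_measurable_matrix_vector[OF v1(1) f'(1)] by measurable
    have bump_w: "ennreal (measure lebesgue (cube z l) powr (\<alpha> / real CARD('d) + 1 / q - 1 / p) / psi \<rho> (\<theta> / 3) z l) *
        orlicz_norm \<Psi> (cube z l) (\<lambda>x. orlicz_norm \<Phi> (cube z l) (w x)) \<le> ennreal b" if "l > 0" for z l
      unfolding w_def b(1)[symmetric] by (rule bump_const_representative[OF u(2) v(2) that])
    \<comment> \<open>Since (V^(p/q))^(1/p) = V^(1/q), the p-norm of \<open>h\<close> is the
      weighted norm of \<open>f\<close>.\<close>
    have h_norm: "(\<integral>\<^sup>+x. ennreal (h x powr p) \<partial>lebesgue) \<le> ennreal (c powr p)" if c: "N < ennreal c" for c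
    proof -
      have "AE x in lborel. h x = norm (mpow (mpow (V x) (p / q)) (1 / p) *v f x)"
        using v1(2) f'(2) Vpos
      proof eventually_elim
        case (elim x)
        then show ?case using mpow_mpow[OF elim(3), of "p / q" "1 / p"] q by (simp add: h_def)
      qed
      then have "(\<integral>\<^sup>+x. ennreal (h x powr p) \<partial>lebesgue) = (\<integral>\<^sup>+x. ennreal (norm (mpow (mpow (V x) (p / q)) (1 / p) *v f x) powr p) \<partial>lebesgue)"
        by (intro nn_integral_cong_AE) (drule AE_completion, auto elim: eventually_mono)
      also have "\<dots> \<le> ennreal (c powr p)"
        using c q unfolding N_def weighted_norm_def by (intro ennreal_powr_less_imp_le) auto
      finally show ?thesis .
    qed
    have G: "G \<in> borel_measurable lebesgue" and
      G_int: "(\<integral>\<^sup>+x. ennreal_powr (G x) q \<partial>lebesgue) \<le> ennreal ((C * b * c) powr q)" if c: "N < ennreal c" for c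
    proof -
      have "c > 0" using c by (cases "c > 0") (auto simp: ennreal_neg)
      then have "G \<in> borel_measurable lebesgue \<and> (\<integral>\<^sup>+x. ennreal_powr (G x) q \<partial>lebesgue) \<le> ennreal ((C * b * c) powr q)"
        unfolding G_def
        by (intro strong[rule_format, OF b(2) _ bump_w w_meas h_meas _ h_norm[OF c]]) (simp_all add: h_def)
      then show "G \<in> borel_measurable lebesgue" "(\<integral>\<^sup>+x. ennreal_powr (G x) q \<partial>lebesgue) \<le> ennreal ((C * b * c) powr q)"
        by auto
    qed
    obtain c1 where c1: "N < ennreal c1"
    proof -
      obtain n where "N = ennreal n" "n \<ge> 0" using N by (cases N) auto
      then have "N < ennreal (n + 1)" by (simp add: ennreal_less_iff)
      then show ?thesis by (rule that)
    qed
    \<comment> \<open>An L^q bound makes \<open>G\<close> finite almost everywhere; at such points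
      the integrals that define the negative power converge absolutely.\<close>
    have G_fin: "AE x in lborel. G x < \<infinity>"
    proof -
      have "(\<integral>\<^sup>+x. ennreal_powr (G x) q \<partial>lebesgue) \<noteq> \<infinity>" using G_int[OF c1] by (auto simp: top_unique)
      moreover have "(\<lambda>x. ennreal_powr (G x) q) \<in> borel_measurable lebesgue"
        by (rule measurable_compose[OF G[OF c1] borel_measurable_ennreal_powr])
      ultimately have "AE x in lebesgue. ennreal_powr (G x) q \<noteq> \<infinity>" by (intro nn_integral_PInf_AE)
      then have "AE x in lborel. ennreal_powr (G x) q \<noteq> \<infinity>" by (simp add: AE_completion_iff)
      then show ?thesis by eventually_elim (auto simp: ennreal_powr_def less_top[symmetric])
    qed
    have K_le: "(\<integral>\<^sup>+t\<in>{0<..}. (\<integral>\<^sup>+y. ennreal (norm (k t x y) * t powr \<beta>) * (w x y * ennreal (h y)) \<partial>lebesgue) \<partial>lebesgue) \<le> ennreal Ck * G x" for x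
    proof -
      have "w x \<in> borel_measurable borel" using measurable_compose[OF measurable_Pair1' w_meas, of x] by simp
      then have "(\<lambda>y. w x y * ennreal (h y)) \<in> borel_measurable lborel" using h_meas by simp
      then have "(\<lambda>y. w x y * ennreal (h y)) \<in> borel_measurable lebesgue" by (rule measurable_completion)
      then show ?thesis unfolding G_def dyadic_operator_def by (rule kernel[rule_format])
    qed
    have main: "AE x in lborel. (\<forall>i. (AE t in lebesgue. t > 0 \<longrightarrow> integrable lebesgue (\<lambda>y. k t x y * f y $ i)) \<and>
        set_integrable lebesgue {0<..} (frac_integrand k \<alpha> (\<lambda>y. f y $ i) x)) \<and>
        ennreal (norm (mpow (U x) (1 / q) *v frac_power k \<alpha> f x)) \<le> ennreal Ck * G x"
      using kk' u(2) Upos G_fin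
    proof eventually_elim
      case (elim x)
      note kx = elim(1) and ux = elim(2) and Ux = elim(3) and Gx = elim(4)
      \<comment> \<open>The identity V(y)^(-1/q) V(y)^(1/q) is inserted between U(x)^(1/q) and
        f(y).\<close>
      have Uf: "AE y in lborel. norm (mpow (U x) (1 / q) *v f y) \<le> op_norm (u x ** v y) * h y"
        using v(2) v1(2) f'(2) Vpos
      proof eventually_elim
        case (elim y)
        have "v y ** v1 y = mat 1" using mpow_uminus_mult[OF elim(4), of "1 / q"] elim by simp
        then have "(u x ** v y) *v (v1 y *v f' y) = u x *v f y"
          using elim(3) by (simp add: matrix_vector_mul_assoc matrix_mul_assoc[symmetric])
        then show ?case using norm_matrix_vector_le_op_norm[of "u x ** v y" "v1 y *v f' y"] by (simp add: h_def ux)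
      qed
      \<comment> \<open>Used twice: with the identity matrix for absolute convergence, and with
        U(x)^(1/q) and a = 1 for the norm estimate.\<close>
      have bound_A: "(\<integral>\<^sup>+t\<in>{0<..}. (\<integral>\<^sup>+y. ennreal (norm (k t x y) * t powr \<beta>) * ennreal (norm (A *v f y)) \<partial>lebesgue) \<partial>lebesgue) \<le>
        ennreal a * (ennreal Ck * G x)"
        if a: "a > 0" and A: "\<And>z. norm (A *v z) \<le> a * norm (mpow (U x) (1 / q) *v z)" for A :: "complex^'n^'n" and a
      proof -
        have "AE y in lebesgue. norm (A *v f y) \<le> a * (op_norm (u x ** v y) * h y)"
          using AE_completion[OF Uf]
        proof eventually_elim
          case (elim y)
          then show ?case using A[of "f y"] a by (meson less_imp_le mult_left_mono order_trans)
        qed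
        then have "AE y in lebesgue. ennreal (norm (A *v f y)) \<le> ennreal a * (w x y * ennreal (h y))"
        proof eventually_elim
          case (elim y)
          from ennreal_leI[OF elim] show ?case
            using a op_norm_nonneg[of "u x ** v y"] by (simp add: w_def h_def ennreal_mult)
        qed
        then have inner: "(\<integral>\<^sup>+y. ennreal (norm (k t x y) * t powr \<beta>) * ennreal (norm (A *v f y)) \<partial>lebesgue) \<le>
            (\<integral>\<^sup>+y. ennreal a * (ennreal (norm (k t x y) * t powr \<beta>) * (w x y * ennreal (h y))) \<partial>lebesgue)" for t
        proof (intro nn_integral_mono_AE, eventually_elim)
          case (elim y)
          from mult_left_mono[OF elim(2), of "ennreal (norm (k t x y) * t powr \<beta>)"]
          show ?case by (simp add: mult.left_commute)
        qed
        have "(\<integral>\<^sup>+t\<in>{0<..}. (\<integral>\<^sup>+y. ennreal (norm (k t x y) * t powr \<beta>) * ennreal (norm (A *v f y)) \<partial>lebesgue) \<partial>lebesgue) \<le>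
          (\<integral>\<^sup>+t. ennreal a * ((\<integral>\<^sup>+y. ennreal (norm (k t x y) * t powr \<beta>) * (w x y * ennreal (h y)) \<partial>lebesgue) * indicator {0<..} t) \<partial>lebesgue)"
        proof (intro nn_integral_mono)
          fix t :: real
          have "(\<integral>\<^sup>+y. ennreal (norm (k t x y) * t powr \<beta>) * ennreal (norm (A *v f y)) \<partial>lebesgue) \<le>
            ennreal a * (\<integral>\<^sup>+y. ennreal (norm (k t x y) * t powr \<beta>) * (w x y * ennreal (h y)) \<partial>lebesgue)"
            by (rule order_trans[OF inner nn_integral_cmult_le[OF a]])
          from mult_right_mono[OF this, of "indicator {0<..} t"]
          show "(\<integral>\<^sup>+y. ennreal (norm (k t x y) * t powr \<beta>) * ennreal (norm (A *v f y)) \<partial>lebesgue) * indicator {0<..} t \<le>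
            ennreal a * ((\<integral>\<^sup>+y. ennreal (norm (k t x y) * t powr \<beta>) * (w x y * ennreal (h y)) \<partial>lebesgue) * indicator {0<..} t)"
            by (simp add: mult.assoc)
        qed
        also have "\<dots> \<le> ennreal a * (\<integral>\<^sup>+t\<in>{0<..}. (\<integral>\<^sup>+y. ennreal (norm (k t x y) * t powr \<beta>) * (w x y * ennreal (h y)) \<partial>lebesgue) \<partial>lebesgue)"
          by (rule nn_integral_cmult_le[OF a])
        also have "\<dots> \<le> ennreal a * (ennreal Ck * G x)" by (intro mult_left_mono K_le) simp
        finally show ?thesis .
      qed
      \<comment> \<open>The norm of U(x)^(-1/q), increased by 1 to be positive. It depends on x,
        which is harmless, as it enters only into the finiteness at x.\<close>
      define a where "a = op_norm (mpow (U x) (- (1 / q))) + 1"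
      have a: "a > 0" using op_norm_nonneg[of "mpow (U x) (- (1 / q))"] by (simp add: a_def)
      have "norm (mat 1 *v z) \<le> a * norm (mpow (U x) (1 / q) *v z)" for z
      proof -
        have "mat 1 *v z = mpow (U x) (- (1 / q)) *v (mpow (U x) (1 / q) *v z)"
          by (simp add: matrix_vector_mul_assoc mpow_uminus_mult[OF Ux])
        then have "norm (mat 1 *v z) \<le> op_norm (mpow (U x) (- (1 / q))) * norm (mpow (U x) (1 / q) *v z)"
          using norm_matrix_vector_le_op_norm by metis
        also have "\<dots> \<le> a * norm (mpow (U x) (1 / q) *v z)" by (intro mult_right_mono) (auto simp: a_def)
        finally show ?thesis .
      qed
      from bound_A[OF a this]
      have "(\<integral>\<^sup>+t\<in>{0<..}. (\<integral>\<^sup>+y. ennreal (norm (k t x y) * t powr \<beta>) * ennreal (norm (f y)) \<partial>lebesgue) \<partial>lebesgue) \<le> ennreal a * (ennreal Ck * G x)"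
        by simp
      also have "\<dots> < \<infinity>" using Gx by (simp add: ennreal_mult_less_top)
      finally have fin: "(\<integral>\<^sup>+t\<in>{0<..}. (\<integral>\<^sup>+y. ennreal (norm (k t x y) * t powr \<beta>) * ennreal (norm (f y)) \<partial>lebesgue) \<partial>lebesgue) < \<infinity>" .
      note bounds = iterated_integral_bounds[OF k'_x[of x] kx f' fin]
      have fp: "frac_power k \<alpha> f x = (\<chi> i. LINT t:{0<..}|lebesgue. (LINT y|lebesgue. k t x y * f y $ i) * complex_of_real (t powr \<beta>))"
        by (simp add: frac_power_def frac_integrand_def kernel_op_def \<beta>_def)
      have "ennreal (norm (mpow (U x) (1 / q) *v frac_power k \<alpha> f x)) \<le> ennreal 1 * (ennreal Ck * G x)"
        unfolding fp by (rule order_trans[OF bounds(3) bound_A]) auto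
      then show ?case
        using bounds(1,2) by (simp add: frac_integrand_def[abs_def] kernel_op_def \<beta>_def)
    qed
    have conv: "frac_power_converges k \<alpha> f"
      unfolding frac_power_converges_def using AE_completion[OF main] by (auto elim: eventually_mono)
    have fp_meas: "frac_power k \<alpha> f \<in> borel_measurable lebesgue"
    proof (rule borel_measurable_vecI)
      fix i
      have m: "(\<lambda>y. f' y $ i) \<in> borel_measurable borel" by (rule borel_measurable_vec_nth[OF f'(1)])
      have ae: "AE y in lborel. f y $ i = f' y $ i" using f'(2) by (auto elim: eventually_mono)
      show "(\<lambda>x. frac_power k \<alpha> f x $ i) \<in> borel_measurable lebesgue"
        using iterated_integral_measurable[OF k' kk' m ae] by (simp add: frac_power_def frac_integrand_def kernel_op_def)
    qed
    have norm_le: "weighted_norm q U (frac_power k \<alpha> f) \<le> (ennreal (Ck * C) * ennreal b) * ennreal c" if c: "N < ennreal c" for c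
    proof -
      have c0: "c > 0" using c by (cases "c > 0") (auto simp: ennreal_neg)
      have "(\<integral>\<^sup>+x. ennreal (norm (mpow (U x) (1 / q) *v frac_power k \<alpha> f x) powr q) \<partial>lebesgue) \<le>
        (\<integral>\<^sup>+x. ennreal (Ck powr q) * ennreal_powr (G x) q \<partial>lebesgue)"
        using AE_completion[OF main]
      proof (intro nn_integral_mono_AE, eventually_elim)
        case (elim x)
        then show ?case
          using ennreal_powr_mono[of "norm (mpow (U x) (1 / q) *v frac_power k \<alpha> f x)" "ennreal Ck * G x" q] q
          by (simp add: ennreal_powr_cmult[OF Ck])
      qed
      also have "\<dots> \<le> ennreal (Ck powr q) * (\<integral>\<^sup>+x. ennreal_powr (G x) q \<partial>lebesgue)"
        using Ck by (intro nn_integral_cmult_le) simp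
      also have "\<dots> \<le> ennreal (Ck powr q) * ennreal ((C * b * c) powr q)"
        by (intro mult_left_mono G_int[OF c]) simp
      also have "\<dots> = ennreal ((Ck * C * b * c) powr q)"
        using Ck C b c0 by (simp add: ennreal_mult[symmetric] powr_mult mult.assoc)
      finally have "weighted_norm q U (frac_power k \<alpha> f) \<le> ennreal (Ck * C * b * c)"
        unfolding weighted_norm_def using Ck C b c0 q by (intro ennreal_powr_le) auto
      then show ?thesis using Ck C b c0 by (simp add: ennreal_mult[symmetric])
    qed
    have "weighted_norm q U (frac_power k \<alpha> f) \<le> (ennreal (Ck * C) * ennreal b) * N"
      by (rule ennreal_le_mult_of_forall_gt[OF _ N norm_le]) (simp_all add: ennreal_mult_less_top)
    moreover have "weighted_norm q U (frac_power k \<alpha> f) < \<infinity>"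
      using norm_le[OF c1] by (rule le_less_trans) (simp add: ennreal_mult_less_top)
    ultimately show ?thesis using conv fp_meas by (simp add: weighted_space_def b(1) N_def)
  qed
  then show ?thesis using Ck C by (intro exI[of _ "Ck * C"]) auto
qed

end
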